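(* There is a constant $B>0$ such that, as $\alpha\to\infty$, $$F(\alpha) \ge 1 - \exp\Bigg(-\exp\bigg(\frac{B\alpha^{1/2}}{(\log \alpha)^{1/4}}\bigg)\bigg(\frac{2\log\log\alpha}{\log\alpha} + O\Big(\frac{1}{\log \alpha}\Big)\bigg)\Bigg).$$
   Context: For a Dirichlet character $\chi$ modulo $q$, let $S_\chi(t) = \sum_{1\le n \le t}\chi(n)$ and $M(\chi) = \max_{t} |S_\chi(t)|$. Let $\chi_0$ be the principal character modulo $q$ and $\phi$ Euler's function. Define $$F_q(\alpha) = \frac{1}{\phi(q) - 1}\#\{\chi \bmod q : \chi \ne \chi_0,\ M(\chi) \le \alpha \sqrt{q}\}, \qquad F(\alpha) = \liminf_{q \to \infty} F_q(\alpha),$$ where $q$ runs over all positive integers (with $\phi(q)>1$). *)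

theory Defs
  imports
    Complex_Main
    "HOL-Library.Extended_Real"
    "HOL-Library.Liminf_Limsup"
    "HOL-Library.Landau_Symbols"
    "HOL-Number_Theory.Totient"
begin

definition dirichlet_char :: "nat \<Rightarrow> (nat \<Rightarrow> complex) \<Rightarrow> bool" where
  "dirichlet_char q \<chi> \<longleftrightarrow>
     \<chi> 1 = 1 \<and>
     (\<forall>m n. \<chi> (m * n) = \<chi> m * \<chi> n) \<and>
     (\<forall>n. \<chi> (n + q) = \<chi> n) \<and>
     (\<forall>n. \<chi> n \<noteq> 0 \<longleftrightarrow> coprime n q)"

definition principal_char :: "nat \<Rightarrow> nat \<Rightarrow> complex" where
  "principal_char q n = (if coprime n q then 1 else 0)"

definition char_sum :: "(nat \<Rightarrow> complex) \<Rightarrow> real \<Rightarrow> complex" where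
  "char_sum \<chi> t = (\<Sum>n | 1 \<le> n \<and> real n \<le> t. \<chi> n)"

text \<open>For a non-principal character modulo \<open>q > 0\<close> the function \<open>char_sum \<chi>\<close> takes only finitely
  many values, so the supremum is a maximum. It is a junk value for principal characters, which
  are excluded below.\<close>

definition max_char_sum :: "(nat \<Rightarrow> complex) \<Rightarrow> real" where
  "max_char_sum \<chi> = (SUP t::real. cmod (char_sum \<chi> t))"

definition F_mod :: "nat \<Rightarrow> real \<Rightarrow> real" where
  "F_mod q \<alpha> =
     real (card {\<chi>. dirichlet_char q \<chi> \<and> \<chi> \<noteq> principal_char q \<and>
                    max_char_sum \<chi> \<le> \<alpha> * sqrt (real q)})
       / (real (totient q) - 1)"

text \<open>The limit inferior is taken in the complete lattice of extended reals, along the moduli with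
  more than one character; since \<open>0 \<le> F_mod q \<alpha> \<le> 1\<close> for these, the value is a real number.\<close>

definition F_lim :: "real \<Rightarrow> ereal" where
  "F_lim \<alpha> =
     Liminf (inf sequentially (principal {q. totient q > 1})) (\<lambda>q. ereal (F_mod q \<alpha>))"

end

theory Submission
  imports Defs "HOL-Number_Theory.Residues" "HOL-Real_Asymp.Real_Asymp"
begin

text \<open>
  For primitive \<open>\<chi>\<close> modulo \<open>d\<close>, finite Fourier expansion writes a partial sum, divided by
  \<open>sqrt d\<close>, as a sum of \<open>cnj (\<chi> b) * a b\<close> with \<open>cmod (a b) \<le> 1 / b\<close>. The terms with
  \<open>b \<le> 2 ^ J1\<close> contribute at most \<open>1 + J1\<close>. A dyadic block with \<open>b\<close> between \<open>2 ^ J1\<close> and about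
  \<open>d powr (2/3)\<close> is small for most \<open>\<chi>\<close>: its \<open>2m\<close>-th moment counts congruences between products
  of \<open>m\<close> factors, hence is controlled by the \<open>m\<close>-fold divisor function, and a grid takes care of
  the supremum over the length of the partial sum. The remaining terms are small for every \<open>\<chi>\<close> by
  the Polya-Vinogradov argument. With \<open>J1\<close> a small multiple of \<open>\<alpha>\<close> one can take
  \<open>(ln m)\<^sup>2\<close> as large as a constant times \<open>J1\<close>, and the proportion of exceptions is at
  most \<open>exp (- m)\<close>. A character induced from a modulus \<open>d = q / r\<close> gains a factor
  \<open>r powr (1/4)\<close>, and Markov's inequality turns this into a convergent sum over \<open>r\<close>.
\<close>

section \<open>Counting Dirichlet characters\<close>

text \<open>The divisor function decides how large \<open>m\<close> may be. Up to a factor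
  \<open>m ^ O(m)\<close>, an integer \<open>l\<close> has at most
  \<open>l powr (1 - 1 / ln m)\<close> factorizations into \<open>m\<close> ordered factors. At a
  block \<open>2 ^ j\<close> the moment thus gains about \<open>2 powr (j * m / ln m)\<close>, which
  beats \<open>m ^ O(m)\<close> and \<open>j ^ (4 * m + 2)\<close> once \<open>j\<close> exceeds a
  large multiple of \<open>(ln m) ^ 2\<close>: hence the square. This allows \<open>ln m\<close> of
  order \<open>sqrt \<alpha>\<close>; the factor \<open>(ln \<alpha>) powr (1/4)\<close> of the
  theorem leaves room for all numerical constants. Products of \<open>m\<close> factors may exceed
  the modulus. Since the blocks grow with \<open>d\<close> while \<open>m\<close> is fixed, the gain
  above does not control the off-diagonal term. A second divisor bound with exponent
  \<open>1 / (8 * m)\<close> does; its constant is enormous in terms of \<open>m\<close>, but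
  \<alpha> is fixed before \<open>q\<close> tends to infinity. \<open>F_mod\<close> counts the good
  characters, which calls for a lower bound on the number of all characters. It is built by
  adjoining one unit at a time, bypassing the structure of the unit group.\<close>

definition unit_subgroup :: "nat \<Rightarrow> nat set \<Rightarrow> bool" where
  "unit_subgroup q H \<longleftrightarrow> 1 \<in> H \<and> (\<forall>a\<in>H. coprime a q) \<and> (\<forall>a\<in>H. \<forall>b\<in>H. a * b \<in> H) \<and>
     (\<forall>a\<in>H. \<forall>b. [a = b] (mod q) \<longrightarrow> b \<in> H)"

text \<open>A subgroup of the units modulo \<open>q\<close> and its characters are described on
  natural numbers, saturated under congruence. Inverses have no clause in
  \<open>unit_subgroup\<close> because by Euler's theorem they are powers. Extension by zero makes
  equality of functions the same as equality on \<open>H\<close>, so that characters can be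
  counted.\<close>

definition subgroup_chars :: "nat \<Rightarrow> nat set \<Rightarrow> (nat \<Rightarrow> complex) set" where
  "subgroup_chars q H = {f. (\<forall>n. n \<notin> H \<longrightarrow> f n = 0) \<and> f 1 = 1 \<and>
     (\<forall>a\<in>H. \<forall>b\<in>H. f (a * b) = f a * f b) \<and> (\<forall>a b. [a = b] (mod q) \<longrightarrow> f a = f b)}"

lemma unit_subgroup_power:
  assumes "unit_subgroup q H" "a \<in> H"
  shows "a ^ k \<in> H"
  using assms by (induction k) (auto simp: unit_subgroup_def)

lemma subgroup_chars_power:
  assumes "unit_subgroup q H" "f \<in> subgroup_chars q H" "a \<in> H"
  shows "f (a ^ k) = f a ^ k"
proof (induction k)
  case 0 show ?case using assms by (simp add: subgroup_chars_def)
next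
  case (Suc k)
  have "a ^ k \<in> H" using unit_subgroup_power assms by blast
  then show ?case using Suc assms by (simp add: subgroup_chars_def)
qed

text \<open>Division inside \<open>H\<close>: multiplication by \<open>h ^ (totient q - 1)\<close>
  undoes multiplication by \<open>h\<close>.\<close>

lemma unit_subgroup_cancel:
  assumes H: "unit_subgroup q H" and h: "h \<in> H" and c: "[h * x = h'] (mod q)" and h': "h' \<in> H"
  shows "x \<in> H"
proof -
  have "coprime h q" using H h by (auto simp: unit_subgroup_def)
  then have e: "[h ^ totient q = 1] (mod q)" by (rule euler_theorem)
  have "[h ^ totient q * x = x] (mod q)" using cong_mult[OF e cong_refl, of x] by simp
  show ?thesis
  proof (cases "totient q = 0")
    \<comment> \<open>Only \<open>q = 0\<close> has totient \<open>0\<close>; congruence is then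
      equality and \<open>1\<close> is the only unit.\<close>
    case True
    then have "q = 0" by simp
    then have "h = 1" using \<open>coprime h q\<close> by simp
    then show ?thesis using c h' \<open>q = 0\<close> by (simp add: Cong.cong_def)
  next
    case False
    then have "h ^ totient q * x = h ^ (totient q - 1) * (h * x)"
      by (metis mult.assoc power_minus_mult neq0_conv)
    moreover have "[h ^ (totient q - 1) * (h * x) = h ^ (totient q - 1) * h'] (mod q)"
      using c by (rule cong_mult[OF cong_refl])
    moreover have "h ^ (totient q - 1) * h' \<in> H"
      using unit_subgroup_power[OF H h] H h' by (auto simp: unit_subgroup_def)
    ultimately show ?thesis
      using H \<open>[h ^ totient q * x = x] (mod q)\<close> unfolding unit_subgroup_def by (metis cong_sym)
  qed
qed

lemma subgroup_chars_nonzero: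
  assumes H: "unit_subgroup q H" and f: "f \<in> subgroup_chars q H" and a: "a \<in> H" and "q > 0"
  shows "f a ^ totient q = 1"
proof -
  have "[a ^ totient q = 1] (mod q)" using H a by (intro euler_theorem) (auto simp: unit_subgroup_def)
  then have "f (a ^ totient q) = f 1" using f unfolding subgroup_chars_def by blast
  then show ?thesis using subgroup_chars_power[OF H f a] f by (simp add: subgroup_chars_def)
qed

lemma finite_subgroup_chars:
  assumes H: "unit_subgroup q H" and q: "q > 0"
  shows "finite (subgroup_chars q H)"
proof -
  define V where "V = insert 0 {z::complex. z ^ totient q = 1}"
  have tq: "totient q > 0" using q by simp
  have "finite V" unfolding V_def using finite_nth_roots[OF tq, of 1] by simp
  then have fin: "finite (PiE {..<q} (\<lambda>_. V))" by (intro finite_PiE) auto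
  have "inj_on (\<lambda>f. restrict f {..<q}) (subgroup_chars q H)"
  proof (rule inj_onI)
    fix f g assume f: "f \<in> subgroup_chars q H" and g: "g \<in> subgroup_chars q H"
      and eq: "restrict f {..<q} = restrict g {..<q}"
    show "f = g"
    proof
      fix n
      have "[n = n mod q] (mod q)" by (simp add: Cong.cong_def)
      then have "f n = f (n mod q)" "g n = g (n mod q)" using f g unfolding subgroup_chars_def by blast+
      moreover have "f (n mod q) = g (n mod q)"
        using fun_cong[OF eq, of "n mod q"] q by (simp add: restrict_def)
      ultimately show "f n = g n" by simp
    qed
  qed
  moreover have "(\<lambda>f. restrict f {..<q}) ` subgroup_chars q H \<subseteq> PiE {..<q} (\<lambda>_. V)"
  proof clarify
    fix f assume f: "f \<in> subgroup_chars q H"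
    have "f n \<in> V" for n
      using subgroup_chars_nonzero[OF H f _ q, of n] f by (cases "n \<in> H") (auto simp: V_def subgroup_chars_def)
    then show "restrict f {..<q} \<in> PiE {..<q} (\<lambda>_. V)" by auto
  qed
  ultimately show ?thesis using fin by (meson finite_imageD finite_subset)
qed

text \<open>An extension to the subgroup generated by \<open>H\<close> and \<open>g\<close> is determined by an \<open>n\<close>-th root \<open>z\<close>
  of \<open>f (g ^ n)\<close>. Since every root occurs, the number of characters grows at least as fast as the subgroup.\<close>

lemma subgroup_char_extend:
  assumes H: "unit_subgroup q H" and q: "q > 0" and g: "coprime g q" and n0: "n > 0"
    and n: "g ^ n \<in> H" and nmin: "\<And>k. 0 < k \<Longrightarrow> k < n \<Longrightarrow> g ^ k \<notin> H"
    and f: "f \<in> subgroup_chars q H" and z: "z ^ n = f (g ^ n)"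
  defines "H' \<equiv> {x. \<exists>h\<in>H. \<exists>i. [x = h * g ^ i] (mod q)}"
  obtains f' where "f' \<in> subgroup_chars q H'"
    "\<And>x h i. h \<in> H \<Longrightarrow> [x = h * g ^ i] (mod q) \<Longrightarrow> f' x = f h * z ^ i"
proof -
  \<comment> \<open>By minimality \<open>n\<close> is the order of \<open>g\<close> modulo
    \<open>H\<close>, so it divides every exponent that leads into \<open>H\<close>.\<close>
  have dvd: "n dvd k" if "g ^ k \<in> H" for k
  proof -
    have "(g ^ n) ^ (k div n) * g ^ (k mod n) = g ^ k"
      by (metis power_add power_mult mult_div_mod_eq)
    then have "g ^ (k mod n) \<in> H"
      using unit_subgroup_cancel[OF H unit_subgroup_power[OF H n], of _ "g ^ (k mod n)" "g ^ k"] that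
      by (metis cong_refl)
    then have "k mod n = 0" using nmin n0 mod_less_divisor by blast
    then show ?thesis by auto
  qed
  have val: "f (g ^ k) = z ^ k" if gk: "g ^ k \<in> H" for k
  proof -
    obtain s where s: "k = n * s" using dvd[OF gk] by (auto elim: dvdE)
    show ?thesis unfolding s using subgroup_chars_power[OF H f n] z by (simp add: power_mult)
  qed
  \<comment> \<open>The value \<open>f h * z ^ i\<close> must not depend on the representation of
    the residue class. Two representations differ by a power of \<open>g\<close> lying in
    \<open>H\<close>, where \<open>val\<close> fixes the value.\<close>
  have uniq1: "f h * z ^ i = f h' * z ^ j"
    if h: "h \<in> H" "h' \<in> H" and c: "[h * g ^ i = h' * g ^ j] (mod q)" and le: "i \<le> j" for h h' i j
  proof -
    have "[h * g ^ i = (h' * g ^ (j - i)) * g ^ i] (mod q)"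
      using c le by (simp add: mult.assoc flip: power_add)
    moreover have "coprime (g ^ i) q" using g by simp
    ultimately have c': "[h = h' * g ^ (j - i)] (mod q)"
      using cong_mult_rcancel_nat by blast
    then have gH: "g ^ (j - i) \<in> H" using unit_subgroup_cancel[OF H h(2)] h(1) cong_sym by blast
    have "f h = f (h' * g ^ (j - i))" using c' f unfolding subgroup_chars_def by blast
    also have "\<dots> = f h' * z ^ (j - i)" using f gH h(2) val[OF gH] by (simp add: subgroup_chars_def)
    finally show ?thesis using le by (simp add: mult.assoc flip: power_add)
  qed
  have uniq: "f h * z ^ i = f h' * z ^ j"
    if h: "h \<in> H" "h' \<in> H" and c: "[h * g ^ i = h' * g ^ j] (mod q)" for h h' i j
    using uniq1[OF h c] uniq1[OF h(2,1) cong_sym[OF c]] by (cases "i \<le> j") auto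
  define f' where "f' x = (if x \<in> H' then
      (SOME y. \<exists>h\<in>H. \<exists>i. [x = h * g ^ i] (mod q) \<and> y = f h * z ^ i) else 0)" for x
  have f': "f' x = f h * z ^ i" if h: "h \<in> H" and c: "[x = h * g ^ i] (mod q)" for x h i
  proof -
    have "x \<in> H'" using h c by (auto simp: H'_def)
    let ?P = "\<lambda>y. \<exists>h\<in>H. \<exists>i. [x = h * g ^ i] (mod q) \<and> y = f h * z ^ i"
    have "?P (SOME y. ?P y)" by (rule someI[of ?P "f h * z ^ i"]) (use h c in auto)
    then obtain h' j where "h' \<in> H" "[x = h' * g ^ j] (mod q)" "f' x = f h' * z ^ j"
      using \<open>x \<in> H'\<close> unfolding f'_def by auto
    then show ?thesis using uniq[OF h, of h' i j] c by (metis cong_sym cong_trans)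
  qed
  have "f' \<in> subgroup_chars q H'"
    unfolding subgroup_chars_def
  proof (intro CollectI conjI ballI allI impI)
    fix x assume "x \<notin> H'" then show "f' x = 0" by (simp add: f'_def)
  next
    show "f' 1 = 1" using f'[of 1 1 0] H f by (auto simp: unit_subgroup_def subgroup_chars_def)
  next
    fix a b assume "a \<in> H'" "b \<in> H'"
    then obtain h i h' j where *: "h \<in> H" "[a = h * g ^ i] (mod q)" "h' \<in> H" "[b = h' * g ^ j] (mod q)"
      by (auto simp: H'_def)
    then have "[a * b = (h * h') * g ^ (i + j)] (mod q)"
      using cong_mult[OF *(2) *(4)] by (simp add: power_add mult_ac)
    moreover have "h * h' \<in> H" using H * by (auto simp: unit_subgroup_def)
    ultimately show "f' (a * b) = f' a * f' b"
      using f'[of "h * h'" "a * b" "i + j"] f'[of h a i] f'[of h' b j] * f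
      by (simp add: subgroup_chars_def power_add)
  next
    fix a b assume ab: "[a = b] (mod q)"
    show "f' a = f' b"
    proof (cases "a \<in> H'")
      case True
      then obtain h i where "h \<in> H" "[a = h * g ^ i] (mod q)" by (auto simp: H'_def)
      then show ?thesis using f' ab by (metis cong_sym cong_trans)
    next
      case False
      then have "b \<notin> H'" using ab unfolding H'_def by simp (metis cong_trans)
      with False show ?thesis by (simp add: f'_def)
    qed
  qed
  then show thesis using f' that by blast
qed

text \<open>Adjoining \<open>g\<close>, of order \<open>n\<close> modulo \<open>H\<close>, preserves
  the inequality: every residue of \<open>H'\<close> is some \<open>h * g ^ i\<close> with
  \<open>i < n\<close>, so their number grows at most by the factor \<open>n\<close>, while the
  \<open>n\<close> roots \<open>z\<close> belonging to each \<open>f\<close> yield different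
  extensions.\<close>

lemma unit_subgroup_extend:
  assumes H: "unit_subgroup q H" and q: "q > 0" and g: "coprime g q" "g \<notin> H"
    and card: "card (H \<inter> {..<q}) \<le> card (subgroup_chars q H)"
  defines "H' \<equiv> {x. \<exists>h\<in>H. \<exists>i. [x = h * g ^ i] (mod q)}"
  shows "unit_subgroup q H'" "H \<subset> H'" "card (H' \<inter> {..<q}) \<le> card (subgroup_chars q H')"
proof -
  show H': "unit_subgroup q H'"
    unfolding unit_subgroup_def
  proof (intro conjI ballI allI impI)
    show "1 \<in> H'" using H unfolding H'_def unit_subgroup_def
      by (intro CollectI bexI[of _ 1] exI[of _ 0]) auto
  next
    fix a assume "a \<in> H'"
    then obtain h i where "h \<in> H" "[a = h * g ^ i] (mod q)" by (auto simp: H'_def)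
    moreover from this have "coprime (h * g ^ i) q" using H g by (auto simp: unit_subgroup_def)
    ultimately show "coprime a q" by (metis cong_imp_coprime cong_sym)
  next
    fix a b assume "a \<in> H'" "b \<in> H'"
    then obtain h i h' j where *: "h \<in> H" "[a = h * g ^ i] (mod q)" "h' \<in> H" "[b = h' * g ^ j] (mod q)"
      by (auto simp: H'_def)
    then have "[a * b = (h * h') * g ^ (i + j)] (mod q)"
      using cong_mult[OF *(2) *(4)] by (simp add: power_add mult_ac)
    moreover have "h * h' \<in> H" using H * by (auto simp: unit_subgroup_def)
    ultimately show "a * b \<in> H'" by (auto simp: H'_def)
  next
    fix a b assume "a \<in> H'" "[a = b] (mod q)"
    then show "b \<in> H'" unfolding H'_def by simp (metis cong_sym cong_trans)
  qed
  have "H \<subseteq> H'" unfolding H'_def by (auto intro!: bexI exI[of _ 0])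
  moreover have "g \<in> H'" using H unfolding H'_def unit_subgroup_def
    by (intro CollectI bexI[of _ 1] exI[of _ 1]) auto
  ultimately show "H \<subset> H'" using g by auto
  define n where "n = (LEAST n. 0 < n \<and> g ^ n \<in> H)"
  have "[g ^ totient q = 1] (mod q)" by (rule euler_theorem[OF g(1)])
  then have "g ^ totient q \<in> H" using H unfolding unit_subgroup_def by (metis cong_sym)
  then have ex: "\<exists>n. 0 < n \<and> g ^ n \<in> H" using q by (intro exI[of _ "totient q"]) auto
  have n: "0 < n" "g ^ n \<in> H" using LeastI_ex[OF ex] unfolding n_def by auto
  have nmin: "g ^ k \<notin> H" if "0 < k" "k < n" for k
    using not_less_Least[of k] that unfolding n_def by blast
  have "H' \<inter> {..<q} \<subseteq> (\<lambda>(h, i). (h * g ^ i) mod q) ` ((H \<inter> {..<q}) \<times> {..<n})"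
  proof
    fix x assume x: "x \<in> H' \<inter> {..<q}"
    then obtain h i where h: "h \<in> H" "[x = h * g ^ i] (mod q)" by (auto simp: H'_def)
    \<comment> \<open>Full powers of \<open>g ^ n\<close> lie in \<open>H\<close> and are absorbed
      into the first factor; only \<open>g ^ (i mod n)\<close> remains.\<close>
    let ?h = "(h * (g ^ n) ^ (i div n)) mod q"
    have "h * (g ^ n) ^ (i div n) \<in> H" using H h unit_subgroup_power[OF H n(2)]
      by (auto simp: unit_subgroup_def)
    then have hH: "?h \<in> H" using H unfolding unit_subgroup_def
      by (metis cong_mod_right cong_refl)
    have "x = x mod q" using x by simp
    also have "\<dots> = (h * g ^ i) mod q" using h by (simp add: Cong.cong_def)
    also have "h * g ^ i = h * (g ^ n) ^ (i div n) * g ^ (i mod n)"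
      by (metis power_add power_mult mult_div_mod_eq mult.assoc)
    also have "\<dots> mod q = (?h * g ^ (i mod n)) mod q" by (simp add: mod_mult_left_eq)
    finally show "x \<in> (\<lambda>(h, i). (h * g ^ i) mod q) ` ((H \<inter> {..<q}) \<times> {..<n})"
      using hH q n(1) by (intro image_eqI[of _ _ "(?h, i mod n)"]) auto
  qed
  then have "card (H' \<inter> {..<q}) \<le> card ((H \<inter> {..<q}) \<times> {..<n})"
    by (meson card_image_le card_mono finite_Int finite_SigmaI finite_imageI finite_lessThan order_trans)
  then have c1: "card (H' \<inter> {..<q}) \<le> card (H \<inter> {..<q}) * n" by simp
  define R where "R f = {z::complex. z ^ n = f (g ^ n)}" for f :: "nat \<Rightarrow> complex"
  have cardR: "card (R f) = n" if "f \<in> subgroup_chars q H" for f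
  proof -
    have "f (g ^ n) \<noteq> 0" using subgroup_chars_nonzero[OF H that n(2) q] q by (metis power_eq_0_iff totient_gt_0_iff zero_neq_one zero_power)
    then show ?thesis unfolding R_def using card_nth_roots n(1) by blast
  qed
  have "\<forall>p\<in>Sigma (subgroup_chars q H) R. \<exists>f'. f' \<in> subgroup_chars q H' \<and>
      (\<forall>x. \<forall>h\<in>H. \<forall>i. [x = h * g ^ i] (mod q) \<longrightarrow> f' x = fst p h * snd p ^ i)"
  proof
    fix p assume p: "p \<in> Sigma (subgroup_chars q H) R"
    have "fst p \<in> subgroup_chars q H" "snd p ^ n = fst p (g ^ n)" using p by (auto simp: R_def)
    from subgroup_char_extend[OF H q g(1) n nmin this]
    obtain f' where "f' \<in> subgroup_chars q H'"
      "\<And>x h i. h \<in> H \<Longrightarrow> [x = h * g ^ i] (mod q) \<Longrightarrow> f' x = fst p h * snd p ^ i"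
      unfolding H'_def by blast
    then show "\<exists>f'. f' \<in> subgroup_chars q H' \<and>
      (\<forall>x. \<forall>h\<in>H. \<forall>i. [x = h * g ^ i] (mod q) \<longrightarrow> f' x = fst p h * snd p ^ i)" by blast
  qed
  from bchoice[OF this] obtain E where E: "\<forall>p\<in>Sigma (subgroup_chars q H) R. E p \<in> subgroup_chars q H' \<and>
      (\<forall>x. \<forall>h\<in>H. \<forall>i. [x = h * g ^ i] (mod q) \<longrightarrow> E p x = fst p h * snd p ^ i)" ..
  have E1: "E (f, z) \<in> subgroup_chars q H'" if "f \<in> subgroup_chars q H" "z \<in> R f" for f z
    using E that by blast
  have E2: "E (f, z) x = f h * z ^ i"
    if "f \<in> subgroup_chars q H" "z \<in> R f" "h \<in> H" "[x = h * g ^ i] (mod q)" for f z x h i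
    using bspec[OF E, of "(f, z)"] that by simp
  \<comment> \<open>An extension remembers \<open>f\<close> by its values on \<open>H\<close>
    (exponent \<open>0\<close>) and \<open>z\<close> by its value at \<open>g\<close>.\<close>
  have "inj_on E (Sigma (subgroup_chars q H) R)"
  proof (rule inj_onI, clarify)
    fix f z f2 z2 assume a: "f \<in> subgroup_chars q H" "z \<in> R f" "f2 \<in> subgroup_chars q H" "z2 \<in> R f2"
      and eq: "E (f, z) = E (f2, z2)"
    have "f h = f2 h" for h
    proof (cases "h \<in> H")
      case True
      then show ?thesis using E2[OF a(1,2) True, of h 0] E2[OF a(3,4) True, of h 0] eq by simp
    next
      case False
      then show ?thesis using a by (simp add: subgroup_chars_def)
    qed
    moreover have "z = z2"
    proof -
      have "1 \<in> H" using H by (simp add: unit_subgroup_def)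
      then show ?thesis using E2[OF a(1,2), of 1 g 1] E2[OF a(3,4), of 1 g 1] eq a
        by (simp add: subgroup_chars_def)
    qed
    ultimately show "f = f2 \<and> z = z2" by auto
  qed
  then have "card (Sigma (subgroup_chars q H) R) \<le> card (subgroup_chars q H')"
    using E1 by (intro card_inj_on_le[OF _ _ finite_subgroup_chars[OF H' q]]) auto
  moreover have "card (Sigma (subgroup_chars q H) R) = card (subgroup_chars q H) * n"
    using cardR finite_subgroup_chars[OF H q] n(1) by (subst card_SigmaI) (auto intro: card_ge_0_finite)
  ultimately show "card (H' \<inter> {..<q}) \<le> card (subgroup_chars q H')"
    using c1 mult_le_mono1[OF card, of n] by linarith
qed

lemma card_coprime_lessThan:
  assumes q: "q > 0"
  shows "card ({n. coprime n q} \<inter> {..<q}) = totient q"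
\<comment> \<open>\<open>totatives\<close> lies in \<open>1..q\<close>, the residues in
  \<open>0..<q\<close>. For \<open>q = 1\<close> the two sets differ, although both have one
  element.\<close>
proof (cases "q = 1")
  case True
  then have "{n. coprime n q} \<inter> {..<q} = {0}" by auto
  then show ?thesis using True by simp
next
  case False
  then have "n > 0" if "coprime n q" for n using that by (intro Nat.gr0I) simp
  moreover have "n \<noteq> q" if "coprime n q" for n using that False by auto
  ultimately have "{n. coprime n q} \<inter> {..<q} = totatives q"
    by (auto simp: totatives_def order.order_iff_strict)
  then show ?thesis by (simp add: totient_def)
qed

text \<open>Among the subgroups satisfying the inequality of \<open>unit_subgroup_extend\<close>,
  take one with the most residues. If a unit were missing, adjoining it would give a larger one. The
  class of \<open>1\<close> shows that there is something to choose from.\<close>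

lemma totient_le_card_subgroup_chars:
  assumes q: "q > 0"
  shows "totient q \<le> card (subgroup_chars q {n. coprime n q})"
proof -
  have fin: "finite {k. \<exists>H. unit_subgroup q H \<and> card (H \<inter> {..<q}) \<le> card (subgroup_chars q H) \<and> k = card (H \<inter> {..<q})}"
    (is "finite ?K")
  proof (rule finite_subset)
    have "card (H \<inter> {..<q}) \<le> q" for H
      using card_mono[of "{..<q}" "H \<inter> {..<q}"] by simp
    then show "?K \<subseteq> {..q}" by auto
  qed auto
  define H0 where "H0 = {n. [n = 1] (mod q)}"
  have "unit_subgroup q H0" unfolding unit_subgroup_def H0_def
    using cong_mult[of _ 1 q _ 1] cong_imp_coprime[of 1 _ q]
    by (simp add: cong_sym_eq) (metis cong_sym cong_trans)
  moreover have "card (H0 \<inter> {..<q}) \<le> 1"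
  proof -
    have "H0 \<inter> {..<q} \<subseteq> {1 mod q}" by (auto simp: H0_def Cong.cong_def)
    then show ?thesis by (metis card_mono finite.emptyI finite.insertI is_singletonI is_singleton_altdef)
  qed
  moreover have "(\<lambda>n. if n \<in> H0 then 1 else 0) \<in> subgroup_chars q H0"
    using \<open>unit_subgroup q H0\<close> unfolding subgroup_chars_def unit_subgroup_def
    by (auto simp: cong_sym_eq)
  moreover from this have "card (subgroup_chars q H0) \<ge> 1"
    using finite_subgroup_chars[OF \<open>unit_subgroup q H0\<close> q] by (metis One_nat_def Suc_leI card_gt_0_iff empty_iff)
  ultimately have "card (H0 \<inter> {..<q}) \<in> ?K" by fastforce
  then have "Max ?K \<in> ?K" using Max_in[OF fin] by blast
  then obtain H where H: "unit_subgroup q H" and c: "card (H \<inter> {..<q}) \<le> card (subgroup_chars q H)"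
    and mx: "Max ?K = card (H \<inter> {..<q})" by blast
  have "H = {n. coprime n q}"
  proof (rule ccontr)
    assume "H \<noteq> {n. coprime n q}"
    moreover have "H \<subseteq> {n. coprime n q}" using H by (auto simp: unit_subgroup_def)
    ultimately obtain g where g: "coprime g q" "g \<notin> H" by blast
    define H' where "H' = {x. \<exists>h\<in>H. \<exists>i. [x = h * g ^ i] (mod q)}"
    note * = unit_subgroup_extend[OF H q g c, folded H'_def]
    have inK: "card (H' \<inter> {..<q}) \<in> ?K" using * by blast
    have le: "card (H' \<inter> {..<q}) \<le> card (H \<inter> {..<q})" using Max_ge[OF fin inK] mx by simp
    have "H \<inter> {..<q} \<subseteq> H' \<inter> {..<q}" using *(2) by auto
    \<comment> \<open>Having the same residues below \<open>q\<close> forces \<open>H\<close> and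
      \<open>H'\<close> to coincide, because both are saturated under congruence.\<close>
    then have eq: "H \<inter> {..<q} = H' \<inter> {..<q}" using le by (meson card_seteq finite_Int finite_lessThan)
    obtain x where x: "x \<in> H'" "x \<notin> H" using *(2) by auto
    have "x mod q \<in> H'" using x *(1) unfolding unit_subgroup_def by (metis cong_mod_right cong_refl)
    then have "x mod q \<in> H' \<inter> {..<q}" using q by simp
    then have "x mod q \<in> H" using eq by blast
    moreover have "[x mod q = x] (mod q)" by simp
    ultimately have "x \<in> H" using H unfolding unit_subgroup_def by blast
    then show False using x by simp
  qed
  then show ?thesis using c card_coprime_lessThan[OF q] by simp
qed

section \<open>Dirichlet characters as characters of the unit group\<close>

lemma dirichlet_char_cong:
  assumes "dirichlet_char q \<chi>" "[a = b] (mod q)"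
  shows "\<chi> a = \<chi> b"
proof -
  have per: "\<chi> (a + k * q) = \<chi> a" for a k
    using assms(1) by (induction k) (simp_all add: dirichlet_char_def, metis add.assoc add.commute)
  have "\<chi> a = \<chi> (a mod q)" for a using per[of "a mod q" "a div q"] by simp
  then show ?thesis using assms(2) unfolding Cong.cong_def by metis
qed

lemma unit_subgroup_coprime: "unit_subgroup q {n. coprime n q}"
  unfolding unit_subgroup_def using cong_imp_coprime by fastforce

lemma dirichlet_chars_eq:
  assumes q: "q > 0"
  shows "{\<chi>. dirichlet_char q \<chi>} = subgroup_chars q {n. coprime n q}"
proof (intro Set.set_eqI iffI)
  fix f assume "f \<in> {\<chi>. dirichlet_char q \<chi>}"
  then have f: "dirichlet_char q f" by simp
  then show "f \<in> subgroup_chars q {n. coprime n q}"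
    using dirichlet_char_cong[OF f] unfolding subgroup_chars_def dirichlet_char_def by blast
next
  fix f assume f: "f \<in> subgroup_chars q {n. coprime n q}"
  then have f0: "\<And>n. \<not> coprime n q \<Longrightarrow> f n = 0" and f1: "f 1 = 1"
    and fm: "\<And>m n. coprime m q \<Longrightarrow> coprime n q \<Longrightarrow> f (m * n) = f m * f n"
    and fc: "\<And>a b. [a = b] (mod q) \<Longrightarrow> f a = f b"
    unfolding subgroup_chars_def by blast+
  have "f n \<noteq> 0" if "coprime n q" for n
    using subgroup_chars_nonzero[OF unit_subgroup_coprime f _ q, of n] that q
    by (auto simp: zero_power)
  moreover have "f (m * n) = f m * f n" for m n
    by (cases "coprime m q \<and> coprime n q") (auto simp: f0 fm)
  moreover have "f (n + q) = f n" for n by (rule fc) (simp add: Cong.cong_def)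
  ultimately show "f \<in> {\<chi>. dirichlet_char q \<chi>}" using f0 f1
    unfolding dirichlet_char_def by blast
qed

lemma finite_dirichlet_chars: "q > 0 \<Longrightarrow> finite {\<chi>. dirichlet_char q \<chi>}"
  by (simp add: dirichlet_chars_eq finite_subgroup_chars unit_subgroup_coprime)

text \<open>The direction used by \<open>F_mod_ge\<close>: removing few exceptional characters
  leaves many good ones only if there are many characters.\<close>

lemma totient_le_card_dirichlet_chars: "q > 0 \<Longrightarrow> totient q \<le> card {\<chi>. dirichlet_char q \<chi>}"
  by (simp add: dirichlet_chars_eq totient_le_card_subgroup_chars)

section \<open>Ordered factorizations\<close>

text \<open>The cardinality is the \<open>m\<close>-fold divisor function of \<open>l\<close>.
  Tuples are extensional functions on \<open>{..<m}\<close>, which makes the set finite for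
  \<open>l > 0\<close>.\<close>

definition ordered_factorizations :: "nat \<Rightarrow> nat \<Rightarrow> (nat \<Rightarrow> nat) set" where
  "ordered_factorizations m l = {t \<in> PiE {..<m} (\<lambda>_. {0<..}). prod t {..<m} = l}"

lemma ordered_factorizations_dvd:
  assumes "t \<in> ordered_factorizations m l" "i < m"
  shows "t i dvd l"
  using assms dvd_prodI[of "{..<m}" i t] by (auto simp: ordered_factorizations_def)

lemma ordered_factorizations_subset:
  "ordered_factorizations m l \<subseteq> PiE {..<m} (\<lambda>_. {n. n dvd l})"
proof
  fix t assume t: "t \<in> ordered_factorizations m l"
  then show "t \<in> PiE {..<m} (\<lambda>_. {n. n dvd l})"
    using ordered_factorizations_dvd[OF t] by (auto simp: ordered_factorizations_def PiE_iff)
qed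

lemma finite_ordered_factorizations: "l > 0 \<Longrightarrow> finite (ordered_factorizations m l)"
  by (rule finite_subset[OF ordered_factorizations_subset]) (auto intro!: finite_PiE)

text \<open>A factorization of \<open>p * l\<close> has a component divisible by the prime
  \<open>p\<close>. Dividing it by \<open>p\<close> gives a factorization of \<open>l\<close>, and
  the position of the component restores the original; there are \<open>m\<close> positions.\<close>

lemma card_ordered_factorizations_prime_mult:
  assumes p: "prime p" and l: "l > 0"
  shows "card (ordered_factorizations m (p * l)) \<le> m * card (ordered_factorizations m l)"
proof -
  have "ordered_factorizations m (p * l) \<subseteq>
      (\<lambda>(i, t). t(i := p * t i)) ` ({..<m} \<times> ordered_factorizations m l)"
  proof
    fix t assume t: "t \<in> ordered_factorizations m (p * l)"
    then have "p dvd prod t {..<m}" by (simp add: ordered_factorizations_def)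
    then obtain i where i: "i < m" "p dvd t i" using prime_dvd_prod_iff[of "{..<m}" p t] p by auto
    then obtain k where k: "t i = p * k" by (auto elim: dvdE)
    define s where "s = t(i := k)"
    have "t i > 0" using t i by (auto simp: ordered_factorizations_def)
    then have "k > 0" using k by (cases k) auto
    have r: "{..<m} = insert i ({..<m} - {i})" using i by auto
    have "prod t {..<m} = t i * prod t ({..<m} - {i})" by (subst r, subst prod.insert) auto
    moreover have "prod s {..<m} = k * prod s ({..<m} - {i})" by (subst r, subst prod.insert) (auto simp: s_def)
    moreover have "prod s ({..<m} - {i}) = prod t ({..<m} - {i})" by (rule prod.cong) (auto simp: s_def)
    ultimately have "prod s {..<m} = l"
      using t k prime_gt_0_nat[OF p] by (simp add: ordered_factorizations_def)
    moreover have "s \<in> PiE {..<m} (\<lambda>_. {0<..})"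
      using t i \<open>k > 0\<close> by (auto simp: s_def ordered_factorizations_def PiE_iff extensional_def)
    ultimately have "s \<in> ordered_factorizations m l" by (simp add: ordered_factorizations_def)
    moreover have "t = s(i := p * s i)" using k by (auto simp: s_def)
    ultimately show "t \<in> (\<lambda>(i, t). t(i := p * t i)) ` ({..<m} \<times> ordered_factorizations m l)"
      using i by (intro image_eqI[of _ _ "(i, s)"]) auto
  qed
  then have "card (ordered_factorizations m (p * l)) \<le> card ({..<m} \<times> ordered_factorizations m l)"
    using finite_ordered_factorizations[OF l, of m] by (intro surj_card_le) auto
  then show ?thesis unfolding card_cartesian_product card_lessThan .
qed

text \<open>The Euler product as an upper bound for a finite piece of its Dirichlet series.
  Splitting off the exact power of \<open>p\<close> from each \<open>n\<close> separates a geometric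
  series in \<open>p powr (-\<eta>)\<close> from a sum governed by the remaining primes.\<close>

lemma sum_powr_smooth_le_prod:
  fixes \<eta> :: real
  assumes "finite P" "\<And>p. p \<in> P \<Longrightarrow> prime p" and eta: "\<eta> > 0"
    and "finite S" "\<And>n. n \<in> S \<Longrightarrow> n > 0 \<and> prime_factors n \<subseteq> P"
  shows "(\<Sum>n\<in>S. real n powr (-\<eta>)) \<le> (\<Prod>p\<in>P. 1 / (1 - real p powr (-\<eta>)))"
  using assms(1,2,4,5)
proof (induction P arbitrary: S rule: finite_induct)
  case empty
  then have "S \<subseteq> {1}" by (auto simp: prime_factorization_empty_iff)
  then show ?case by (auto simp: subset_singleton_iff)
next
  case (insert p P)
  have p: "prime p" using insert.prems by auto
  then have p1: "p > 1" by (rule prime_gt_1_nat)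
  define x where "x = real p powr (-\<eta>)"
  have x: "0 < x" "x < 1" using p1 eta by (auto simp: x_def powr_less_one)
  \<comment> \<open>\<open>K\<close> exceeds the multiplicity of \<open>p\<close> in every element
    \<open>s\<close> of \<open>S\<close>, since
    \<open>multiplicity p s < p ^ multiplicity p s \<le> s\<close>.\<close>
  define K where "K = Suc (Max (insert 0 S))"
  define T where "T = (\<lambda>n. n div p ^ multiplicity p n) ` S"
  have T: "n > 0 \<and> prime_factors n \<subseteq> P" if nT: "n \<in> T" for n
  proof -
    obtain s where s: "s \<in> S" "n = s div p ^ multiplicity p s" using nT by (auto simp: T_def)
    have s0: "s > 0" "prime_factors s \<subseteq> insert p P" using insert.prems s by auto
    have sn: "s = p ^ multiplicity p s * n" using s multiplicity_dvd[of p s] by simp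
    then have "n > 0" using s0 by (cases n) auto
    moreover have "\<not> p dvd n" using s(2) multiplicity_decompose[of s p] s0 p1 by auto
    moreover have "prime_factors n \<subseteq> prime_factors s"
      using sn s0 by (intro dvd_prime_factors) (auto intro: dvdI[of _ _ "p ^ multiplicity p s"] simp: mult.commute)
    ultimately show ?thesis using s0 by (auto simp: in_prime_factors_iff)
  qed
  have IH: "(\<Sum>n\<in>T. real n powr (-\<eta>)) \<le> (\<Prod>p\<in>P. 1 / (1 - real p powr (-\<eta>)))"
    using insert.prems T by (intro insert.IH) (auto simp: T_def)
  have sub: "S \<subseteq> (\<lambda>(i, n). p ^ i * n) ` ({..<K} \<times> T)"
  proof
    fix s assume s: "s \<in> S"
    have "multiplicity p s < K"
    proof -
      have "p ^ multiplicity p s \<le> s" using insert.prems s by (intro dvd_imp_le multiplicity_dvd) auto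
      moreover have "multiplicity p s < p ^ multiplicity p s" using p1 by (simp add: power_gt_expt)
      moreover have "s \<le> Max (insert 0 S)" using s insert.prems by (intro Max_ge) auto
      ultimately show ?thesis unfolding K_def by linarith
    qed
    then show "s \<in> (\<lambda>(i, n). p ^ i * n) ` ({..<K} \<times> T)"
      using s by (intro image_eqI[of _ _ "(multiplicity p s, s div p ^ multiplicity p s)"])
        (auto simp: T_def multiplicity_dvd)
  qed
  have fT: "finite T" using insert.prems by (simp add: T_def)
  have "(\<Sum>n\<in>S. real n powr (-\<eta>)) \<le> (\<Sum>n\<in>(\<lambda>(i, n). p ^ i * n) ` ({..<K} \<times> T). real n powr (-\<eta>))"
    using sub fT by (intro sum_mono2) auto
  also have "\<dots> \<le> (\<Sum>(i, n)\<in>{..<K} \<times> T. real (p ^ i * n) powr (-\<eta>))"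
    using sum_image_le[of "{..<K} \<times> T" "\<lambda>n. real n powr (-\<eta>)" "\<lambda>(i, n). p ^ i * n"] fT
    by (simp add: case_prod_unfold o_def)
  also have "\<dots> = (\<Sum>(i, n)\<in>{..<K} \<times> T. x ^ i * real n powr (-\<eta>))"
    using p1 by (intro sum.cong) (auto simp: x_def powr_mult powr_powr powr_realpow[symmetric] mult.commute)
  also have "\<dots> = (\<Sum>i<K. x ^ i) * (\<Sum>n\<in>T. real n powr (-\<eta>))"
    by (simp add: sum_product sum.cartesian_product)
  also have "\<dots> \<le> (1 / (1 - x)) * (\<Prod>p\<in>P. 1 / (1 - real p powr (-\<eta>)))"
  proof (rule mult_mono[OF _ IH])
    show "(\<Sum>i<K. x ^ i) \<le> 1 / (1 - x)"
      using x by (simp add: sum_gp_strict divide_right_mono)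
  qed (use x in \<open>auto intro!: sum_nonneg\<close>)
  also have "\<dots> = (\<Prod>p\<in>insert p P. 1 / (1 - real p powr (-\<eta>)))"
    using insert.hyps by (simp add: x_def)
  finally show ?case .
qed

text \<open>\<open>l powr (-\<eta>)\<close> is the product of the \<open>t i powr (-\<eta>)\<close>.
  Dropping the condition that the \<open>t i\<close> multiply to \<open>l\<close> lets them range
  independently over the divisors of \<open>l\<close>, and each of the \<open>m\<close> resulting
  sums is bounded by an Euler product.\<close>

lemma card_ordered_factorizations_smooth:
  fixes \<eta> :: real
  assumes eta: "\<eta> > 0" and l: "l > 0"
  shows "real (card (ordered_factorizations m l)) \<le>
     (\<Prod>p\<in>prime_factors l. 1 / (1 - real p powr (-\<eta>))) ^ m * real l powr \<eta>"
proof -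
  let ?D = "{n. n dvd l}"
  have fD: "finite ?D" using l by simp
  have "real (card (ordered_factorizations m l)) * real l powr (-\<eta>) =
      (\<Sum>t\<in>ordered_factorizations m l. \<Prod>i<m. real (t i) powr (-\<eta>))"
  proof -
    have "(\<Prod>i<m. real (t i) powr (-\<eta>)) = real l powr (-\<eta>)" if "t \<in> ordered_factorizations m l" for t
    proof -
      have "(\<Prod>i<m. real (t i) powr (-\<eta>)) = (\<Prod>i<m. real (t i)) powr (-\<eta>)"
        by (rule prod_powr_distrib[symmetric])
      also have "(\<Prod>i<m. real (t i)) = real l"
        using that unfolding ordered_factorizations_def by (metis (mono_tags, lifting) mem_Collect_eq of_nat_prod)
      finally show ?thesis .
    qed
    then show ?thesis by simp
  qed
  also have "\<dots> \<le> (\<Sum>t\<in>PiE {..<m} (\<lambda>_. ?D). \<Prod>i<m. real (t i) powr (-\<eta>))"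
    using fD by (intro sum_mono2 ordered_factorizations_subset finite_PiE prod_nonneg) auto
  also have "\<dots> = (\<Prod>i<m. \<Sum>n\<in>?D. real n powr (-\<eta>))"
    using fD by (intro prod_sum_PiE[symmetric]) auto
  also have "\<dots> = (\<Sum>n\<in>?D. real n powr (-\<eta>)) ^ m" by simp
  also have "\<dots> \<le> (\<Prod>p\<in>prime_factors l. 1 / (1 - real p powr (-\<eta>))) ^ m"
  proof (intro power_mono sum_powr_smooth_le_prod sum_nonneg)
    show "n > 0 \<and> prime_factors n \<subseteq> prime_factors l" if "n \<in> ?D" for n
      using dvd_prime_factors[of l n] dvd_pos_nat[of l n] l that by simp
  qed (use fD eta in auto)
  finally show ?thesis using l by (simp add: powr_minus field_simps)
qed

text \<open>A prime \<open>p > y\<close> multiplies the count by at most \<open>m \<le> p powr \<eta>\<close>; what remains is \<open>y\<close>-smooth and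
  is treated by Rankin's trick.\<close>

lemma card_ordered_factorizations_le:
  fixes \<eta> :: real
  assumes eta: "\<eta> > 0" and y: "real (Suc y) powr \<eta> \<ge> real m"
  shows "l > 0 \<Longrightarrow> real (card (ordered_factorizations m l)) \<le>
     (\<Prod>p=2..y. 1 / (1 - real p powr (-\<eta>))) ^ m * real l powr \<eta>"
proof (induction l rule: less_induct)
  case (less l)
  have f1: "1 / (1 - real p powr (-\<eta>)) \<ge> 1" if "p \<ge> 2" for p
    using that eta by (simp add: powr_less_one)
  show ?case
  proof (cases "\<exists>p. prime p \<and> p dvd l \<and> p > y")
    case True
    then obtain p k where p: "prime p" "p > y" "l = p * k" by (auto elim!: dvdE)
    have k: "k > 0" "k < l" using less.prems p prime_gt_1_nat[OF p(1)] by (auto intro!: Nat.gr0I)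
    have mp: "real m \<le> real p powr \<eta>" using y p eta by (smt (verit) Suc_leI of_nat_mono powr_mono2 of_nat_0_le_iff)
    have "real (card (ordered_factorizations m l)) \<le> real m * real (card (ordered_factorizations m k))"
      using card_ordered_factorizations_prime_mult[OF p(1) k(1), of m] p(3) by (metis of_nat_mono of_nat_mult)
    also have "\<dots> \<le> real p powr \<eta> * ((\<Prod>p=2..y. 1 / (1 - real p powr (-\<eta>))) ^ m * real k powr \<eta>)"
      using less.IH[OF k(2,1)] mp by (intro mult_mono) auto
    also have "\<dots> = (\<Prod>p=2..y. 1 / (1 - real p powr (-\<eta>))) ^ m * real l powr \<eta>"
      using p by (simp add: powr_mult)
    finally show ?thesis .
  next
    case False
    have sub: "prime_factors l \<subseteq> {2..y}"
      using False by (auto simp: in_prime_factors_iff not_less prime_ge_2_nat)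
    \<comment> \<open>Every factor is at least \<open>1\<close>, so the product may be extended from
      the primes of \<open>l\<close> to all integers from \<open>2\<close> to \<open>y\<close>. This
      removes the dependence on \<open>l\<close> and leads to a harmonic sum in
      \<open>euler_product_le\<close>.\<close>
    have "(\<Prod>p\<in>prime_factors l. 1 / (1 - real p powr (-\<eta>))) \<le> (\<Prod>p=2..y. 1 / (1 - real p powr (-\<eta>)))"
    proof (rule prod_mono2)
      show "1 \<le> 1 / (1 - real b powr (-\<eta>))" if "b \<in> {2..y} - prime_factors l" for b
        using that by (intro f1) auto
      show "0 \<le> 1 / (1 - real a powr (-\<eta>))" if "a \<in> prime_factors l" for a
        by (rule order_trans[OF zero_le_one f1]) (use that sub in auto)
    qed (use sub in auto)
    then have "(\<Prod>p\<in>prime_factors l. 1 / (1 - real p powr (-\<eta>))) ^ m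
        \<le> (\<Prod>p=2..y. 1 / (1 - real p powr (-\<eta>))) ^ m"
    proof (rule power_mono)
      show "0 \<le> (\<Prod>p\<in>prime_factors l. 1 / (1 - real p powr (-\<eta>)))"
        by (rule prod_nonneg, rule order_trans[OF zero_le_one f1]) (use sub in auto)
    qed
    then show ?thesis using card_ordered_factorizations_smooth[OF eta less.prems, of m]
      by (meson mult_right_mono order_trans powr_ge_zero)
  qed
qed

section \<open>Orthogonality and moments\<close>

lemma norm_dirichlet_char:
  assumes \<chi>: "dirichlet_char q \<chi>" and q: "q > 0"
  shows "cmod (\<chi> n) = (if coprime n q then 1 else 0)"
proof (cases "coprime n q")
  case True
  have "\<chi> \<in> subgroup_chars q {n. coprime n q}" using \<chi> dirichlet_chars_eq[OF q] by blast
  then have "\<chi> n ^ totient q = 1"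
    using subgroup_chars_nonzero[OF unit_subgroup_coprime _ _ q] True by blast
  then have "cmod (\<chi> n) ^ totient q = 1" by (metis norm_one norm_power)
  then show ?thesis using True q power_eq_imp_eq_base[of "cmod (\<chi> n)" "totient q" 1] by simp
next
  case False
  then have "\<chi> n = 0" using \<chi> unfolding dirichlet_char_def by blast
  then show ?thesis using False by simp
qed

lemma norm_dirichlet_char_le_1:
  "dirichlet_char q \<chi> \<Longrightarrow> q > 0 \<Longrightarrow> cmod (\<chi> n) \<le> 1"
  by (simp add: norm_dirichlet_char)

lemma sum_residues_mult:
  fixes f :: "nat \<Rightarrow> 'a::comm_monoid_add"
  assumes u: "coprime u q" and q: "q > 0" and f: "\<And>a b. [a = b] (mod q) \<Longrightarrow> f a = f b"
  shows "(\<Sum>n<q. f (u * n)) = (\<Sum>n<q. f n)"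
proof -
  have inj: "inj_on (\<lambda>n. (u * n) mod q) {..<q}"
  proof (rule inj_onI)
    fix x y assume xy: "x \<in> {..<q}" "y \<in> {..<q}" "(u * x) mod q = (u * y) mod q"
    then have "[u * x = u * y] (mod q)" by (simp add: Cong.cong_def)
    then have "[x = y] (mod q)" using u cong_mult_lcancel_nat by blast
    then show "x = y" using xy by (simp add: Cong.cong_def)
  qed
  have "(\<lambda>n. (u * n) mod q) ` {..<q} = {..<q}"
    using q inj by (intro endo_inj_surj) auto
  then have "(\<Sum>n<q. f n) = (\<Sum>n<q. f ((u * n) mod q))"
    using sum.reindex[OF inj, of f] by (simp add: o_def)
  also have "\<dots> = (\<Sum>n<q. f (u * n))" by (intro sum.cong f) auto
  finally show ?thesis ..
qed

lemma card_coprime_residues: "card {n\<in>{..<q}. coprime n q} = totient q" if "q > 0"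
proof -
  have "{n\<in>{..<q}. coprime n q} = {n. coprime n q} \<inter> {..<q}" by auto
  then show ?thesis using card_coprime_lessThan[OF that] by simp
qed

lemma sum_norm_dirichlet_char:
  assumes "dirichlet_char q \<chi>" "q > 0"
  shows "(\<Sum>n<q. \<chi> n * cnj (\<chi> n)) = of_nat (totient q)"
proof -
  have "\<chi> n * cnj (\<chi> n) = (if coprime n q then 1 else 0)" for n
    using norm_dirichlet_char[OF assms, of n] by (simp flip: complex_norm_square)
  then have "(\<Sum>n<q. \<chi> n * cnj (\<chi> n)) = of_nat (card {n\<in>{..<q}. coprime n q})"
    by (simp add: sum.If_cases Int_def)
  then show ?thesis using card_coprime_residues[OF assms(2)] by simp
qed

lemma dirichlet_char_cnj: "dirichlet_char q \<chi> \<Longrightarrow> dirichlet_char q (\<lambda>n. cnj (\<chi> n))"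
  by (simp add: dirichlet_char_def)

lemma dirichlet_char_eqI:
  assumes "dirichlet_char q \<chi>" "dirichlet_char q \<psi>" "\<And>n. coprime n q \<Longrightarrow> \<chi> n = \<psi> n"
  shows "\<chi> = \<psi>"
  using assms unfolding dirichlet_char_def by (intro ext) metis

lemma dirichlet_char_orthogonal:
  assumes \<chi>: "dirichlet_char q \<chi>" and \<psi>: "dirichlet_char q \<psi>" and ne: "\<chi> \<noteq> \<psi>" and q: "q > 0"
  shows "(\<Sum>n<q. \<chi> n * cnj (\<psi> n)) = 0"
proof -
  obtain u where u: "coprime u q" "\<chi> u \<noteq> \<psi> u" using dirichlet_char_eqI[OF \<chi> \<psi>] ne by blast
  define S where "S = (\<Sum>n<q. \<chi> n * cnj (\<psi> n))"
  have "S = (\<Sum>n<q. \<chi> (u * n) * cnj (\<psi> (u * n)))"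
    unfolding S_def by (rule sum_residues_mult[OF u(1) q, symmetric])
      (simp add: dirichlet_char_cong[OF \<chi>] dirichlet_char_cong[OF \<psi>])
  also have "\<dots> = \<chi> u * cnj (\<psi> u) * S"
    using \<chi> \<psi> by (simp add: dirichlet_char_def S_def sum_distrib_left mult_ac)
  finally have eq: "S = \<chi> u * cnj (\<psi> u) * S" .
  have "\<psi> u * cnj (\<psi> u) = 1"
    using norm_dirichlet_char[OF \<psi> q, of u] u by (simp flip: complex_norm_square)
  then have "\<psi> u * S = \<chi> u * S" using arg_cong[OF eq, of "\<lambda>z. \<psi> u * z"] by (simp add: mult_ac)
  then show ?thesis using u unfolding S_def by simp
qed

text \<open>Bessel's inequality: on the residues modulo \<open>q\<close> the characters are
  orthogonal with squared norm \<open>totient q\<close>. It holds for any set \<open>X\<close> of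
  characters and rests on orthogonality in the residue variable alone.\<close>

lemma dirichlet_char_bessel:
  fixes g :: "nat \<Rightarrow> complex"
  assumes X: "\<And>\<chi>. \<chi> \<in> X \<Longrightarrow> dirichlet_char q \<chi>" and q: "q > 0"
  shows "(\<Sum>\<chi>\<in>X. (cmod (\<Sum>c<q. g c * \<chi> c))\<^sup>2) \<le> real (totient q) * (\<Sum>c<q. (cmod (g c))\<^sup>2)"
proof -
  have fX: "finite X" using finite_subset[OF _ finite_dirichlet_chars[OF q], of X] X by auto
  define N where "N = real (totient q)"
  have N: "N > 0" using q by (simp add: N_def)
  define F where "F \<chi> = (\<Sum>c<q. g c * \<chi> c)" for \<chi>
  \<comment> \<open>\<open>h\<close> is \<open>N\<close> times the orthogonal projection of
    \<open>g\<close> onto the span of the conjugates of the characters in \<open>X\<close>. The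
    inequality comes from expanding the squared distance between \<open>N * g\<close> and
    \<open>h\<close>.\<close>
  define h where "h c = (\<Sum>\<chi>\<in>X. F \<chi> * cnj (\<chi> c))" for c
  define SF where "SF = (\<Sum>\<chi>\<in>X. (cmod (F \<chi>))\<^sup>2)"
  have orth: "(\<Sum>c<q. cnj (\<chi> c) * \<psi> c) = (if \<psi> = \<chi> then of_real N else 0)"
    if "\<chi> \<in> X" "\<psi> \<in> X" for \<chi> \<psi>
    using that X dirichlet_char_orthogonal[OF X X _ q, of \<psi> \<chi>] sum_norm_dirichlet_char[OF X q, of \<chi>]
    by (auto simp: N_def mult.commute)
  have hh: "(\<Sum>c<q. h c * cnj (h c)) = of_real (N * SF)"
  proof -
    have "(\<Sum>c<q. h c * cnj (h c)) =
        (\<Sum>c<q. \<Sum>\<chi>\<in>X. \<Sum>\<psi>\<in>X. F \<chi> * cnj (F \<psi>) * (cnj (\<chi> c) * \<psi> c))"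
      by (simp only: h_def cnj_sum sum_product complex_cnj_mult complex_cnj_cnj) (simp add: mult_ac)
    also have "\<dots> = (\<Sum>\<chi>\<in>X. \<Sum>c<q. \<Sum>\<psi>\<in>X. F \<chi> * cnj (F \<psi>) * (cnj (\<chi> c) * \<psi> c))"
      by (rule sum.swap)
    also have "\<dots> = (\<Sum>\<chi>\<in>X. \<Sum>\<psi>\<in>X. \<Sum>c<q. F \<chi> * cnj (F \<psi>) * (cnj (\<chi> c) * \<psi> c))"
      by (intro sum.cong refl sum.swap)
    also have "\<dots> = (\<Sum>\<chi>\<in>X. \<Sum>\<psi>\<in>X. F \<chi> * cnj (F \<psi>) * (if \<psi> = \<chi> then of_real N else 0))"
      using orth by (intro sum.cong refl) (simp flip: sum_distrib_left)
    also have "\<dots> = (\<Sum>\<chi>\<in>X. F \<chi> * cnj (F \<chi>) * of_real N)"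
      using fX by (intro sum.cong refl) (simp add: if_distrib[of "\<lambda>x. _ * x"] cong: if_cong)
    also have "\<dots> = of_real (N * SF)"
      by (simp add: SF_def sum_distrib_left mult.commute flip: complex_norm_square)
    finally show ?thesis .
  qed
  have gh: "(\<Sum>c<q. g c * cnj (h c)) = of_real SF"
  proof -
    have "(\<Sum>c<q. g c * cnj (h c)) = (\<Sum>c<q. \<Sum>\<chi>\<in>X. cnj (F \<chi>) * (g c * \<chi> c))"
      by (simp add: h_def sum_distrib_left mult_ac)
    also have "\<dots> = (\<Sum>\<chi>\<in>X. \<Sum>c<q. cnj (F \<chi>) * (g c * \<chi> c))" by (rule sum.swap)
    also have "\<dots> = (\<Sum>\<chi>\<in>X. F \<chi> * cnj (F \<chi>))"
      unfolding sum_distrib_left[symmetric] F_def[symmetric] by (simp add: mult.commute)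
    also have "\<dots> = of_real SF" by (simp add: SF_def flip: complex_norm_square)
    finally show ?thesis .
  qed
  have hg: "(\<Sum>c<q. h c * cnj (g c)) = of_real SF"
    using arg_cong[OF gh, of cnj] by (simp add: mult.commute)
  have "complex_of_real (\<Sum>c<q. (cmod (of_real N * g c - h c))\<^sup>2) =
      (\<Sum>c<q. (of_real N * g c - h c) * cnj (of_real N * g c - h c))"
    by (simp only: of_real_sum complex_norm_square)
  also have "\<dots> = (\<Sum>c<q. of_real (N\<^sup>2) * (g c * cnj (g c)) - of_real N * (g c * cnj (h c))
      - of_real N * (h c * cnj (g c)) + h c * cnj (h c))"
    by (intro sum.cong refl) (simp add: algebra_simps power2_eq_square)
  also have "\<dots> = of_real (N\<^sup>2) * (\<Sum>c<q. g c * cnj (g c)) - of_real N * of_real SF - of_real N * of_real SF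
      + of_real (N * SF)"
    by (simp add: sum.distrib sum_subtractf gh hg hh flip: sum_distrib_left)
  also have "\<dots> = of_real (N\<^sup>2 * (\<Sum>c<q. (cmod (g c))\<^sup>2) - N * SF)"
    by (simp flip: complex_norm_square)
  finally have "(\<Sum>c<q. (cmod (of_real N * g c - h c))\<^sup>2) = N\<^sup>2 * (\<Sum>c<q. (cmod (g c))\<^sup>2) - N * SF"
    using of_real_eq_iff by blast
  moreover have "(\<Sum>c<q. (cmod (of_real N * g c - h c))\<^sup>2) \<ge> 0" by (intro sum_nonneg) auto
  ultimately have "N * SF \<le> N * (N * (\<Sum>c<q. (cmod (g c))\<^sup>2))" by (simp add: power2_eq_square)
  then show ?thesis using N by (simp add: SF_def F_def N_def)
qed

lemma card_residue_class_le:
  assumes q: "q > 0"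
  shows "real (card {l\<in>{1..L}. l mod q = c}) \<le> real L / real q + 1"
proof -
  have "inj_on (\<lambda>l. l div q) {l\<in>{1..L}. l mod q = c}"
    by (rule inj_onI) (metis (mono_tags, lifting) mem_Collect_eq mult_div_mod_eq)
  then have "card {l\<in>{1..L}. l mod q = c} \<le> card {..L div q}"
    by (rule card_inj_on_le) (auto intro: div_le_mono)
  then have "real (card {l\<in>{1..L}. l mod q = c}) \<le> real (L div q) + 1" by simp
  also have "real (L div q) \<le> real L / real q" by (rule of_nat_div_le_of_nat)
  finally show ?thesis by simp
qed

lemma dirichlet_char_prod:
  assumes "dirichlet_char q \<chi>" "finite A"
  shows "\<chi> (prod t A) = (\<Prod>i\<in>A. \<chi> (t i))"
  using assms(2,1) by (induction A rule: finite_induct) (auto simp: dirichlet_char_def)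

text \<open>The \<open>m\<close>-th power of the sum is a sum over \<open>m\<close>-tuples from
  \<open>I\<close>; grouping them by the residue \<open>c\<close> of their product makes Bessel's
  inequality applicable. At most \<open>M ^ m / q + 1\<close> integers up to \<open>M ^ m\<close>
  lie in one class, and each is the product of at most \<open>R\<close> tuples.\<close>

lemma dirichlet_char_moment:
  fixes a :: "nat \<Rightarrow> complex"
  assumes X: "\<And>\<chi>. \<chi> \<in> X \<Longrightarrow> dirichlet_char q \<chi>" and q: "q > 0"
    and I: "I \<subseteq> {1..M}" and a: "\<And>b. b \<in> I \<Longrightarrow> cmod (a b) \<le> \<kappa>"
    and R: "\<And>l. 1 \<le> l \<Longrightarrow> l \<le> M ^ m \<Longrightarrow> real (card (ordered_factorizations m l)) \<le> R"
    and R0: "R \<ge> 0" and k0: "\<kappa> \<ge> 0"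
  shows "(\<Sum>\<chi>\<in>X. cmod (\<Sum>b\<in>I. a b * \<chi> b) ^ (2 * m)) \<le>
    real (totient q) * (\<kappa> ^ (2 * m) * real (card I) ^ m * ((real M ^ m / real q + 1) * R))"
proof -
  have fI: "finite I" using I finite_subset by blast
  define T where "T = PiE {..<m} (\<lambda>_. I)"
  have fT: "finite T" using fI by (simp add: T_def finite_PiE)
  define A where "A t = (\<Prod>i<m. a (t i))" for t
  define w where "w t = prod t {..<m}" for t :: "nat \<Rightarrow> nat"
  define C where "C c = {t\<in>T. w t mod q = c}" for c
  define g where "g c = (\<Sum>t\<in>C c. A t)" for c
  have pow: "(\<Sum>b\<in>I. a b * \<chi> b) ^ m = (\<Sum>c<q. g c * \<chi> c)" if "\<chi> \<in> X" for \<chi>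
  proof -
    have "(\<Sum>b\<in>I. a b * \<chi> b) ^ m = (\<Prod>i<m. \<Sum>b\<in>I. a b * \<chi> b)" by simp
    also have "\<dots> = (\<Sum>t\<in>T. \<Prod>i<m. a (t i) * \<chi> (t i))"
      unfolding T_def using fI by (intro prod_sum_PiE) auto
    also have "\<dots> = (\<Sum>t\<in>T. A t * \<chi> (w t mod q))"
    proof (intro sum.cong refl)
      fix t assume "t \<in> T"
      have "\<chi> (w t mod q) = \<chi> (w t)" by (rule dirichlet_char_cong[OF X[OF that]]) simp
      also have "\<dots> = (\<Prod>i<m. \<chi> (t i))" unfolding w_def by (rule dirichlet_char_prod[OF X[OF that]]) simp
      finally show "(\<Prod>i<m. a (t i) * \<chi> (t i)) = A t * \<chi> (w t mod q)"
        by (simp add: A_def prod.distrib)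
    qed
    also have "\<dots> = (\<Sum>c<q. \<Sum>t\<in>C c. A t * \<chi> (w t mod q))"
      unfolding C_def using fT q by (intro sum.group[symmetric]) auto
    also have "\<dots> = (\<Sum>c<q. g c * \<chi> c)"
      unfolding g_def sum_distrib_right by (intro sum.cong refl) (simp add: C_def)
    finally show ?thesis .
  qed
  have normA: "cmod (A t) \<le> \<kappa> ^ m" if "t \<in> T" for t
  proof -
    have "cmod (A t) = (\<Prod>i<m. cmod (a (t i)))" by (simp add: A_def prod_norm)
    also have "\<dots> \<le> (\<Prod>i<m. \<kappa>)" using that a by (intro prod_mono) (auto simp: T_def)
    finally show ?thesis by simp
  qed
  have cardC: "real (card (C c)) \<le> (real M ^ m / real q + 1) * R" for c
  proof -
    have "C c \<subseteq> (\<Union>l\<in>{l\<in>{1..M ^ m}. l mod q = c}. ordered_factorizations m l)"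
    proof
      fix t assume t: "t \<in> C c"
      then have t1: "t i \<in> {1..M}" if "i < m" for i using that I by (auto simp: C_def T_def)
      have "w t \<le> (\<Prod>i<m. M)" unfolding w_def using t1 by (intro prod_mono) auto
      moreover have "w t > 0" unfolding w_def using t1 by (fastforce intro: prod_pos)
      moreover have "t \<in> PiE {..<m} (\<lambda>_. {0<..})" using t t1 unfolding C_def T_def PiE_iff by fastforce
      ultimately have "w t \<in> {l\<in>{1..M ^ m}. l mod q = c}" "t \<in> ordered_factorizations m (w t)"
        using t by (auto simp: C_def ordered_factorizations_def w_def[symmetric])
      then show "t \<in> (\<Union>l\<in>{l\<in>{1..M ^ m}. l mod q = c}. ordered_factorizations m l)" by blast
    qed
    then have "card (C c) \<le> card (\<Union>l\<in>{l\<in>{1..M ^ m}. l mod q = c}. ordered_factorizations m l)"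
      by (intro card_mono) (auto intro: finite_ordered_factorizations)
    also have "\<dots> \<le> (\<Sum>l\<in>{l\<in>{1..M ^ m}. l mod q = c}. card (ordered_factorizations m l))"
      by (rule card_UN_le) auto
    finally have "real (card (C c)) \<le> (\<Sum>l\<in>{l\<in>{1..M ^ m}. l mod q = c}. real (card (ordered_factorizations m l)))"
      by (metis of_nat_mono of_nat_sum)
    also have "\<dots> \<le> (\<Sum>l\<in>{l\<in>{1..M ^ m}. l mod q = c}. R)" by (intro sum_mono R) auto
    also have "\<dots> = real (card {l\<in>{1..M ^ m}. l mod q = c}) * R" by simp
    also have "\<dots> \<le> (real (M ^ m) / real q + 1) * R"
      by (intro mult_right_mono card_residue_class_le q R0)
    finally show ?thesis by simp
  qed
  \<comment> \<open>Of the two factors \<open>card (C c)\<close> in the square only one is replaced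
    by its upper bound; the sum of the other over \<open>c\<close> is exactly
    \<open>card I ^ m\<close>.\<close>
  have ng: "(cmod (g c))\<^sup>2 \<le> \<kappa> ^ (2 * m) * (real (card (C c)) * ((real M ^ m / real q + 1) * R))" for c
  proof -
    have "cmod (g c) \<le> (\<Sum>t\<in>C c. \<kappa> ^ m)"
      unfolding g_def by (rule sum_norm_le) (auto simp: C_def intro: normA)
    then have "cmod (g c) \<le> real (card (C c)) * \<kappa> ^ m" by simp
    then have "(cmod (g c))\<^sup>2 \<le> (real (card (C c)) * \<kappa> ^ m)\<^sup>2" by (intro power_mono) auto
    also have "\<dots> = \<kappa> ^ (2 * m) * (real (card (C c)) * real (card (C c)))"
      by (simp add: power2_eq_square power_mult_distrib power_mult mult_ac flip: power_add)
    also have "\<dots> \<le> \<kappa> ^ (2 * m) * (real (card (C c)) * ((real M ^ m / real q + 1) * R))"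
      using cardC[of c] k0 by (intro mult_left_mono) auto
    finally show ?thesis .
  qed
  have "(\<Sum>\<chi>\<in>X. cmod (\<Sum>b\<in>I. a b * \<chi> b) ^ (2 * m)) = (\<Sum>\<chi>\<in>X. (cmod (\<Sum>c<q. g c * \<chi> c))\<^sup>2)"
  proof (intro sum.cong refl)
    fix \<chi> assume "\<chi> \<in> X"
    show "cmod (\<Sum>b\<in>I. a b * \<chi> b) ^ (2 * m) = (cmod (\<Sum>c<q. g c * \<chi> c))\<^sup>2"
      by (subst pow[OF \<open>\<chi> \<in> X\<close>, symmetric]) (simp add: norm_power power_mult mult.commute flip: power_mult)
  qed
  also have "\<dots> \<le> real (totient q) * (\<Sum>c<q. (cmod (g c))\<^sup>2)"
    by (rule dirichlet_char_bessel[OF X q])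
  also have "\<dots> \<le> real (totient q) * (\<Sum>c<q. \<kappa> ^ (2 * m) * (real (card (C c)) * ((real M ^ m / real q + 1) * R)))"
    by (intro mult_left_mono sum_mono ng) auto
  also have "\<dots> = real (totient q) * (\<kappa> ^ (2 * m) * real (\<Sum>c<q. card (C c)) * ((real M ^ m / real q + 1) * R))"
    by (simp add: sum_distrib_left sum_distrib_right mult_ac)
  also have "(\<Sum>c<q. card (C c)) = card I ^ m"
  proof -
    have "(\<Sum>c<q. card (C c)) = (\<Sum>c<q. \<Sum>t\<in>C c. 1)" by simp
    also have "\<dots> = (\<Sum>t\<in>T. 1)" unfolding C_def using fT q by (intro sum.group) auto
    finally show ?thesis using fI by (simp add: T_def card_PiE)
  qed
  finally show ?thesis by simp
qed

section \<open>Primitive characters and Gauss sums\<close>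

definition uexp :: "real \<Rightarrow> complex" where "uexp x = cis (2 * pi * x)"

lemma uexp_0 [simp]: "uexp 0 = 1" by (simp add: uexp_def)

lemma uexp_add: "uexp (x + y) = uexp x * uexp y" by (simp add: uexp_def cis_mult algebra_simps)

lemma cnj_uexp: "cnj (uexp x) = uexp (- x)" by (simp add: uexp_def cis_cnj)

lemma norm_uexp [simp]: "cmod (uexp x) = 1" by (simp add: uexp_def)

lemma uexp_of_int [simp]: "uexp (of_int k) = 1"
  unfolding uexp_def by (rule cis_multiple_2pi) simp

lemma uexp_power: "uexp x ^ n = uexp (real n * x)"
  by (simp add: uexp_def DeMoivre algebra_simps)

lemma uexp_cong:
  assumes "[a = b] (mod d)" "d > 0"
  shows "uexp (real a / real d) = uexp (real b / real d)"
proof -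
  have "[int a = int b] (mod int d)" using assms by (simp add: cong_int_iff)
  then obtain k where "int a = int b + int d * k" by (metis cong_iff_lin cong_sym)
  then have "real a = real b + real d * real_of_int k"
    by (metis of_int_add of_int_mult of_int_of_nat_eq)
  then have "real a / real d = real b / real d + of_int k" using assms(2) by (simp add: field_simps)
  then show ?thesis by (simp add: uexp_add)
qed

lemma norm_uexp_minus_1: "cmod (uexp x - 1) = 2 * \<bar>sin (pi * x)\<bar>"
proof -
  have "(cmod (uexp x - 1))\<^sup>2 = (cos (2 * (pi * x)) - 1)\<^sup>2 + (sin (2 * (pi * x)))\<^sup>2"
    by (simp add: uexp_def cmod_def mult.assoc)
  also have "\<dots> = 2 - 2 * cos (2 * (pi * x))"
    using sin_cos_squared_add[of "2 * (pi * x)"] by (simp add: power2_eq_square algebra_simps)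
  also have "\<dots> = (2 * \<bar>sin (pi * x)\<bar>)\<^sup>2"
    by (simp add: cos_double_sin power_mult_distrib)
  finally show ?thesis by (rule power2_eq_imp_eq) auto
qed

lemma norm_uexp_diff_le: "cmod (uexp x - uexp y) \<le> 2 * pi * \<bar>x - y\<bar>"
proof -
  have "uexp x - uexp y = uexp y * (uexp (x - y) - 1)"
    using uexp_add[of y "x - y"] by (simp add: algebra_simps)
  then have "cmod (uexp x - uexp y) = 2 * \<bar>sin (pi * (x - y))\<bar>"
    by (simp add: norm_mult norm_uexp_minus_1)
  also have "\<dots> \<le> 2 * \<bar>pi * (x - y)\<bar>" using abs_sin_x_le_abs_x by simp
  finally show ?thesis by (simp add: abs_mult)
qed

text \<open>The Taylor error \<open>x ^ 3 / 6\<close> is at most \<open>2 * x / 3\<close> for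
  \<open>x \<le> 2\<close>, a range that contains \<open>pi / 2\<close>. The factor
  \<open>1 / 3\<close> is compensated by \<open>3 \<le> pi\<close> in
  \<open>norm_uexp_minus_1_ge\<close>.\<close>

lemma third_le_sin:
  fixes x :: real
  assumes "0 \<le> x" "x \<le> 2"
  shows "x / 3 \<le> sin x"
proof -
  have "\<bar>sin x - (\<Sum>m<3. sin_coeff m * x ^ m)\<bar> \<le> inverse (fact 3) * \<bar>x\<bar> ^ 3"
    by (rule Maclaurin_sin_bound)
  then have "\<bar>sin x - x\<bar> \<le> x * x\<^sup>2 / 6"
    using assms by (simp add: eval_nat_numeral sin_coeff_def)
  moreover have "x\<^sup>2 \<le> 2\<^sup>2" using assms by (intro power_mono) auto
  then have "x * x\<^sup>2 \<le> x * 4" using assms by (intro mult_left_mono) (auto simp: power2_eq_square)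
  ultimately show ?thesis using assms by linarith
qed

lemma three_le_pi: "3 \<le> pi"
  using sin_x_le_x[of "pi / 6"] by (simp add: sin_30)

lemma norm_uexp_minus_1_ge:
  assumes "0 \<le> x" "x \<le> 1 / 2"
  shows "2 * x \<le> cmod (uexp x - 1)"
proof -
  have "pi * x \<le> pi * (1 / 2)" using assms by (intro mult_left_mono) auto
  then have "pi * x \<le> 2" using pi_half_less_two by linarith
  then have "pi * x / 3 \<le> sin (pi * x)"
    using assms by (intro third_le_sin) auto
  moreover have "3 * x \<le> pi * x" using assms three_le_pi by (intro mult_right_mono) auto
  ultimately show ?thesis unfolding norm_uexp_minus_1 by linarith
qed

lemma norm_uexp_minus_1_ge':
  assumes "0 \<le> x" "x \<le> 1"
  shows "2 * min x (1 - x) \<le> cmod (uexp x - 1)"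
proof (cases "x \<le> 1 / 2")
  case True then show ?thesis using norm_uexp_minus_1_ge[of x] assms by (auto simp: min_def)
next
  case False
  have "cmod (uexp x - 1) = cmod (uexp (1 - x) - 1)"
    by (simp add: norm_uexp_minus_1 right_diff_distrib)
  then show ?thesis using norm_uexp_minus_1_ge[of "1 - x"] assms False by (auto simp: min_def)
qed

lemma norm_sum_uexp_le:
  assumes "uexp x \<noteq> 1"
  shows "cmod (\<Sum>b=1..n. uexp (real b * x)) \<le> 2 / cmod (uexp x - 1)"
proof -
  have "(\<Sum>b=1..n. uexp (real b * x)) = (\<Sum>b<n. uexp (real (Suc b) * x))"
    by (rule sum.reindex_bij_witness[of _ Suc "\<lambda>b. b - 1"]) auto
  also have "\<dots> = (\<Sum>b<n. uexp x * uexp x ^ b)"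
    by (intro sum.cong refl) (simp add: uexp_power ring_distribs flip: uexp_add)
  also have "\<dots> = uexp x * ((1 - uexp x ^ n) / (1 - uexp x))"
    using assms by (simp add: sum_gp_strict flip: sum_distrib_left)
  finally have "cmod (\<Sum>b=1..n. uexp (real b * x)) = cmod (1 - uexp x ^ n) / cmod (uexp x - 1)"
    by (simp add: norm_mult norm_divide norm_minus_commute)
  also have "\<dots> \<le> 2 / cmod (uexp x - 1)"
  proof (rule divide_right_mono)
    show "cmod (1 - uexp x ^ n) \<le> 2" using norm_triangle_ineq4[of 1 "uexp x ^ n"] by (simp add: norm_power)
  qed simp
  finally show ?thesis .
qed

lemma uexp_eq_1_residue:
  fixes k :: int
  assumes "\<not> int d dvd k" "d > 0"
  shows "uexp (of_int k / real d) \<noteq> 1"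
proof
  assume "uexp (of_int k / real d) = 1"
  then have "sin (pi * (of_int k / real d)) = 0" using norm_uexp_minus_1[of "of_int k / real d"] by simp
  then obtain i :: int where "pi * (of_int k / real d) = of_int i * pi" by (auto simp: sin_zero_iff_int2)
  then have "real_of_int k = of_int (i * int d)" using assms(2) by (simp add: field_simps)
  then have "k = i * int d" by (simp only: of_int_eq_iff)
  then show False using assms(1) by simp
qed

lemma sum_uexp_residues:
  fixes k :: int
  assumes d: "d > 0"
  shows "(\<Sum>b<d. uexp (real b * of_int k / real d)) = (if int d dvd k then of_nat d else 0)"
proof -
  have eq: "(\<Sum>b<d. uexp (real b * of_int k / real d)) = (\<Sum>b<d. uexp (of_int k / real d) ^ b)"
    by (simp add: uexp_power)
  show ?thesis
  proof (cases "int d dvd k")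
    case True
    then obtain i where "k = int d * i" by (auto elim: dvdE)
    then have "of_int k / real d = of_int i" using d by simp
    then show ?thesis unfolding eq using True by simp
  next
    case False
    have "uexp (of_int k / real d) ^ d = 1" using d by (simp add: uexp_power)
    then show ?thesis unfolding eq using uexp_eq_1_residue[OF False d] False by (simp add: sum_gp_strict)
  qed
qed

section \<open>Primitive characters and their Gauss sums\<close>

text \<open>Primitivity only needs to be tested against the maximal proper divisors \<open>d div p\<close>.\<close>

definition primitive_char :: "nat \<Rightarrow> (nat \<Rightarrow> complex) \<Rightarrow> bool" where
  "primitive_char d \<chi> \<longleftrightarrow> dirichlet_char d \<chi> \<and>
     (\<forall>p. prime p \<and> p dvd d \<longrightarrow> (\<exists>u. coprime u d \<and> [u = 1] (mod (d div p)) \<and> \<chi> u \<noteq> 1))"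

lemma primitive_char_cnj: "primitive_char d \<chi> \<Longrightarrow> primitive_char d (\<lambda>n. cnj (\<chi> n))"
  unfolding primitive_char_def by (metis complex_cnj_cnj complex_cnj_one dirichlet_char_cnj)

definition gauss_sum :: "nat \<Rightarrow> (nat \<Rightarrow> complex) \<Rightarrow> nat \<Rightarrow> complex" where
  "gauss_sum d \<chi> b = (\<Sum>n<d. \<chi> n * uexp (real (b * n) / real d))"

lemma gauss_sum_unit_mult:
  assumes \<chi>: "dirichlet_char d \<chi>" and d: "d > 0" and u: "coprime u d"
  shows "\<chi> u * gauss_sum d \<chi> (b * u) = gauss_sum d \<chi> b"
proof -
  have "\<chi> u * gauss_sum d \<chi> (b * u) = (\<Sum>n<d. \<chi> (u * n) * uexp (real (b * (u * n)) / real d))"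
    using \<chi> by (simp add: gauss_sum_def sum_distrib_left dirichlet_char_def mult_ac)
  also have "\<dots> = gauss_sum d \<chi> b"
    unfolding gauss_sum_def
    by (rule sum_residues_mult[OF u d]) (metis dirichlet_char_cong[OF \<chi>] uexp_cong[OF _ d] cong_scalar_left)
  finally show ?thesis .
qed

lemma gauss_sum_cong:
  assumes "[b = b'] (mod d)" "d > 0"
  shows "gauss_sum d \<chi> b = gauss_sum d \<chi> b'"
  unfolding gauss_sum_def
  by (intro sum.cong refl arg_cong2[where f = "(*)"] uexp_cong cong_mult assms) simp_all

text \<open>For \<open>b\<close> coprime to \<open>d\<close> this is a change of variable. Otherwise
  a prime \<open>p\<close> divides both, and a unit \<open>u\<close> congruent to \<open>1\<close>
  modulo \<open>d div p\<close> satisfies \<open>b * u = b\<close> modulo \<open>d\<close>. Hence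
  the Gauss sum at \<open>b\<close> is fixed under multiplication by \<open>\<chi> u\<close>, which
  differs from \<open>1\<close>, and it vanishes. Only moduli \<open>d div p\<close> occur, which
  explains the form of \<open>primitive_char\<close>.\<close>

lemma gauss_sum_primitive:
  assumes \<chi>: "primitive_char d \<chi>" and d: "d > 0"
  shows "gauss_sum d \<chi> b = cnj (\<chi> b) * gauss_sum d \<chi> 1"
proof (cases "coprime b d")
  case True
  have \<chi>': "dirichlet_char d \<chi>" using \<chi> by (simp add: primitive_char_def)
  have "\<chi> b * gauss_sum d \<chi> b = gauss_sum d \<chi> 1"
    using gauss_sum_unit_mult[OF \<chi>' d True, of 1] by simp
  moreover have "cnj (\<chi> b) * \<chi> b = 1"
    using norm_dirichlet_char[OF \<chi>' d, of b] True
    by (simp add: mult.commute flip: complex_norm_square)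
  ultimately show ?thesis by (metis mult.assoc mult_1)
next
  case False
  have \<chi>': "dirichlet_char d \<chi>" using \<chi> by (simp add: primitive_char_def)
  then have b0: "\<chi> b = 0" using False unfolding dirichlet_char_def by blast
  obtain p where p: "prime p" "p dvd b" "p dvd d"
    using False prime_factor_nat[of "gcd b d"] by (auto simp: coprime_iff_gcd_eq_1)
  obtain u where u: "coprime u d" "[u = 1] (mod (d div p))" "\<chi> u \<noteq> 1"
    using \<chi> p unfolding primitive_char_def by blast
  obtain b' where b': "b = p * b'" using p(2) by (auto elim: dvdE)
  have "[p * u = p * 1] (mod (p * (d div p)))"
    using u(2) by (simp add: Cong.cong_def mult_mod_right[symmetric])
  then have "[p * u = p] (mod d)" using p(3) by simp
  then have "[b' * (p * u) = b' * p] (mod d)" by (rule cong_scalar_left)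
  then have "gauss_sum d \<chi> (b * u) = gauss_sum d \<chi> b"
    by (intro gauss_sum_cong d) (simp add: b' mult_ac)
  then have "\<chi> u * gauss_sum d \<chi> b = gauss_sum d \<chi> b" using gauss_sum_unit_mult[OF \<chi>' d u(1), of b] by simp
  then have "gauss_sum d \<chi> b = 0" using u(3) by simp
  then show ?thesis using b0 by simp
qed

text \<open>The sum of the squared moduli of all Gauss sums is computed twice: orthogonality of
  additive characters gives \<open>totient d * d\<close>, and \<open>gauss_sum_primitive\<close>
  gives \<open>totient d\<close> times the squared modulus at \<open>1\<close>.\<close>

lemma norm_gauss_sum_primitive:
  assumes \<chi>: "primitive_char d \<chi>" and d: "d > 0"
  shows "cmod (gauss_sum d \<chi> 1) = sqrt (real d)"
proof -
  have \<chi>': "dirichlet_char d \<chi>" using \<chi> by (simp add: primitive_char_def)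
  let ?\<tau> = "gauss_sum d \<chi> 1"
  have "(\<Sum>b<d. gauss_sum d \<chi> b * cnj (gauss_sum d \<chi> b)) =
     (\<Sum>b<d. \<Sum>n<d. \<Sum>k<d. \<chi> n * cnj (\<chi> k) * uexp (real b * of_int (int n - int k) / real d))"
    by (simp only: gauss_sum_def cnj_sum sum_product complex_cnj_mult cnj_uexp)
      (simp add: mult_ac diff_divide_distrib right_diff_distrib flip: uexp_add)
  also have "\<dots> = (\<Sum>n<d. \<Sum>b<d. \<Sum>k<d. \<chi> n * cnj (\<chi> k) * uexp (real b * of_int (int n - int k) / real d))"
    by (rule sum.swap)
  also have "\<dots> = (\<Sum>n<d. \<Sum>k<d. \<Sum>b<d. \<chi> n * cnj (\<chi> k) * uexp (real b * of_int (int n - int k) / real d))"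
    by (intro sum.cong refl sum.swap)
  also have "\<dots> = (\<Sum>n<d. \<Sum>k<d. \<chi> n * cnj (\<chi> k) * (if k = n then of_nat d else 0))"
  proof (intro sum.cong refl)
    fix n k assume "n \<in> {..<d}" "k \<in> {..<d}"
    then have "int d dvd int n - int k \<longleftrightarrow> k = n"
      by (auto simp flip: cong_iff_dvd_diff simp: cong_int_iff Cong.cong_def)
    then show "(\<Sum>b<d. \<chi> n * cnj (\<chi> k) * uexp (real b * of_int (int n - int k) / real d)) =
        \<chi> n * cnj (\<chi> k) * (if k = n then of_nat d else 0)"
      unfolding sum_distrib_left[symmetric] sum_uexp_residues[OF d] by simp
  qed
  also have "\<dots> = (\<Sum>n<d. \<chi> n * cnj (\<chi> n) * of_nat d)"
    by (intro sum.cong refl) (simp add: if_distrib[of "\<lambda>x. _ * x"] cong: if_cong)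
  also have "\<dots> = of_nat (totient d) * of_nat d"
    using sum_norm_dirichlet_char[OF \<chi>' d] by (simp flip: sum_distrib_right)
  finally have 1: "(\<Sum>b<d. gauss_sum d \<chi> b * cnj (gauss_sum d \<chi> b)) = of_nat (totient d) * of_nat d" .
  have "(\<Sum>b<d. gauss_sum d \<chi> b * cnj (gauss_sum d \<chi> b)) = (\<Sum>b<d. (\<chi> b * cnj (\<chi> b)) * (?\<tau> * cnj ?\<tau>))"
    by (intro sum.cong refl) (subst (1 2) gauss_sum_primitive[OF \<chi> d], simp add: mult_ac)
  also have "\<dots> = of_nat (totient d) * (?\<tau> * cnj ?\<tau>)"
    using sum_norm_dirichlet_char[OF \<chi>' d] by (simp only: sum_distrib_right[symmetric])
  finally have "?\<tau> * cnj ?\<tau> = of_nat d" using 1 d by simp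
  then have "(cmod ?\<tau>)\<^sup>2 = real d"
    by (metis complex_norm_square of_real_eq_iff of_real_of_nat_eq)
  then show ?thesis by (metis norm_ge_zero real_sqrt_unique)
qed

section \<open>Fourier expansion of partial sums\<close>

lemma sum_inverse_le_ln:
  assumes "n \<ge> 1"
  shows "(\<Sum>b=1..n. 1 / real b) \<le> 1 + ln (real n)"
  using assms
proof (induction n rule: dec_induct)
  case base then show ?case by simp
next
  case (step n)
  have "1 / real (Suc n) \<le> ln (real (Suc n)) - ln (real n)"
  proof -
    have "ln (real n / real (Suc n)) \<le> real n / real (Suc n) - 1"
      using step by (intro ln_le_minus_one) auto
    also have "\<dots> = - (1 / real (Suc n))" by (simp add: field_simps)
    finally show ?thesis using step by (simp add: ln_div)
  qed
  then show ?case using step by simp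
qed

definition fourier_weight :: "nat \<Rightarrow> nat \<Rightarrow> complex" where
  "fourier_weight d b = 1 / (of_nat d * (uexp (real b / real d) - 1))"

definition fourier_coeff :: "nat \<Rightarrow> real \<Rightarrow> nat \<Rightarrow> complex" where
  "fourier_coeff d \<theta> b = fourier_weight d b * (1 - uexp (- (real b * \<theta>)))"

lemma uexp_residue_neq_1:
  assumes "b \<in> {1..<d}"
  shows "uexp (real b / real d) \<noteq> 1"
proof -
  have "\<not> int d dvd int b" using assms by (auto dest: zdvd_imp_le)
  then show ?thesis using uexp_eq_1_residue[of d "int b"] assms by simp
qed

lemma fourier_coeff_eq:
  assumes b: "b \<in> {1..<d}"
  shows "(\<Sum>k=1..t. uexp (- (real b * real k / real d))) / of_nat d = fourier_coeff d (real t / real d) b"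
proof -
  define z where "z = uexp (- (real b / real d))"
  have z: "z \<noteq> 0" "inverse z = uexp (real b / real d)"
    by (simp_all add: z_def uexp_def cis_inverse)
  then have z1: "z \<noteq> 1" using uexp_residue_neq_1[OF b] by auto
  have "(\<Sum>k=1..t. uexp (- (real b * real k / real d))) = (\<Sum>k<t. z * z ^ k)"
  proof (rule sum.reindex_bij_witness[of _ Suc "\<lambda>k. k - 1"])
    fix k assume "k \<in> {1..t}"
    then have "z * z ^ (k - 1) = z ^ k" by (simp add: power_eq_if)
    also have "\<dots> = uexp (- (real b * real k / real d))" by (simp add: z_def uexp_power mult.commute)
    finally show "z * z ^ (k - 1) = uexp (- (real b * real k / real d))" .
  qed auto
  also have "\<dots> = z * ((1 - z ^ t) / (1 - z))" using z1 by (simp add: sum_gp_strict flip: sum_distrib_left)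
  also have "\<dots> = (1 - z ^ t) / (inverse z - 1)" using z z1 by (simp add: field_simps)
  also have "z ^ t = uexp (- (real b * (real t / real d)))" by (simp add: z_def uexp_power mult_ac)
  finally show ?thesis by (simp add: z(2) fourier_coeff_def fourier_weight_def mult.commute)
qed

text \<open>The condition that \<open>n\<close> equals some \<open>k \<le> t\<close> is detected by
  additive characters modulo \<open>d\<close>; summing over \<open>n\<close> first produces Gauss
  sums, which \<open>gauss_sum_primitive\<close> evaluates.\<close>

lemma char_partial_sum_fourier:
  assumes \<chi>: "primitive_char d \<chi>" and d: "d > 1" and t: "t < d"
  shows "(\<Sum>n=1..t. \<chi> n) = gauss_sum d \<chi> 1 * (\<Sum>b=1..<d. cnj (\<chi> b) * fourier_coeff d (real t / real d) b)"
proof -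
  define c where "c b = (\<Sum>k=1..t. uexp (- (real b * real k / real d))) / of_nat d" for b
  have \<chi>': "dirichlet_char d \<chi>" using \<chi> by (simp add: primitive_char_def)
  have d0: "d > 0" using d by simp
  have "\<chi> 0 = 0" using norm_dirichlet_char[OF \<chi>' d0, of 0] d by simp
  have "(\<Sum>b<d. c b * gauss_sum d \<chi> b) =
     (\<Sum>b<d. \<Sum>k=1..t. \<Sum>n<d. \<chi> n * (uexp (real b * of_int (int n - int k) / real d) / of_nat d))"
    unfolding c_def gauss_sum_def sum_divide_distrib sum_product
    by (intro sum.cong refl) (simp add: diff_divide_distrib right_diff_distrib mult_ac flip: uexp_add)
  also have "\<dots> = (\<Sum>k=1..t. \<Sum>b<d. \<Sum>n<d. \<chi> n * (uexp (real b * of_int (int n - int k) / real d) / of_nat d))"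
    by (rule sum.swap)
  also have "\<dots> = (\<Sum>k=1..t. \<Sum>n<d. \<Sum>b<d. \<chi> n * (uexp (real b * of_int (int n - int k) / real d) / of_nat d))"
    by (intro sum.cong refl sum.swap)
  also have "\<dots> = (\<Sum>k=1..t. \<Sum>n<d. \<chi> n * (if n = k then 1 else 0))"
  proof (intro sum.cong refl)
    fix k n assume "k \<in> {1..t}" "n \<in> {..<d}"
    then have "int d dvd int n - int k \<longleftrightarrow> n = k"
      using t by (auto simp flip: cong_iff_dvd_diff simp: cong_int_iff Cong.cong_def)
    then show "(\<Sum>b<d. \<chi> n * (uexp (real b * of_int (int n - int k) / real d) / of_nat d)) =
        \<chi> n * (if n = k then 1 else 0)"
      unfolding sum_distrib_left[symmetric] sum_divide_distrib[symmetric] sum_uexp_residues[OF d0] using d by simp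
  qed
  also have "\<dots> = (\<Sum>k=1..t. \<chi> k)"
    using t by (intro sum.cong refl) (simp add: if_distrib[of "\<lambda>x. _ * x"] cong: if_cong)
  finally have "(\<Sum>k=1..t. \<chi> k) = (\<Sum>b<d. c b * gauss_sum d \<chi> b)" ..
  also have "\<dots> = (\<Sum>b<d. gauss_sum d \<chi> 1 * (cnj (\<chi> b) * c b))"
    by (intro sum.cong refl) (subst gauss_sum_primitive[OF \<chi> d0], simp add: mult_ac)
  also have "\<dots> = gauss_sum d \<chi> 1 * (\<Sum>b<d. cnj (\<chi> b) * c b)" by (simp add: sum_distrib_left)
  \<comment> \<open>The frequency \<open>b = 0\<close>, where \<open>fourier_weight\<close> would
    divide by zero, drops out because \<open>\<chi> 0 = 0\<close>.\<close>
  also have "(\<Sum>b<d. cnj (\<chi> b) * c b) = (\<Sum>b=1..<d. cnj (\<chi> b) * c b)"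
    using \<open>\<chi> 0 = 0\<close> by (intro sum.mono_neutral_right) (auto simp: not_less_eq_eq)
  also have "\<dots> = (\<Sum>b=1..<d. cnj (\<chi> b) * fourier_coeff d (real t / real d) b)"
    unfolding c_def by (intro sum.cong refl arg_cong2[where f = "(*)"] fourier_coeff_eq)
  finally show ?thesis .
qed

section \<open>Size and variation of the Fourier coefficients\<close>

lemma norm_fourier_weight_le:
  assumes "b > 0" "2 * b \<le> d"
  shows "cmod (fourier_weight d b) \<le> 1 / (2 * real b)"
proof -
  have "2 * (real b / real d) \<le> cmod (uexp (real b / real d) - 1)"
    using assms by (intro norm_uexp_minus_1_ge) (auto simp: field_simps)
  then have "2 * real b \<le> real d * cmod (uexp (real b / real d) - 1)"
    using assms by (simp add: field_simps)
  then have "1 / (real d * cmod (uexp (real b / real d) - 1)) \<le> 1 / (2 * real b)"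
    using assms by (intro divide_left_mono mult_pos_pos) (auto intro: order.strict_trans2)
  then show ?thesis by (simp add: fourier_weight_def norm_divide norm_mult)
qed

lemma norm_fourier_coeff_le:
  assumes "b > 0" "2 * b \<le> d"
  shows "cmod (fourier_coeff d \<theta> b) \<le> 1 / real b"
proof -
  have "cmod (1 - uexp (- (real b * \<theta>))) \<le> 2"
    using norm_triangle_ineq4[of 1 "uexp (- (real b * \<theta>))"] by simp
  then have "cmod (fourier_coeff d \<theta> b) \<le> (1 / (2 * real b)) * 2"
    unfolding fourier_coeff_def norm_mult by (intro mult_mono norm_fourier_weight_le assms) auto
  then show ?thesis by simp
qed

text \<open>The factor \<open>b\<close> in the Lipschitz constant of the exponential cancels against
  the weight. The resulting uniformity in \<open>b\<close> determines the mesh in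
  \<open>grid_size\<close>.\<close>

lemma norm_fourier_coeff_diff_le:
  assumes "b > 0" "2 * b \<le> d"
  shows "cmod (fourier_coeff d \<theta> b - fourier_coeff d \<theta>' b) \<le> 4 * \<bar>\<theta> - \<theta>'\<bar>"
proof -
  have "fourier_coeff d \<theta> b - fourier_coeff d \<theta>' b =
      fourier_weight d b * (uexp (- (real b * \<theta>')) - uexp (- (real b * \<theta>)))"
    by (simp add: fourier_coeff_def algebra_simps)
  then have "cmod (fourier_coeff d \<theta> b - fourier_coeff d \<theta>' b) \<le>
      (1 / (2 * real b)) * (2 * pi * \<bar>- (real b * \<theta>') - - (real b * \<theta>)\<bar>)"
    by (simp only: norm_mult) (intro mult_mono norm_uexp_diff_le norm_fourier_weight_le[OF assms]; simp)
  also have "\<bar>- (real b * \<theta>') - - (real b * \<theta>)\<bar> = real b * \<bar>\<theta> - \<theta>'\<bar>"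
    by (simp add: abs_mult flip: right_diff_distrib)
  also have "(1 / (2 * real b)) * (2 * pi * (real b * \<bar>\<theta> - \<theta>'\<bar>)) = pi * \<bar>\<theta> - \<theta>'\<bar>"
    using assms by simp
  also have "\<dots> \<le> 4 * \<bar>\<theta> - \<theta>'\<bar>" using pi_less_4 by (intro mult_right_mono) auto
  finally show ?thesis .
qed

text \<open>A difference of reciprocals, bounded in a telescoping shape so that its sum over
  \<open>b\<close> collapses in \<open>norm_fourier_tail_le\<close>.\<close>

lemma norm_fourier_weight_diff_le:
  assumes "b > 0" "2 * Suc b \<le> d"
  shows "cmod (fourier_weight d (Suc b) - fourier_weight d b) \<le> 2 * (1 / real b - 1 / real (Suc b))"
proof -
  let ?x = "uexp (real b / real d)" and ?y = "uexp (real (Suc b) / real d)"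
  have xy: "?x \<noteq> 1" "?y \<noteq> 1" using assms by (intro uexp_residue_neq_1; simp)+
  have d: "d > 0" using assms by simp
  have "fourier_weight d (Suc b) - fourier_weight d b =
      of_nat d * (?x - ?y) * fourier_weight d b * fourier_weight d (Suc b)"
    using xy d by (simp add: fourier_weight_def field_simps)
  then have "cmod (fourier_weight d (Suc b) - fourier_weight d b) =
      real d * cmod (?x - ?y) * cmod (fourier_weight d b) * cmod (fourier_weight d (Suc b))"
    by (simp add: norm_mult)
  also have "\<dots> \<le> real d * (2 * pi * \<bar>real b / real d - real (Suc b) / real d\<bar>) * (1 / (2 * real b)) * (1 / (2 * real (Suc b)))"
    using assms by (intro mult_mono norm_uexp_diff_le norm_fourier_weight_le mult_nonneg_nonneg) auto
  also have "\<bar>real b / real d - real (Suc b) / real d\<bar> = 1 / real d" by (simp add: diff_divide_distrib[symmetric])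
  also have "real d * (2 * pi * (1 / real d)) * (1 / (2 * real b)) * (1 / (2 * real (Suc b))) =
      (pi / 2) * (1 / real b - 1 / real (Suc b))"
    using d assms by (simp add: field_simps)
  also have "\<dots> \<le> 2 * (1 / real b - 1 / real (Suc b))"
    using pi_half_less_two assms by (intro mult_right_mono) (auto simp: field_simps)
  finally show ?thesis .
qed

section \<open>The Polya-Vinogradov inequality and the tail of the expansion\<close>

lemma sum_inverse_norm_uexp_le:
  assumes d: "d > 1"
  shows "(\<Sum>k=1..<d. 1 / cmod (uexp (real k / real d) - 1)) \<le> real d * (1 + ln (real d))"
proof -
  have "1 / cmod (uexp (real k / real d) - 1) \<le> (real d / 2) * (1 / real k + 1 / real (d - k))"
    if k: "k \<in> {1..<d}" for k
  proof -
    let ?x = "real k / real d" and ?m = "min (real k) (real (d - k))"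
    have m: "?m > 0" using k by auto
    have "2 * min ?x (1 - ?x) \<le> cmod (uexp ?x - 1)" using k by (intro norm_uexp_minus_1_ge') auto
    moreover have "min ?x (1 - ?x) = ?m / real d"
      using k by (simp add: min_def field_simps of_nat_diff)
    ultimately have "2 * ?m / real d \<le> cmod (uexp ?x - 1)" by simp
    then have "1 / cmod (uexp ?x - 1) \<le> 1 / (2 * ?m / real d)"
      using m d by (intro frac_le) auto
    also have "\<dots> = (real d / 2) * (1 / ?m)" by simp
    also have "\<dots> \<le> (real d / 2) * (1 / real k + 1 / real (d - k))"
      using k by (intro mult_left_mono) (auto simp: min_def)
    finally show ?thesis .
  qed
  then have "(\<Sum>k=1..<d. 1 / cmod (uexp (real k / real d) - 1)) \<le>
      (\<Sum>k=1..<d. (real d / 2) * (1 / real k + 1 / real (d - k)))" by (rule sum_mono)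
  also have "\<dots> = (real d / 2) * ((\<Sum>k=1..<d. 1 / real k) + (\<Sum>k=1..<d. 1 / real (d - k)))"
    by (simp only: sum.distrib distrib_left sum_distrib_left)
  also have "(\<Sum>k=1..<d. 1 / real (d - k)) = (\<Sum>k=1..<d. 1 / real k)"
    by (rule sum.reindex_bij_witness[of _ "\<lambda>k. d - k" "\<lambda>k. d - k"]) auto
  also have "(real d / 2) * ((\<Sum>k=1..<d. 1 / real k) + (\<Sum>k=1..<d. 1 / real k)) = real d * (\<Sum>k=1..<d. 1 / real k)"
    by simp
  also have "\<dots> \<le> real d * (1 + ln (real d))"
  proof (rule mult_left_mono)
    have "(\<Sum>k=1..<d. 1 / real k) \<le> (\<Sum>k=1..d. 1 / real k)" by (intro sum_mono2) auto
    also have "\<dots> \<le> 1 + ln (real d)" using d by (intro sum_inverse_le_ln) auto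
    finally show "(\<Sum>k=1..<d. 1 / real k) \<le> 1 + ln (real d)" .
  qed simp
  finally show ?thesis .
qed

text \<open>Multiplication by the Gauss sum turns \<open>cnj (\<chi> b)\<close> into additive
  characters, and the twist merely shifts the frequency \<open>n / d\<close> to
  \<open>(n - t) / d\<close>. The case \<open>n = t\<close> costs at most \<open>d\<close>; the
  geometric sums for \<open>n > t\<close> and for \<open>n < t\<close> cost
  \<open>2 * d * (1 + ln d)\<close> each. This gives the constant
  \<open>1 + 2 + 2 = 5\<close>.\<close>

lemma polya_vinogradov_twisted:
  assumes \<chi>: "primitive_char d \<chi>" and d: "d > 1" and t: "t < d" and x: "x \<le> d"
  shows "cmod (\<Sum>b=1..x. cnj (\<chi> b) * uexp (- (real b * (real t / real d)))) \<le> 5 * sqrt (real d) * (1 + ln (real d))"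
proof -
  have \<chi>': "dirichlet_char d \<chi>" using \<chi> by (simp add: primitive_char_def)
  have d0: "d > 0" using d by simp
  let ?V = "\<Sum>b=1..x. cnj (\<chi> b) * uexp (- (real b * (real t / real d)))"
  define W where "W n = (\<Sum>b=1..x. uexp (real b * ((real n - real t) / real d)))" for n
  have "gauss_sum d \<chi> 1 * ?V = (\<Sum>b=1..x. gauss_sum d \<chi> b * uexp (- (real b * (real t / real d))))"
    unfolding sum_distrib_left
    by (intro sum.cong refl) (subst (2) gauss_sum_primitive[OF \<chi> d0], simp add: mult_ac)
  also have "\<dots> = (\<Sum>b=1..x. \<Sum>n<d. \<chi> n * uexp (real b * ((real n - real t) / real d)))"
    unfolding gauss_sum_def sum_distrib_right
    by (intro sum.cong refl) (simp add: diff_divide_distrib right_diff_distrib mult_ac flip: uexp_add)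
  also have "\<dots> = (\<Sum>n<d. \<chi> n * W n)" unfolding W_def sum_distrib_left by (rule sum.swap)
  finally have "gauss_sum d \<chi> 1 * ?V = (\<Sum>n<d. \<chi> n * W n)" .
  then have "sqrt (real d) * cmod ?V = cmod (\<Sum>n<d. \<chi> n * W n)"
    by (metis norm_gauss_sum_primitive[OF \<chi> d0] norm_mult)
  also have "\<dots> \<le> (\<Sum>n<d. cmod (W n))"
    by (rule sum_norm_le) (simp add: norm_mult mult_left_le_one_le norm_dirichlet_char_le_1[OF \<chi>' d0])
  also have "{..<d} = insert t ({t<..<d} \<union> {..<t})" using t by auto
  also have "(\<Sum>n\<in>insert t ({t<..<d} \<union> {..<t}). cmod (W n)) =
      cmod (W t) + ((\<Sum>n\<in>{t<..<d}. cmod (W n)) + (\<Sum>n<t. cmod (W n)))"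
    by (subst sum.insert) (auto intro!: sum.union_disjoint)
  also have "\<dots> \<le> real d + (2 * (real d * (1 + ln (real d))) + 2 * (real d * (1 + ln (real d))))"
  proof (intro add_mono)
    have "cmod (W t) \<le> (\<Sum>b=1..x. 1)" unfolding W_def by (rule sum_norm_le) simp
    then show "cmod (W t) \<le> real d" using x by simp
  next
    have "(\<Sum>n\<in>{t<..<d}. cmod (W n)) \<le> (\<Sum>n\<in>{t<..<d}. 2 / cmod (uexp (real (n - t) / real d) - 1))"
    proof (rule sum_mono)
      fix n assume n: "n \<in> {t<..<d}"
      then have "uexp (real (n - t) / real d) \<noteq> 1" by (intro uexp_residue_neq_1) auto
      then show "cmod (W n) \<le> 2 / cmod (uexp (real (n - t) / real d) - 1)"
        using norm_sum_uexp_le[of "real (n - t) / real d" x] n by (simp add: W_def of_nat_diff)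
    qed
    also have "\<dots> = (\<Sum>k\<in>{1..<d-t}. 2 / cmod (uexp (real k / real d) - 1))"
      by (rule sum.reindex_bij_witness[of _ "\<lambda>k. k + t" "\<lambda>n. n - t"]) auto
    also have "\<dots> \<le> (\<Sum>k\<in>{1..<d}. 2 / cmod (uexp (real k / real d) - 1))" by (intro sum_mono2) auto
    also have "\<dots> = 2 * (\<Sum>k\<in>{1..<d}. 1 / cmod (uexp (real k / real d) - 1))" by (simp add: sum_distrib_left)
    also have "\<dots> \<le> 2 * (real d * (1 + ln (real d)))" using sum_inverse_norm_uexp_le[OF d] by simp
    finally show "(\<Sum>n\<in>{t<..<d}. cmod (W n)) \<le> 2 * (real d * (1 + ln (real d)))" .
  next
    have "(\<Sum>n<t. cmod (W n)) \<le> (\<Sum>n<t. 2 / cmod (uexp (real (t - n) / real d) - 1))"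
    proof (rule sum_mono)
      fix n assume n: "n \<in> {..<t}"
      have neg: "cmod (uexp (- y) - 1) = cmod (uexp y - 1)" for y by (simp add: norm_uexp_minus_1)
      have u: "uexp (real (t - n) / real d) \<noteq> 1" using n t by (intro uexp_residue_neq_1) auto
      then have "uexp (- (real (t - n) / real d)) \<noteq> 1" using neg[of "real (t - n) / real d"] by force
      moreover have "(real n - real t) / real d = - (real (t - n) / real d)"
        using n by (simp add: of_nat_diff diff_divide_distrib)
      ultimately show "cmod (W n) \<le> 2 / cmod (uexp (real (t - n) / real d) - 1)"
        using norm_sum_uexp_le[of "- (real (t - n) / real d)" x] by (simp only: neg W_def not_False_eq_True simp_thms)
    qed
    also have "\<dots> = (\<Sum>k\<in>{1..t}. 2 / cmod (uexp (real k / real d) - 1))"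
      by (rule sum.reindex_bij_witness[of _ "\<lambda>k. t - k" "\<lambda>n. t - n"]) auto
    also have "\<dots> \<le> (\<Sum>k\<in>{1..<d}. 2 / cmod (uexp (real k / real d) - 1))" using t by (intro sum_mono2) auto
    also have "\<dots> = 2 * (\<Sum>k\<in>{1..<d}. 1 / cmod (uexp (real k / real d) - 1))" by (simp add: sum_distrib_left)
    also have "\<dots> \<le> 2 * (real d * (1 + ln (real d)))" using sum_inverse_norm_uexp_le[OF d] by simp
    finally show "(\<Sum>n<t. cmod (W n)) \<le> 2 * (real d * (1 + ln (real d)))" .
  qed
  also have "\<dots> \<le> 5 * (real d * (1 + ln (real d)))" using d by (simp add: algebra_simps)
  also have "\<dots> = 5 * ((sqrt (real d) * sqrt (real d)) * (1 + ln (real d)))" by simp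
  also have "\<dots> = sqrt (real d) * (5 * sqrt (real d) * (1 + ln (real d)))" by (simp only: mult_ac)
  finally show ?thesis using d0 by (subst (asm) mult_le_cancel_left_pos) auto
qed

lemma abel_summation:
  fixes v w :: "nat \<Rightarrow> 'a::comm_ring_1"
  assumes "B < H"
  defines "P \<equiv> (\<lambda>x. \<Sum>b=1..x. v b)"
  shows "(\<Sum>b\<in>{B<..H}. v b * w b) = P H * w H - P B * w (Suc B) - (\<Sum>b\<in>{Suc B..<H}. P b * (w (Suc b) - w b))"
proof -
  have "Suc B \<le> H" using assms by simp
  then show ?thesis
  proof (induction H rule: dec_induct)
    case base
    have "{B<..Suc B} = {Suc B}" by auto
    then show ?case by (simp add: P_def algebra_simps)
  next
    case (step n)
    have "{B<..Suc n} = insert (Suc n) {B<..n}" using step by auto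
    then have "(\<Sum>b\<in>{B<..Suc n}. v b * w b) = v (Suc n) * w (Suc n) + (\<Sum>b\<in>{B<..n}. v b * w b)" by simp
    then show ?case using step by (simp add: P_def algebra_simps)
  qed
qed

text \<open>Abel summation: the partial sums without weight are a plain minus a twisted
  Polya-Vinogradov sum, hence bounded by \<open>Q\<close>. The two boundary terms and the
  telescoping variation of the weight contribute \<open>1 + 1 + 2\<close> times
  \<open>Q / B\<close>.\<close>

lemma norm_fourier_tail_le:
  assumes \<chi>: "primitive_char d \<chi>" and d: "d > 1" and t: "t < d" and B: "B > 0" and H: "B \<le> H" "2 * H \<le> d"
  shows "cmod (\<Sum>b\<in>{B<..H}. cnj (\<chi> b) * fourier_coeff d (real t / real d) b)
    \<le> 40 * sqrt (real d) * (1 + ln (real d)) / real B"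
proof (cases "B < H")
  case False
  then show ?thesis using d by simp
next
  case True
  define Q where "Q = 10 * sqrt (real d) * (1 + ln (real d))"
  have Q: "Q \<ge> 0" using d by (simp add: Q_def)
  define v where "v b = cnj (\<chi> b) * (1 - uexp (- (real b * (real t / real d))))" for b
  define P where "P x = (\<Sum>b=1..x. v b)" for x
  let ?w = "fourier_weight d"
  have tri: "cmod (a - b - c) \<le> cmod a + cmod b + cmod c" for a b c :: complex
    using norm_triangle_ineq4[of "a - b" c] norm_triangle_ineq4[of a b] by linarith
  have P: "cmod (P x) \<le> Q" if "x \<le> d" for x
  proof -
    define V where "V s = (\<Sum>b=1..x. cnj (\<chi> b) * uexp (- (real b * (real s / real d))))" for s :: nat
    have "P x = V 0 - V t"
      by (simp add: P_def v_def V_def sum_subtractf right_diff_distrib)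
    then have "cmod (P x) \<le> cmod (V 0) + cmod (V t)" using norm_triangle_ineq4[of "V 0" "V t"] by simp
    also have "\<dots> \<le> 5 * sqrt (real d) * (1 + ln (real d)) + 5 * sqrt (real d) * (1 + ln (real d))"
      using d t that unfolding V_def by (intro add_mono polya_vinogradov_twisted[OF \<chi>]) auto
    finally show ?thesis by (simp add: Q_def)
  qed
  have "(\<Sum>b\<in>{B<..H}. cnj (\<chi> b) * fourier_coeff d (real t / real d) b) = (\<Sum>b\<in>{B<..H}. v b * ?w b)"
    by (intro sum.cong refl) (simp add: v_def fourier_coeff_def mult_ac)
  also have "\<dots> = P H * ?w H - P B * ?w (Suc B) - (\<Sum>b\<in>{Suc B..<H}. P b * (?w (Suc b) - ?w b))"
    unfolding P_def by (rule abel_summation[OF True])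
  also have "cmod \<dots> \<le> cmod (P H * ?w H) + cmod (P B * ?w (Suc B)) + cmod (\<Sum>b\<in>{Suc B..<H}. P b * (?w (Suc b) - ?w b))"
    by (rule tri)
  also have "\<dots> \<le> Q * (1 / real B) + Q * (1 / real B) + Q * (2 / real B)"
  proof (intro add_mono)
    show "cmod (P H * ?w H) \<le> Q * (1 / real B)"
      unfolding norm_mult
    proof (intro mult_mono P)
      have "cmod (?w H) \<le> 1 / (2 * real H)" using B H by (intro norm_fourier_weight_le) auto
      also have "\<dots> \<le> 1 / real B" using B H by (intro divide_left_mono) auto
      finally show "cmod (?w H) \<le> 1 / real B" .
    qed (use H Q in auto)
    show "cmod (P B * ?w (Suc B)) \<le> Q * (1 / real B)"
      unfolding norm_mult
    proof (intro mult_mono P)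
      have "cmod (?w (Suc B)) \<le> 1 / (2 * real (Suc B))" using True H by (intro norm_fourier_weight_le) auto
      also have "\<dots> \<le> 1 / real B" using B H by (intro divide_left_mono) auto
      finally show "cmod (?w (Suc B)) \<le> 1 / real B" .
    qed (use H Q in auto)
    have "cmod (\<Sum>b\<in>{Suc B..<H}. P b * (?w (Suc b) - ?w b)) \<le>
        (\<Sum>b\<in>{Suc B..<H}. Q * (2 * (1 / real b - 1 / real (Suc b))))"
    proof (rule sum_norm_le)
      fix b assume b: "b \<in> {Suc B..<H}"
      show "cmod (P b * (?w (Suc b) - ?w b)) \<le> Q * (2 * (1 / real b - 1 / real (Suc b)))"
        unfolding norm_mult
        by (intro mult_mono P norm_fourier_weight_diff_le) (use b H B Q in auto)
    qed
    also have "\<dots> = Q * (2 * (\<Sum>b\<in>{Suc B..<H}. - (1 / real (Suc b)) - - (1 / real b)))"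
      unfolding sum_distrib_left by (intro sum.cong refl) simp
    also have "(\<Sum>b\<in>{Suc B..<H}. - (1 / real (Suc b)) - - (1 / real b)) = - (1 / real H) - - (1 / real (Suc B))"
      using True by (intro sum_Suc_diff') auto
    also have "\<dots> \<le> 1 / real B" using B by (simp add: field_simps)
    finally show "cmod (\<Sum>b\<in>{Suc B..<H}. P b * (?w (Suc b) - ?w b)) \<le> Q * (2 / real B)"
      using Q by (simp add: mult_left_mono)
  qed
  also have "\<dots> = 40 * sqrt (real d) * (1 + ln (real d)) / real B"
    by (simp add: Q_def field_simps)
  finally show ?thesis .
qed

section \<open>Dyadic blocks\<close>

lemma sum_inverse_squares_le:
  assumes "J1 \<ge> 1"
  shows "(\<Sum>j\<in>{J1..<J}. 1 / (real j)\<^sup>2) \<le> 2"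
proof -
  have le: "(\<Sum>j\<in>{1..n}. 1 / (real j)\<^sup>2) \<le> 2 - 1 / real n" if "n \<ge> 1" for n
    using that
  proof (induction n rule: dec_induct)
    case base then show ?case by simp
  next
    case (step n)
    have "1 / (real (Suc n))\<^sup>2 \<le> 1 / (real n * real (Suc n))"
      using step by (intro divide_left_mono) (auto simp: power2_eq_square)
    also have "\<dots> = 1 / real n - 1 / real (Suc n)" using step by (simp add: field_simps)
    finally show ?case using step by simp
  qed
  have "(\<Sum>j\<in>{J1..<J}. 1 / (real j)\<^sup>2) \<le> (\<Sum>j\<in>{1..Suc J}. 1 / (real j)\<^sup>2)"
    using assms by (intro sum_mono2) auto
  also have "\<dots> \<le> 2 - 1 / real (Suc J)" by (rule le) simp
  also have "\<dots> \<le> 2" by simp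
  finally show ?thesis .
qed

lemma sum_greaterThanAtMost_split:
  fixes f :: "nat \<Rightarrow> 'a::comm_monoid_add"
  assumes "a \<le> b" "b \<le> c"
  shows "sum f {a<..c} = sum f {a<..b} + sum f {b<..c}"
proof -
  have "{a<..c} = {a<..b} \<union> {b<..c}" using assms by auto
  then show ?thesis by (simp only:) (intro sum.union_disjoint, auto)
qed

lemma sum_dyadic_blocks:
  fixes f :: "nat \<Rightarrow> 'a::comm_monoid_add"
  assumes "i \<le> j"
  shows "sum f {2 ^ i<..2 ^ j} = (\<Sum>k\<in>{i..<j}. sum f {2 ^ k<..2 ^ Suc k})"
  using assms
proof (induction j rule: dec_induct)
  case base then show ?case by simp
next
  case (step j)
  have "(2::nat) ^ i \<le> 2 ^ j" using step by (intro power_increasing) auto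
  then have "sum f {2 ^ i<..2 ^ Suc j} = sum f {2 ^ i<..2 ^ j} + sum f {2 ^ j<..2 ^ Suc j}"
    by (rule sum_greaterThanAtMost_split) simp
  then show ?case using step by (simp add: sum.atLeastLessThan_Suc)
qed

text \<open>A block has \<open>2 ^ j\<close> terms, each changing by at most
  \<open>4 / grid_size j\<close> when \<theta> is rounded to the grid. The total change is at most
  \<open>1 / j ^ 2\<close>, which is summable over the blocks.\<close>

definition grid_size :: "nat \<Rightarrow> nat" where "grid_size j = 4 * 2 ^ j * j\<^sup>2"

text \<open>The thresholds \<open>T / j ^ 2\<close> are summable over \<open>j\<close>.
  \<open>T\<close> stays free: it will be \<open>1\<close> for conductor \<open>q\<close> and grow
  with \<open>q / d\<close> for a smaller conductor \<open>d\<close>.\<close>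

definition small_blocks :: "nat \<Rightarrow> nat \<Rightarrow> nat \<Rightarrow> real \<Rightarrow> (nat \<Rightarrow> complex) \<Rightarrow> bool" where
  "small_blocks d J1 J T \<psi> \<longleftrightarrow> (\<forall>j\<in>{J1..<J}. \<forall>k<grid_size j.
     cmod (\<Sum>b\<in>{2 ^ j<..2 ^ Suc j}. fourier_coeff d (real k / real (grid_size j)) b * \<psi> b) \<le> T / (real j)\<^sup>2)"

lemma norm_block_le:
  assumes good: "small_blocks d J1 J T \<psi>" and j: "j \<in> {J1..<J}" and J1: "J1 \<ge> 1"
    and \<psi>: "\<And>b. cmod (\<psi> b) \<le> 1" and \<theta>: "0 \<le> \<theta>" "\<theta> < 1" and d: "2 * 2 ^ Suc j \<le> d"
  shows "cmod (\<Sum>b\<in>{2 ^ j<..2 ^ Suc j}. \<psi> b * fourier_coeff d \<theta> b) \<le> (T + 1) / (real j)\<^sup>2"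
proof -
  let ?R = "grid_size j" and ?I = "{2 ^ j<..(2::nat) ^ Suc j}"
  have j1: "j \<ge> 1" using j J1 by auto
  have R: "real ?R > 0" using j1 by (simp add: grid_size_def)
  define k where "k = nat \<lfloor>\<theta> * real ?R\<rfloor>"
  have kr: "real k = of_int \<lfloor>\<theta> * real ?R\<rfloor>" using \<theta> R by (simp add: k_def)
  have k: "real k \<le> \<theta> * real ?R" "\<theta> * real ?R < real k + 1" unfolding kr by linarith+
  have "\<theta> * real ?R < 1 * real ?R" using \<theta> R by (intro mult_strict_right_mono) auto
  then have "k < ?R" using k by linarith
  have dist: "\<bar>\<theta> - real k / real ?R\<bar> \<le> 1 / real ?R"
  proof -
    have "\<theta> - real k / real ?R = (\<theta> * real ?R - real k) / real ?R" using R by (simp add: field_simps)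
    moreover have "\<bar>\<theta> * real ?R - real k\<bar> \<le> 1" using k by linarith
    ultimately show ?thesis using R by (simp add: abs_divide divide_right_mono)
  qed
  have "(\<Sum>b\<in>?I. \<psi> b * fourier_coeff d \<theta> b) =
      (\<Sum>b\<in>?I. fourier_coeff d (real k / real ?R) b * \<psi> b) +
      (\<Sum>b\<in>?I. \<psi> b * (fourier_coeff d \<theta> b - fourier_coeff d (real k / real ?R) b))"
    by (simp add: algebra_simps flip: sum.distrib)
  also have "cmod \<dots> \<le> T / (real j)\<^sup>2 + 1 / (real j)\<^sup>2"
  proof (intro norm_triangle_mono)
    show "cmod (\<Sum>b\<in>?I. fourier_coeff d (real k / real ?R) b * \<psi> b) \<le> T / (real j)\<^sup>2"
      using good j \<open>k < ?R\<close> unfolding small_blocks_def by blast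
    have "cmod (\<Sum>b\<in>?I. \<psi> b * (fourier_coeff d \<theta> b - fourier_coeff d (real k / real ?R) b))
        \<le> (\<Sum>b\<in>?I. 4 * (1 / real ?R))"
    proof (rule sum_norm_le)
      fix b assume b: "b \<in> ?I"
      have "cmod (\<psi> b) * cmod (fourier_coeff d \<theta> b - fourier_coeff d (real k / real ?R) b)
          \<le> 1 * (4 * \<bar>\<theta> - real k / real ?R\<bar>)"
        using b d by (intro mult_mono \<psi> norm_fourier_coeff_diff_le) auto
      also have "\<dots> \<le> 4 * (1 / real ?R)" using dist by simp
      finally show "cmod (\<psi> b * (fourier_coeff d \<theta> b - fourier_coeff d (real k / real ?R) b))
          \<le> 4 * (1 / real ?R)" by (simp only: norm_mult)
    qed
    also have "\<dots> = 1 / (real j)\<^sup>2" using j1 by (simp add: grid_size_def)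
    finally show "cmod (\<Sum>b\<in>?I. \<psi> b * (fourier_coeff d \<theta> b - fourier_coeff d (real k / real ?R) b))
        \<le> 1 / (real j)\<^sup>2" .
  qed
  finally show ?thesis by (simp add: add_divide_distrib)
qed

lemma norm_fourier_sum_le:
  assumes \<chi>: "primitive_char d \<chi>" and d: "d > 1" and t: "t < d"
    and good: "small_blocks d J1 J T (\<lambda>n. cnj (\<chi> n))" and J: "1 \<le> J1" "J1 \<le> J" and T: "T \<ge> 0"
    and H: "2 ^ J \<le> H" "2 * H \<le> d"
    and tail: "40 * sqrt (real d) * (1 + ln (real d)) / 2 ^ J \<le> 1 / 2"
  shows "cmod (\<Sum>b=1..H. cnj (\<chi> b) * fourier_coeff d (real t / real d) b) \<le> real J1 + 2 * T + 7 / 2"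
proof -
  have \<chi>': "dirichlet_char d \<chi>" using \<chi> by (simp add: primitive_char_def)
  have d0: "d > 0" using d by simp
  define f where "f b = cnj (\<chi> b) * fourier_coeff d (real t / real d) b" for b
  have \<chi>1: "cmod (cnj (\<chi> b)) \<le> 1" for b using norm_dirichlet_char_le_1[OF \<chi>' d0] by simp
  have J12: "(2::nat) ^ J1 \<le> 2 ^ J" using J by (intro power_increasing) auto
  have ivl: "{1..n} = {0<..n}" for n :: nat by auto
  have "(\<Sum>b=1..H. f b) = (\<Sum>b=1..2 ^ J1. f b) + ((\<Sum>b\<in>{2 ^ J1<..2 ^ J}. f b) + (\<Sum>b\<in>{2 ^ J<..H}. f b))"
    unfolding ivl sum_greaterThanAtMost_split[OF J12 H(1), of f, symmetric]
    by (rule sum_greaterThanAtMost_split[OF _ order_trans[OF J12 H(1)]]) simp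
  \<comment> \<open>The summands belong to the initial range (a harmonic sum, with
    \<open>ln 2 \<le> 1\<close>), to the blocks (the \<open>1 / j ^ 2\<close> add up to at most
    \<open>2\<close>) and to the tail.\<close>
  also have "cmod \<dots> \<le> (1 + real J1) + (2 * (T + 1) + 1 / 2)"
  proof (intro norm_triangle_mono)
    have "cmod (\<Sum>b=1..2 ^ J1. f b) \<le> (\<Sum>b=1..2 ^ J1. 1 / real b)"
    proof (rule sum_norm_le)
      fix b assume b: "b \<in> {1..(2::nat) ^ J1}"
      then have "cmod (cnj (\<chi> b)) * cmod (fourier_coeff d (real t / real d) b) \<le> 1 * (1 / real b)"
        using order_trans[of b "2 ^ J1" H] order_trans[OF J12 H(1)] H(2)
        by (intro mult_mono \<chi>1 norm_fourier_coeff_le) auto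
      then show "cmod (f b) \<le> 1 / real b" by (simp only: f_def norm_mult)
    qed
    also have "\<dots> \<le> 1 + ln (real (2 ^ J1))" by (rule sum_inverse_le_ln) simp
    also have "ln (real (2 ^ J1)) = real J1 * ln 2" by (simp add: ln_realpow)
    also have "\<dots> \<le> real J1 * 1" using ln_2_less_1 by (intro mult_left_mono) auto
    finally show "cmod (\<Sum>b=1..2 ^ J1. f b) \<le> 1 + real J1" by simp
  next
    have "cmod (\<Sum>b\<in>{2 ^ J1<..2 ^ J}. f b) \<le> (\<Sum>j\<in>{J1..<J}. (T + 1) * (1 / (real j)\<^sup>2))"
      unfolding sum_dyadic_blocks[OF J(2)]
    proof (rule sum_norm_le)
      fix j assume j: "j \<in> {J1..<J}"
      have "(2::nat) ^ Suc j \<le> 2 ^ J" using j by (intro power_increasing) auto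
      then have "2 * 2 ^ Suc j \<le> d" using H by linarith
      then show "cmod (\<Sum>b\<in>{2 ^ j<..2 ^ Suc j}. f b) \<le> (T + 1) * (1 / (real j)\<^sup>2)"
        using norm_block_le[OF good j J(1) \<chi>1, of "real t / real d"] t d unfolding f_def by simp
    qed
    also have "\<dots> = (T + 1) * (\<Sum>j\<in>{J1..<J}. 1 / (real j)\<^sup>2)" by (simp only: sum_distrib_left)
    also have "\<dots> \<le> (T + 1) * 2" using T by (intro mult_left_mono sum_inverse_squares_le J) auto
    finally show "cmod (\<Sum>b\<in>{2 ^ J1<..2 ^ J}. f b) \<le> 2 * (T + 1)" by simp
  next
    have "cmod (\<Sum>b\<in>{2 ^ J<..H}. f b) \<le> 40 * sqrt (real d) * (1 + ln (real d)) / real (2 ^ J)"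
      unfolding f_def by (rule norm_fourier_tail_le[OF \<chi> d t _ H]) simp
    also have "\<dots> \<le> 1 / 2" using tail by simp
    finally show "cmod (\<Sum>b\<in>{2 ^ J<..H}. f b) \<le> 1 / 2" .
  qed
  finally show ?thesis by (simp add: f_def)
qed

lemma char_partial_sum_periodic:
  assumes \<chi>: "primitive_char d \<chi>" and d: "d > 1"
  shows "(\<Sum>n=1..t. \<chi> n) = (\<Sum>n=1..t mod d. \<chi> n)"
proof -
  have \<chi>': "dirichlet_char d \<chi>" using \<chi> by (simp add: primitive_char_def)
  have d0: "d > 0" using d by simp
  have "\<chi> 0 = 0" using norm_dirichlet_char[OF \<chi>' d0, of 0] d by simp
  moreover have "\<chi> d = \<chi> 0" by (rule dirichlet_char_cong[OF \<chi>']) (simp add: Cong.cong_def)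
  moreover have "{1..d} = insert d {1..<d}" "{..<d} = insert 0 {1..<d}" using d by auto
  ultimately have "(\<Sum>n=1..d. \<chi> n) = (\<Sum>n<d. \<chi> n)" by simp
  also have "\<dots> = gauss_sum d \<chi> 0" by (simp add: gauss_sum_def)
  also have "\<dots> = 0" using \<open>\<chi> 0 = 0\<close> by (subst gauss_sum_primitive[OF \<chi> d0]) simp
  finally have base: "(\<Sum>n=1..d. \<chi> n) = 0" .
  have per: "(\<Sum>n=1..t + d. \<chi> n) = (\<Sum>n=1..t. \<chi> n)" for t
  proof (induction t)
    case 0 then show ?case using base by simp
  next
    case (Suc t)
    have "\<chi> (Suc t + d) = \<chi> (Suc t)" using \<chi>' unfolding dirichlet_char_def by blast
    then show ?case using Suc by simp
  qed
  have "(\<Sum>n=1..t + k * d. \<chi> n) = (\<Sum>n=1..t. \<chi> n)" for t k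
  proof (induction k)
    case (Suc k) then show ?case using per[of "t + k * d"] by (simp add: algebra_simps)
  qed simp
  from this[of "t mod d" "t div d"] show ?thesis by simp
qed

text \<open>The coefficient bounds require \<open>b \<le> d / 2\<close>, so the upper half is
  reflected by \<open>b \<mapsto> d - b\<close>. This conjugates the coefficient and multiplies
  \<chi> by \<open>\<chi> (d - 1)\<close>, and the upper half becomes the conjugate of a sum for the
  conjugate character. Hence the blocks of both characters have to be small.\<close>

lemma char_partial_sum_le:
  assumes \<chi>: "primitive_char d \<chi>" and d: "d > 1"
    and good: "small_blocks d J1 J T (\<lambda>n. cnj (\<chi> n))" "small_blocks d J1 J T \<chi>"
    and J: "1 \<le> J1" "J1 \<le> J" and T: "T \<ge> 1" and Jd: "2 ^ J \<le> d - 1 - d div 2"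
    and tail: "40 * sqrt (real d) * (1 + ln (real d)) / 2 ^ J \<le> 1 / 2"
  shows "cmod (\<Sum>n=1..t. \<chi> n) \<le> sqrt (real d) * (T * (2 * real J1 + 11))"
proof -
  have \<chi>': "dirichlet_char d \<chi>" using \<chi> by (simp add: primitive_char_def)
  have d0: "d > 0" using d by simp
  define s where "s = t mod d"
  have s: "s < d" using d by (simp add: s_def)
  let ?a = "fourier_coeff d (real s / real d)" and ?h = "d div 2"
  \<comment> \<open>For even \<open>d\<close> this is one less than \<open>d div 2\<close>, so that
    \<open>b = d / 2\<close> is counted once.\<close>
  let ?h' = "d - 1 - d div 2"
  have "(\<Sum>n=1..t. \<chi> n) = (\<Sum>n=1..s. \<chi> n)" unfolding s_def by (rule char_partial_sum_periodic[OF \<chi> d])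
  also have "\<dots> = gauss_sum d \<chi> 1 * (\<Sum>b=1..<d. cnj (\<chi> b) * ?a b)"
    by (rule char_partial_sum_fourier[OF \<chi> d s])
  finally have "cmod (\<Sum>n=1..t. \<chi> n) = sqrt (real d) * cmod (\<Sum>b=1..<d. cnj (\<chi> b) * ?a b)"
    by (simp only: norm_mult norm_gauss_sum_primitive[OF \<chi> d0])
  also have "(\<Sum>b=1..<d. cnj (\<chi> b) * ?a b) = (\<Sum>b=1..?h. cnj (\<chi> b) * ?a b) + (\<Sum>b=1..?h'. cnj (\<chi> (d - b)) * ?a (d - b))"
  proof -
    have "{1..<d} = {1..?h} \<union> {Suc ?h..<d}" using d by auto
    then have "(\<Sum>b=1..<d. cnj (\<chi> b) * ?a b) = (\<Sum>b=1..?h. cnj (\<chi> b) * ?a b) + (\<Sum>b\<in>{Suc ?h..<d}. cnj (\<chi> b) * ?a b)"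
      by (simp only:) (intro sum.union_disjoint, auto)
    also have "(\<Sum>b\<in>{Suc ?h..<d}. cnj (\<chi> b) * ?a b) = (\<Sum>b=1..?h'. cnj (\<chi> (d - b)) * ?a (d - b))"
      by (rule sum.reindex_bij_witness[of _ "\<lambda>b. d - b" "\<lambda>b. d - b"]) auto
    finally show ?thesis .
  qed
  also have "(\<Sum>b=1..?h'. cnj (\<chi> (d - b)) * ?a (d - b)) = cnj (\<chi> (d - 1)) * cnj (\<Sum>b=1..?h'. \<chi> b * ?a b)"
    unfolding cnj_sum sum_distrib_left
  proof (intro sum.cong refl)
    fix b assume b': "b \<in> {1..?h'}"
    then have "b \<le> d - 1 - d div 2" by simp
    then have "b < d" using d by linarith
    then have b: "b \<in> {1..<d}" using b' by simp
    \<comment> \<open>Among natural numbers \<open>d - 1\<close> plays the role of \<open>-1\<close>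
      modulo \<open>d\<close>.\<close>
    have "[(d - 1) * b = d - b] (mod d)"
    proof -
      have "(d - 1) * b + b = d * b" using d by (cases d) (auto simp: algebra_simps)
      moreover have "(d - b) + b = d" using b by simp
      ultimately have "[(d - 1) * b + b = (d - b) + b] (mod d)" by (simp only: Cong.cong_def) simp
      then show ?thesis by (simp add: cong_add_rcancel_nat)
    qed
    then have "\<chi> (d - b) = \<chi> ((d - 1) * b)" using dirichlet_char_cong[OF \<chi>'] cong_sym by blast
    then have c: "\<chi> (d - b) = \<chi> (d - 1) * \<chi> b" using \<chi>' by (simp add: dirichlet_char_def)
    have "b \<in> {1..<d}" "d - b \<in> {1..<d}" using b d by auto
    note e = fourier_coeff_eq[OF this(1), of s, symmetric] fourier_coeff_eq[OF this(2), of s, symmetric]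
    have "uexp (- (real (d - b) * real k / real d)) = uexp (real b * real k / real d)" for k
    proof -
      have "- (real (d - b) * real k / real d) = real b * real k / real d + of_int (- int k)"
        using b d by (simp add: of_nat_diff field_simps)
      then show ?thesis by (simp only: uexp_add uexp_of_int mult_1_right)
    qed
    then have "?a (d - b) = cnj (?a b)" unfolding e by (simp add: cnj_uexp)
    then show "cnj (\<chi> (d - b)) * ?a (d - b) = cnj (\<chi> (d - 1)) * cnj (\<chi> b * ?a b)" by (simp add: c mult_ac)
  qed
  also have "cmod ((\<Sum>b=1..?h. cnj (\<chi> b) * ?a b) + cnj (\<chi> (d - 1)) * cnj (\<Sum>b=1..?h'. \<chi> b * ?a b))
      \<le> (real J1 + 2 * T + 7 / 2) + (real J1 + 2 * T + 7 / 2)"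
  proof (intro norm_triangle_mono)
    show "cmod (\<Sum>b=1..?h. cnj (\<chi> b) * ?a b) \<le> real J1 + 2 * T + 7 / 2"
      using T Jd by (intro norm_fourier_sum_le[OF \<chi> d s good(1) J _ _ _ tail]) auto
    have "small_blocks d J1 J T (\<lambda>n. cnj (cnj (\<chi> n)))" using good(2) by simp
    from norm_fourier_sum_le[OF primitive_char_cnj[OF \<chi>] d s this J _ _ _ tail, of ?h']
    have b2: "cmod (\<Sum>b=1..?h'. \<chi> b * ?a b) \<le> real J1 + 2 * T + 7 / 2" using T Jd by simp
    have "cmod (cnj (\<chi> (d - 1)) * cnj (\<Sum>b=1..?h'. \<chi> b * ?a b)) \<le> 1 * cmod (\<Sum>b=1..?h'. \<chi> b * ?a b)"
      unfolding norm_mult complex_mod_cnj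
      by (intro mult_right_mono norm_dirichlet_char_le_1[OF \<chi>' d0]) auto
    then show "cmod (cnj (\<chi> (d - 1)) * cnj (\<Sum>b=1..?h'. \<chi> b * ?a b)) \<le> real J1 + 2 * T + 7 / 2" using b2 by simp
  qed
  \<comment> \<open>The product form makes the threshold scale with \<open>T\<close>;
    \<open>T \<ge> 1\<close> is what permits it.\<close>
  also have "(real J1 + 2 * T + 7 / 2) + (real J1 + 2 * T + 7 / 2) \<le> T * (2 * real J1 + 11)"
  proof -
    have "real J1 \<le> T * real J1" using mult_right_mono[OF T, of "real J1"] by simp
    then show ?thesis using T by (simp add: algebra_simps)
  qed
  finally show ?thesis using d by (simp add: mult_left_mono)
qed

text \<open>Markov's inequality for the \<open>2 * m\<close>-th moment, with a union bound over grid
  points and blocks. The threshold \<open>T / j ^ 2\<close> produces \<open>j ^ (4 * m)\<close>, the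
  grid \<open>4 * 2 ^ j * j ^ 2\<close>. In the bracket \<open>2 ^ m / d\<close> is the off-diagonal
  and \<open>1 / 2 ^ (j * m)\<close> the diagonal contribution.\<close>

lemma card_not_small_blocks_le:
  assumes d: "d > 0" and T: "T > 0" and J: "1 \<le> J1" and Jd: "2 * 2 ^ J \<le> d"
    and R: "\<And>j l. j \<in> {J1..<J} \<Longrightarrow> 1 \<le> l \<Longrightarrow> l \<le> (2 ^ Suc j) ^ m \<Longrightarrow>
      real (card (ordered_factorizations m l)) \<le> R j" and R0: "\<And>j. R j \<ge> 0"
  shows "real (card {\<psi>. dirichlet_char d \<psi> \<and> \<not> small_blocks d J1 J T \<psi>}) \<le>
    real (totient d) / T ^ (2 * m) *
      (\<Sum>j\<in>{J1..<J}. 4 * 2 ^ j * real j ^ (4 * m + 2) * ((2 ^ m / real d + 1 / 2 ^ (j * m)) * R j))"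
proof -
  define S where "S j k \<psi> = cmod (\<Sum>b\<in>{2 ^ j<..2 ^ Suc j}. fourier_coeff d (real k / real (grid_size j)) b * \<psi> b)" for j k \<psi>
  define X where "X = {\<psi>. dirichlet_char d \<psi>}"
  define Y where "Y j k = {\<psi>\<in>X. S j k \<psi> > T / (real j)\<^sup>2}" for j k
  have fX: "finite X" unfolding X_def by (rule finite_dirichlet_chars[OF d])
  have cardY: "real (card (Y j k)) \<le> real (totient d) / T ^ (2 * m) * (real j ^ (4 * m) * ((2 ^ m / real d + 1 / 2 ^ (j * m)) * R j))"
    if j: "j \<in> {J1..<J}" for j k
  proof -
    let ?N = "(2::real) ^ j"
    have j1: "j \<ge> 1" using j J by auto
    have "(2::nat) ^ Suc j \<le> 2 ^ J" using j by (intro power_increasing) auto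
    then have jd: "2 * (2::nat) ^ Suc j \<le> d" using Jd by linarith
    have "real (card (Y j k)) * (T / (real j)\<^sup>2) ^ (2 * m) = (\<Sum>\<psi>\<in>Y j k. (T / (real j)\<^sup>2) ^ (2 * m))" by simp
    also have "\<dots> \<le> (\<Sum>\<psi>\<in>Y j k. S j k \<psi> ^ (2 * m))"
      using T by (intro sum_mono power_mono) (auto simp: Y_def)
    also have "\<dots> \<le> (\<Sum>\<psi>\<in>X. S j k \<psi> ^ (2 * m))"
      using fX by (intro sum_mono2) (auto simp: Y_def S_def)
    also have "\<dots> \<le> real (totient d) * ((1 / ?N) ^ (2 * m) * real (card {2 ^ j<..(2::nat) ^ Suc j}) ^ m *
        ((real (2 ^ Suc j) ^ m / real d + 1) * R j))"
      unfolding S_def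
    proof (rule dirichlet_char_moment)
      fix b assume b: "b \<in> {2 ^ j<..(2::nat) ^ Suc j}"
      have "cmod (fourier_coeff d (real k / real (grid_size j)) b) \<le> 1 / real b"
        using b jd by (intro norm_fourier_coeff_le) auto
      also have "\<dots> \<le> 1 / real (2 ^ j)" using b by (intro divide_left_mono) (auto simp del: of_nat_power)
      finally show "cmod (fourier_coeff d (real k / real (grid_size j)) b) \<le> 1 / ?N" by simp
    qed (use R[OF j] R0 d in \<open>auto simp: X_def\<close>)
    also have "real (card {2 ^ j<..(2::nat) ^ Suc j}) = ?N" by simp
    also have "(1 / ?N) ^ (2 * m) * ?N ^ m * ((real (2 ^ Suc j) ^ m / real d + 1) * R j) =
        (2 ^ m / real d + 1 / 2 ^ (j * m)) * R j"
    proof -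
      have a: "(1 / ?N) ^ (2 * m) * ?N ^ m = 1 / 2 ^ (j * m)"
      proof -
        have "(1 / ?N) ^ (2 * m) * ?N ^ m = ((1 / ?N)\<^sup>2 * ?N) ^ m"
          by (simp add: power_mult power_mult_distrib)
        also have "(1 / ?N)\<^sup>2 * ?N = 1 / ?N" by (simp add: power2_eq_square)
        finally show ?thesis by (simp add: power_divide power_mult)
      qed
      have b: "real (2 ^ Suc j) ^ m = 2 ^ m * 2 ^ (j * m)"
        by (simp add: power_mult_distrib power_mult)
      show ?thesis unfolding a b by (simp add: field_simps)
    qed
    finally have "real (card (Y j k)) * (T / (real j)\<^sup>2) ^ (2 * m) \<le>
        real (totient d) * ((2 ^ m / real d + 1 / 2 ^ (j * m)) * R j)" .
    moreover have "(T / (real j)\<^sup>2) ^ (2 * m) = T ^ (2 * m) / real j ^ (4 * m)"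
      by (simp add: power_divide flip: power_mult)
    ultimately show ?thesis using T j1 by (simp add: field_simps)
  qed
  have "{\<psi>. dirichlet_char d \<psi> \<and> \<not> small_blocks d J1 J T \<psi>} = (\<Union>j\<in>{J1..<J}. \<Union>k\<in>{..<grid_size j}. Y j k)"
    unfolding Y_def X_def small_blocks_def S_def by (auto simp: not_le)
  then have "card {\<psi>. dirichlet_char d \<psi> \<and> \<not> small_blocks d J1 J T \<psi>} \<le>
      (\<Sum>j\<in>{J1..<J}. card (\<Union>k\<in>{..<grid_size j}. Y j k))" by (simp only:) (rule card_UN_le, simp)
  also have "\<dots> \<le> (\<Sum>j\<in>{J1..<J}. \<Sum>k\<in>{..<grid_size j}. card (Y j k))"
    by (intro sum_mono card_UN_le) simp
  finally have "real (card {\<psi>. dirichlet_char d \<psi> \<and> \<not> small_blocks d J1 J T \<psi>}) \<le>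
      (\<Sum>j\<in>{J1..<J}. \<Sum>k\<in>{..<grid_size j}. real (card (Y j k)))"
    by (simp only: flip: of_nat_sum)
  also have "\<dots> \<le> (\<Sum>j\<in>{J1..<J}. \<Sum>k\<in>{..<grid_size j}.
      real (totient d) / T ^ (2 * m) * (real j ^ (4 * m) * ((2 ^ m / real d + 1 / 2 ^ (j * m)) * R j)))"
    by (intro sum_mono cardY)
  also have "\<dots> = real (totient d) / T ^ (2 * m) *
      (\<Sum>j\<in>{J1..<J}. 4 * 2 ^ j * real j ^ (4 * m + 2) * ((2 ^ m / real d + 1 / 2 ^ (j * m)) * R j))"
    unfolding sum_distrib_left
    by (intro sum.cong refl) (simp add: grid_size_def power_add power2_eq_square mult_ac)
  finally show ?thesis .
qed

section \<open>Imprimitive characters\<close>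

text \<open>If primitivity fails at \<open>p\<close>, then \<chi> is trivial on the units congruent
  to \<open>1\<close> modulo \<open>q div p\<close>, so on units it depends only on the residue
  modulo \<open>q div p\<close>. The character \<psi> is \<chi> evaluated at a lift to a unit modulo
  \<open>q\<close>.\<close>

lemma imprimitive_char_step:
  assumes \<chi>: "dirichlet_char q \<chi>" and q: "q > 0" and np: "\<not> primitive_char q \<chi>"
  obtains p \<psi> where "prime p" "p dvd q" "dirichlet_char (q div p) \<psi>"
    "\<And>n. \<chi> n = (if coprime n q then \<psi> n else 0)"
proof -
  obtain p where p: "prime p" "p dvd q"
    and triv: "\<And>u. coprime u q \<Longrightarrow> [u = 1] (mod (q div p)) \<Longrightarrow> \<chi> u = 1"
    using np \<chi> unfolding primitive_char_def by blast
  define Q where "Q = q div p"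
  have qQ: "q = p * Q" using p by (simp add: Q_def)
  have cop: "coprime n q \<longleftrightarrow> coprime n Q \<and> \<not> p dvd n" for n
    unfolding qQ coprime_mult_right_iff
    using p(1) by (metis coprime_commute prime_imp_coprime coprime_absorb_right not_prime_unit coprime_def)
  have mult: "\<chi> (a * b) = \<chi> a * \<chi> b" and one: "\<chi> 1 = 1" and nz: "\<chi> a \<noteq> 0 \<longleftrightarrow> coprime a q" for a b
    using \<chi> unfolding dirichlet_char_def by blast+
  have wd: "\<chi> a = \<chi> b" if a: "coprime a q" and b: "coprime b q" and ab: "[a = b] (mod Q)" for a b
  proof -
    obtain u where u: "[b * u = 1] (mod q)" using cong_solve_coprime_nat[OF b] by auto
    then have "coprime (b * u) q" by (metis cong_imp_coprime cong_sym coprime_1_left)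
    then have "coprime u q" by simp
    have "[b * u = 1] (mod Q)" using u cong_dvd_modulus_nat[of "b * u" 1 q Q] by (simp add: qQ)
    moreover have "[a * u = b * u] (mod Q)" using ab by (rule cong_scalar_right)
    ultimately have "[a * u = 1] (mod Q)" by (rule cong_trans[rotated])
    then have "\<chi> (a * u) = 1" using a \<open>coprime u q\<close> by (intro triv) (auto simp: Q_def)
    moreover have "\<chi> (b * u) = \<chi> 1" by (rule dirichlet_char_cong[OF \<chi> u])
    ultimately have "\<chi> a * \<chi> u = \<chi> b * \<chi> u" using mult one by metis
    moreover have "\<chi> u \<noteq> 0" using \<open>coprime u q\<close> nz by blast
    ultimately show ?thesis by simp
  qed
  \<comment> \<open>One of \<open>n\<close> and \<open>n + Q\<close> is a lift: if \<open>p\<close>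
    divides \<open>n\<close>, then \<open>p\<close> cannot divide \<open>Q\<close>, hence not
    \<open>n + Q\<close> either.\<close>
  have lift: "\<exists>m. coprime m q \<and> [n = m] (mod Q)" if "coprime n Q" for n
  proof (cases "p dvd n")
    case False
    then show ?thesis using that cop by (intro exI[of _ n]) auto
  next
    case True
    then have "\<not> p dvd Q" using that p(1) not_prime_unit by (metis coprime_def)
    then have "\<not> p dvd n + Q" using True by (simp add: dvd_add_right_iff)
    moreover have "coprime (n + Q) Q" using that by (simp add: coprime_iff_gcd_eq_1)
    ultimately show ?thesis using cop by (intro exI[of _ "n + Q"]) (auto simp: Cong.cong_def)
  qed
  define \<psi> where "\<psi> n = (if coprime n Q then \<chi> (SOME m. coprime m q \<and> [n = m] (mod Q)) else 0)" for n
  have \<psi>: "\<psi> n = \<chi> m" if "coprime m q" "[n = m] (mod Q)" for n m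
  proof -
    have "coprime m Q" using that cop by blast
    then have nQ: "coprime n Q" using that(2) cong_imp_coprime cong_sym by blast
    let ?P = "\<lambda>m. coprime m q \<and> [n = m] (mod Q)"
    have "?P (SOME m. ?P m)" by (rule someI_ex[of ?P]) (rule lift[OF nQ])
    then have "\<chi> (SOME m. ?P m) = \<chi> m" using that by (intro wd) (auto intro: cong_trans cong_sym)
    then show ?thesis using nQ by (simp add: \<psi>_def)
  qed
  have \<psi>0: "\<psi> n = 0" if "\<not> coprime n Q" for n using that by (simp add: \<psi>_def)
  have \<psi>nz: "\<psi> n \<noteq> 0" if nQ: "coprime n Q" for n
  proof -
    obtain m where m: "coprime m q" "[n = m] (mod Q)" using lift[OF nQ] by blast
    then show ?thesis using \<psi>[OF m] nz by simp
  qed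
  have "dirichlet_char Q \<psi>"
    unfolding dirichlet_char_def
  proof (intro conjI allI)
    show "\<psi> 1 = 1" using \<psi>[of 1 1] one by simp
    show "\<psi> (a * b) = \<psi> a * \<psi> b" for a b
    proof (cases "coprime a Q \<and> coprime b Q")
      case True
      then obtain a' b' where a: "coprime a' q" "[a = a'] (mod Q)" and b: "coprime b' q" "[b = b'] (mod Q)"
        using lift by meson
      have "\<psi> (a * b) = \<chi> (a' * b')" using a b by (intro \<psi> cong_mult) auto
      then show ?thesis using \<psi>[OF a] \<psi>[OF b] mult by simp
    next
      case False
      then show ?thesis using \<psi>0 by auto
    qed
    show "\<psi> (n + Q) = \<psi> n" for n
    proof (cases "coprime n Q")
      case True
      then obtain m where m: "coprime m q" "[n = m] (mod Q)" using lift by blast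
      moreover have "[n + Q = m] (mod Q)" using m(2) by (simp add: Cong.cong_def)
      ultimately show ?thesis using \<psi> by simp
    next
      case False
      then have "\<not> coprime (n + Q) Q" by (simp add: coprime_iff_gcd_eq_1)
      then show ?thesis using False \<psi>0 by simp
    qed
    show "\<psi> n \<noteq> 0 \<longleftrightarrow> coprime n Q" for n using \<psi>nz \<psi>0 by blast
  qed
  moreover have "\<chi> n = (if coprime n q then \<psi> n else 0)" for n
    using \<psi>[of n n] nz by auto
  ultimately show thesis using that p unfolding Q_def by blast
qed

text \<open>If \<open>p\<close> divides \<open>q div p\<close>, coprimality to \<open>q\<close> and
  to \<open>q div p\<close> agree and nothing changes. Otherwise the multiples of \<open>p\<close>
  are removed; by multiplicativity they form \<open>\<psi> p\<close> times a shorter partial sum,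
  which costs the factor \<open>2\<close>.\<close>

lemma char_partial_sum_step:
  assumes p: "prime p" "p dvd q" and q: "q > 0" and \<psi>: "dirichlet_char (q div p) \<psi>"
    and \<chi>: "\<And>n. \<chi> n = (if coprime n q then \<psi> n else 0)"
    and X: "\<And>t. cmod (\<Sum>n=1..t. \<psi> n) \<le> X"
  shows "cmod (\<Sum>n=1..t. \<chi> n) \<le> (if p dvd q div p then 1 else 2) * X"
proof -
  define Q where "Q = q div p"
  have qQ: "q = p * Q" using p by (simp add: Q_def)
  have Q0: "Q > 0" using q qQ by simp
  have \<psi>': "dirichlet_char Q \<psi>" using \<psi> by (simp add: Q_def)
  have cop: "coprime n q \<longleftrightarrow> coprime n Q \<and> \<not> p dvd n" for n
    unfolding qQ coprime_mult_right_iff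
    using p(1) by (metis coprime_commute prime_imp_coprime coprime_absorb_right not_prime_unit coprime_def)
  have nz: "\<psi> a \<noteq> 0 \<longleftrightarrow> coprime a Q" for a using \<psi>' unfolding dirichlet_char_def by blast
  have X0: "X \<ge> 0" using X[of 0] by simp
  show ?thesis
  proof (cases "p dvd Q")
    case True
    then have "\<not> p dvd n" if "coprime n Q" for n using that p(1) not_prime_unit by (metis coprime_def)
    then have "\<chi> n = \<psi> n" for n using \<chi> cop nz by auto
    then show ?thesis using X[of t] True by (simp add: Q_def)
  next
    case False
    have "\<chi> n = \<psi> n - (if p dvd n then \<psi> n else 0)" for n using \<chi> cop nz by auto
    then have "(\<Sum>n=1..t. \<chi> n) = (\<Sum>n=1..t. \<psi> n) - (\<Sum>n=1..t. if p dvd n then \<psi> n else 0)"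
      by (simp add: sum_subtractf)
    also have "(\<Sum>n=1..t. if p dvd n then \<psi> n else 0) = (\<Sum>n\<in>{n\<in>{1..t}. p dvd n}. \<psi> n)"
      by (simp add: sum.If_cases Int_def)
    also have "\<dots> = (\<Sum>k=1..t div p. \<psi> (p * k))"
      using prime_gt_0_nat[OF p(1)]
      by (intro sum.reindex_bij_witness[of _ "\<lambda>k. p * k" "\<lambda>n. n div p"])
        (auto simp: div_le_mono less_eq_div_iff_mult_less_eq mult.commute dvd_imp_le elim!: dvdE)
    also have "\<dots> = \<psi> p * (\<Sum>k=1..t div p. \<psi> k)"
      using \<psi>' by (simp add: dirichlet_char_def sum_distrib_left)
    finally have "cmod (\<Sum>n=1..t. \<chi> n) \<le> cmod (\<Sum>n=1..t. \<psi> n) + cmod (\<psi> p) * cmod (\<Sum>k=1..t div p. \<psi> k)"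
      using norm_triangle_ineq4 by (simp add: norm_mult[symmetric])
    also have "\<dots> \<le> X + 1 * X"
      by (intro add_mono mult_mono X norm_dirichlet_char_le_1[OF \<psi>' Q0]) (auto simp: X0)
    finally show ?thesis using False by (simp add: Q_def)
  qed
qed

section \<open>Descent to the inducing primitive character\<close>

text \<open>Passing from \<open>q div p\<close> to \<open>q\<close> costs a factor \<open>2\<close> only if \<open>p\<close> does not divide \<open>q div p\<close>, so at
  most once for each \<open>p\<close>. For \<open>p \<ge> 16\<close> the factor is absorbed by \<open>p powr (1/4)\<close>.\<close>

definition small_prime_count :: "nat \<Rightarrow> nat" where
  "small_prime_count n = card {p. p < 16 \<and> prime p \<and> p dvd n}"

text \<open>A crude bound, as only six primes lie below \<open>16\<close>. It is the origin of the
  factor \<open>2 ^ 16\<close> relating \<alpha> to \<open>J1\<close>.\<close>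

lemma small_prime_count_le: "small_prime_count n \<le> 16"
proof -
  have "card {p. p < 16 \<and> prime p \<and> p dvd n} \<le> card {..<16::nat}" by (rule card_mono) auto
  then show ?thesis by (simp add: small_prime_count_def)
qed

lemma small_prime_count_step:
  assumes p: "prime p"
  shows "(if p dvd Q then 1 else 2) * 2 ^ small_prime_count Q \<le> 2 ^ small_prime_count (p * Q) * real p powr (1/4)"
proof -
  have fin: "finite {r. r < 16 \<and> prime r \<and> r dvd n}" for n :: nat by (rule finite_subset[of _ "{..<16}"]) auto
  have le: "small_prime_count Q \<le> small_prime_count (p * Q)"
    unfolding small_prime_count_def by (intro card_mono fin) auto
  have p1: "real p powr (1/4) \<ge> 1" using prime_gt_1_nat[OF p] by (intro ge_one_powr_ge_zero) auto
  consider "p dvd Q" | "\<not> p dvd Q" "p < 16" | "\<not> p dvd Q" "p \<ge> 16" by linarith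
  then show ?thesis
  proof cases
    case 1
    have "1 * (2::real) ^ small_prime_count Q \<le> real p powr (1/4) * 2 ^ small_prime_count (p * Q)"
      using p1 le by (intro mult_mono power_increasing) auto
    then show ?thesis using 1 by (simp add: mult.commute)
  next
    case 2
    have "insert p {r. r < 16 \<and> prime r \<and> r dvd Q} \<subseteq> {r. r < 16 \<and> prime r \<and> r dvd p * Q}" using 2 p by auto
    then have "Suc (small_prime_count Q) \<le> small_prime_count (p * Q)"
      using card_mono[OF fin, of "insert p {r. r < 16 \<and> prime r \<and> r dvd Q}" "p * Q"] 2(1) fin
      by (simp add: small_prime_count_def)
    then have "(2::real) ^ Suc (small_prime_count Q) * 1 \<le> 2 ^ small_prime_count (p * Q) * real p powr (1/4)"
      using p1 by (intro mult_mono power_increasing) auto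
    then show ?thesis using 2 by simp
  next
    case 3
    have "(16::real) powr (1/4) = 2"
    proof -
      have "(16::real) = 2 powr 4" by simp
      then show ?thesis by (simp only: powr_powr) simp
    qed
    moreover have "(16::real) powr (1/4) \<le> real p powr (1/4)" using 3 by (intro powr_mono2) auto
    ultimately have "2 * (2::real) ^ small_prime_count Q \<le> real p powr (1/4) * 2 ^ small_prime_count (p * Q)"
      using le by (intro mult_mono power_increasing) auto
    then show ?thesis using 3 by (simp add: mult.commute)
  qed
qed

text \<open>One prime is removed at a time. Having \<open>2 ^ small_prime_count\<close> on both
  sides makes the steps compose, and the quantifier over \<open>X\<close> postpones every decision
  about the size of the primitive sums.\<close>

lemma inducing_primitive_char_aux:
  assumes "dirichlet_char q \<chi>" "q > 0"
  shows "\<exists>d \<psi>. d dvd q \<and> primitive_char d \<psi> \<and> (\<forall>n. \<chi> n = (if coprime n q then \<psi> n else 0)) \<and>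
    (\<forall>X. (\<forall>t. cmod (\<Sum>n=1..t. \<psi> n) \<le> X) \<longrightarrow>
      (\<forall>t. 2 ^ small_prime_count d * cmod (\<Sum>n=1..t. \<chi> n) \<le>
        2 ^ small_prime_count q * (real q / real d) powr (1/4) * X))"
  using assms
proof (induction q arbitrary: \<chi> rule: less_induct)
  case (less q)
  show ?case
  proof (cases "primitive_char q \<chi>")
    case True
    have "\<chi> n = (if coprime n q then \<chi> n else 0)" for n
      using less.prems(1) unfolding dirichlet_char_def by auto
    then show ?thesis using True less.prems by (intro exI[of _ q] exI[of _ \<chi>]) auto
  next
    case False
    from imprimitive_char_step[OF less.prems False]
    obtain p \<psi> where p: "prime p" "p dvd q" "dirichlet_char (q div p) \<psi>"
      and \<chi>: "\<And>n. \<chi> n = (if coprime n q then \<psi> n else 0)" by metis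
    define Q where "Q = q div p"
    have qQ: "q = p * Q" using p by (simp add: Q_def)
    have Q: "Q > 0" "Q < q" using less.prems qQ prime_gt_1_nat[OF p(1)] by auto
    obtain d \<xi> where d: "d dvd Q" "primitive_char d \<xi>" and \<xi>: "\<And>n. \<psi> n = (if coprime n Q then \<xi> n else 0)"
      and bd: "\<And>X t. \<forall>t. cmod (\<Sum>n=1..t. \<xi> n) \<le> X \<Longrightarrow>
        2 ^ small_prime_count d * cmod (\<Sum>n=1..t. \<psi> n) \<le> 2 ^ small_prime_count Q * (real Q / real d) powr (1/4) * X"
      using less.IH[OF Q(2) p(3)[folded Q_def] Q(1)] by blast
    have d0: "d > 0" using d Q by (auto intro: dvd_pos_nat)
    have "d dvd q" using d(1) qQ by simp
    moreover have "\<chi> n = (if coprime n q then \<xi> n else 0)" for n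
      using \<chi>[of n] \<xi>[of n] by (auto simp: qQ)
    moreover have "2 ^ small_prime_count d * cmod (\<Sum>n=1..t. \<chi> n) \<le>
        2 ^ small_prime_count q * (real q / real d) powr (1/4) * X"
      if X: "\<forall>t. cmod (\<Sum>n=1..t. \<xi> n) \<le> X" for X t
    proof -
      let ?Y = "2 ^ small_prime_count Q * (real Q / real d) powr (1/4) * X"
      have X0: "X \<ge> 0" using X[rule_format, of 0] by simp
      have Y: "cmod (\<Sum>n=1..t. \<psi> n) \<le> ?Y / 2 ^ small_prime_count d" for t
        using bd[OF X, of t] by (simp add: field_simps)
      have "cmod (\<Sum>n=1..t. \<chi> n) \<le> (if p dvd Q then 1 else 2) * (?Y / 2 ^ small_prime_count d)"
        unfolding Q_def using char_partial_sum_step[OF p(1,2) less.prems(2) p(3) \<chi> Y[unfolded Q_def]] .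
      then have "2 ^ small_prime_count d * cmod (\<Sum>n=1..t. \<chi> n) \<le> (if p dvd Q then 1 else 2) * ?Y"
        by (simp add: field_simps)
      also have "\<dots> = ((if p dvd Q then 1 else 2) * 2 ^ small_prime_count Q) * ((real Q / real d) powr (1/4) * X)"
        by (simp add: mult_ac)
      also have "\<dots> \<le> (2 ^ small_prime_count (p * Q) * real p powr (1/4)) * ((real Q / real d) powr (1/4) * X)"
        by (intro mult_right_mono small_prime_count_step p mult_nonneg_nonneg X0) auto
      also have "\<dots> = 2 ^ small_prime_count q * (real q / real d) powr (1/4) * X"
        by (simp add: qQ powr_mult powr_divide mult_ac)
      finally show ?thesis .
    qed
    ultimately show ?thesis using d(2) by (intro exI[of _ d] exI[of _ \<xi>]) blast
  qed
qed

lemma inducing_primitive_char: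
  assumes \<chi>: "dirichlet_char q \<chi>" and q: "q > 0" and np: "\<chi> \<noteq> principal_char q"
  obtains d \<psi> where "d dvd q" "d > 1" "primitive_char d \<psi>" "\<And>n. \<chi> n = (if coprime n q then \<psi> n else 0)"
    "\<And>X t. \<forall>t. cmod (\<Sum>n=1..t. \<psi> n) \<le> X \<Longrightarrow>
      cmod (\<Sum>n=1..t. \<chi> n) \<le> 2 ^ 16 * (real q / real d) powr (1/4) * X"
proof -
  obtain d \<psi> where d: "d dvd q" "primitive_char d \<psi>" and ind: "\<And>n. \<chi> n = (if coprime n q then \<psi> n else 0)"
    and bd: "\<And>X t. \<forall>t. cmod (\<Sum>n=1..t. \<psi> n) \<le> X \<Longrightarrow>
        2 ^ small_prime_count d * cmod (\<Sum>n=1..t. \<chi> n) \<le> 2 ^ small_prime_count q * (real q / real d) powr (1/4) * X"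
    using inducing_primitive_char_aux[OF \<chi> q] by blast
  have d0: "d > 0" using d q by (auto intro: dvd_pos_nat)
  \<comment> \<open>Modulo \<open>1\<close> the only character is constant, and it induces the
    principal character.\<close>
  have "d \<noteq> 1"
  proof
    assume "d = 1"
    have \<psi>: "dirichlet_char d \<psi>" using d by (simp add: primitive_char_def)
    have "\<psi> n = \<psi> 1" for n by (rule dirichlet_char_cong[OF \<psi>]) (simp add: \<open>d = 1\<close>)
    then have "\<psi> n = 1" for n using \<psi> by (simp add: dirichlet_char_def)
    then have "\<chi> = principal_char q" using ind by (auto simp: principal_char_def)
    then show False using np by simp
  qed
  moreover have "cmod (\<Sum>n=1..t. \<chi> n) \<le> 2 ^ 16 * (real q / real d) powr (1/4) * X"
    if X: "\<forall>t. cmod (\<Sum>n=1..t. \<psi> n) \<le> X" for X t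
  proof -
    have X0: "X \<ge> 0" using X[rule_format, of 0] by simp
    have "1 * cmod (\<Sum>n=1..t. \<chi> n) \<le> 2 ^ small_prime_count d * cmod (\<Sum>n=1..t. \<chi> n)"
      by (intro mult_right_mono) auto
    also have "\<dots> \<le> 2 ^ small_prime_count q * (real q / real d) powr (1/4) * X" by (rule bd[OF X])
    also have "\<dots> \<le> 2 ^ 16 * (real q / real d) powr (1/4) * X"
      by (intro mult_right_mono power_increasing small_prime_count_le X0) auto
    finally show ?thesis by simp
  qed
  ultimately show thesis using that d ind d0 by auto
qed

section \<open>Size of the exceptional set\<close>

lemma half_le_ln_2: "1 / 2 \<le> ln (2::real)"
proof -
  have "exp (1 / 2 :: real) ^ 2 \<le> 2 ^ 2"
    using exp_le by (simp flip: exp_of_nat_mult)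
  then have "exp (1 / 2 :: real) \<le> 2" by (rule power2_le_imp_le) simp
  then show ?thesis by (subst ln_ge_iff) auto
qed

lemma inverse_one_minus_le_exp:
  assumes "0 \<le> x" "x \<le> 3 / 4"
  shows "1 / (1 - x) \<le> exp (4 * x :: real)"
proof -
  have "1 / (1 - x) \<le> 1 + 4 * x"
  proof -
    have "x * x \<le> x * (3 / 4)" using assms by (intro mult_left_mono) auto
    \<comment> \<open>The product is \<open>1 + 3 * x - 4 * x ^ 2\<close>, and \<open>3 / 4\<close>
      is the positive zero of \<open>3 * x - 4 * x ^ 2\<close>.\<close>
    then have "1 \<le> (1 + 4 * x) * (1 - x)" by (simp add: algebra_simps)
    then show ?thesis using assms by (simp add: divide_le_eq)
  qed
  also have "\<dots> \<le> exp (4 * x)" by (rule exp_ge_add_one_self)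
  finally show ?thesis .
qed

text \<open>The choice \<open>\<delta> = 1 / ln m\<close> makes \<open>(m\<^sup>2) powr \<delta> = exp 2\<close> bounded, so that the product is only
  polynomial in \<open>m\<close> while \<open>N powr (m * \<delta>)\<close> is still gained in the moments.\<close>

lemma euler_product_le:
  fixes \<delta> L :: real
  assumes m: "m > 0" and L: "L = ln (real m)" "L \<ge> 2" and \<delta>: "\<delta> = 1 / L"
  shows "(\<Prod>p=2..m\<^sup>2. 1 / (1 - real p powr (-(1 - \<delta>)))) \<le> exp (72 * L)"
proof -
  have L0: "L > 0" using L by simp
  have \<delta>2: "0 < \<delta>" "\<delta> \<le> 1 / 2" unfolding \<delta> using L(2) by (auto simp: field_simps)
  have "m \<noteq> 1" using L by auto
  then have m2: "m \<ge> 2" using m by simp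
  have x: "real p powr (-(1 - \<delta>)) \<le> 3 / 4" if "p \<ge> 2" for p
  proof -
    have "real p powr (-(1 - \<delta>)) \<le> 2 powr (-(1 - \<delta>))" using that \<delta>2 by (intro powr_mono2') auto
    also have "\<dots> \<le> 2 powr (-(1/2))" using \<delta>2 by (intro powr_mono) auto
    also have "\<dots> = 1 / sqrt 2" by (simp add: powr_minus powr_half_sqrt inverse_eq_divide)
    also have "\<dots> \<le> 3 / 4"
    proof -
      have "4 / 3 \<le> sqrt (2::real)" by (rule real_le_rsqrt) (simp add: power2_eq_square)
      then show ?thesis by (simp add: field_simps)
    qed
    finally show ?thesis .
  qed
  have "(\<Prod>p=2..m\<^sup>2. 1 / (1 - real p powr (-(1 - \<delta>)))) \<le> (\<Prod>p=2..m\<^sup>2. exp (4 * real p powr (-(1 - \<delta>))))"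
  proof (rule prod_mono)
    fix p assume "p \<in> {2..m\<^sup>2}"
    then have xp: "real p powr (-(1 - \<delta>)) \<le> 3 / 4" by (intro x) auto
    then show "0 \<le> 1 / (1 - real p powr (-(1 - \<delta>))) \<and>
        1 / (1 - real p powr (-(1 - \<delta>))) \<le> exp (4 * real p powr (-(1 - \<delta>)))"
      by (intro conjI inverse_one_minus_le_exp) (auto intro!: divide_nonneg_nonneg)
  qed
  also have "\<dots> = exp (4 * (\<Sum>p=2..m\<^sup>2. real p powr (-(1 - \<delta>))))"
    by (simp add: exp_sum sum_distrib_left)
  \<comment> \<open>Here \<open>9\<close> bounds \<open>p powr \<delta>\<close> by way of
    \<open>exp 2\<close>, and \<open>2 * L\<close> is the logarithm of \<open>m ^ 2\<close>,
    bounding the harmonic sum without its first term.\<close>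
  also have "\<dots> \<le> exp (4 * (9 * (2 * L)))"
  proof -
    have yd: "real (m\<^sup>2) powr \<delta> \<le> 9"
    proof -
      have "ln (real (m\<^sup>2)) = 2 * L" using m L by (simp add: ln_realpow)
      then have "real (m\<^sup>2) powr \<delta> = exp 2" using m L0 \<delta> by (simp add: powr_def)
      also have "\<dots> = exp 1 ^ 2" by (simp flip: exp_of_nat_mult)
      also have "\<dots> \<le> 3 ^ 2" using exp_le by (intro power_mono) auto
      finally show ?thesis by simp
    qed
    have "(\<Sum>p=2..m\<^sup>2. real p powr (-(1 - \<delta>))) \<le> (\<Sum>p=2..m\<^sup>2. 9 * (1 / real p))"
    proof (rule sum_mono)
      fix p assume p: "p \<in> {2..m\<^sup>2}"
      have "real p powr (-(1 - \<delta>)) = real p powr \<delta> * (1 / real p)"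
        using p by (simp add: powr_diff)
      also have "\<dots> \<le> 9 * (1 / real p)"
      proof (rule mult_right_mono)
        have "real p powr \<delta> \<le> real (m\<^sup>2) powr \<delta>" using p \<delta>2 by (intro powr_mono2) (auto simp del: of_nat_power)
        then show "real p powr \<delta> \<le> 9" using yd by linarith
      qed simp
      finally show "real p powr (-(1 - \<delta>)) \<le> 9 * (1 / real p)" .
    qed
    also have "\<dots> = 9 * (\<Sum>p=2..m\<^sup>2. 1 / real p)" by (simp add: sum_distrib_left)
    also have "(\<Sum>p=2..m\<^sup>2. 1 / real p) \<le> 2 * L"
    proof -
      have "{1..m\<^sup>2} = insert 1 {2..m\<^sup>2}" using m by auto
      then have "(\<Sum>p=1..m\<^sup>2. 1 / real p) = 1 + (\<Sum>p=2..m\<^sup>2. 1 / real p)" by (simp only:) simp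
      moreover have "(\<Sum>p=1..m\<^sup>2. 1 / real p) \<le> 1 + ln (real (m\<^sup>2))" using m by (intro sum_inverse_le_ln) auto
      moreover have "ln (real (m\<^sup>2)) = 2 * L" using m L by (simp add: ln_realpow)
      ultimately show ?thesis by linarith
    qed
    finally show ?thesis by simp
  qed
  finally show ?thesis by simp
qed

text \<open>All factors become exponentials. With \<open>u = j / L\<close>, the saving \<delta> in
  the exponent gains \<open>m * u / 2\<close>. Against it stand a multiple of
  \<open>m * sqrt j\<close> from \<open>j ^ (4 * m + 2)\<close>, \<open>72 * m * L\<close> from
  \<open>A\<close>, and at most \<open>2 * j\<close> for the powers of \<open>2\<close> in the grid
  and in the target. The lower bound on \<open>j\<close> makes \<open>sqrt j\<close> and
  \<open>L\<close> small compared with \<open>u\<close>, and \<open>m \<ge> 16 * L\<close> makes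
  \<open>j\<close> small compared with \<open>m * u\<close>.\<close>

lemma main_block_term_le:
  fixes L \<delta> :: real
  assumes m: "m > 0" and L: "L = ln (real m)" "L \<ge> 2" and mL: "real m \<ge> 16 * L" and \<delta>: "\<delta> = 1 / L"
    and j: "real j \<ge> 10000 * L\<^sup>2" and A: "0 \<le> A" "A \<le> exp (72 * L)"
  shows "4 * 2 ^ j * real j ^ (4 * m + 2) * (1 / 2 ^ (j * m) * (A ^ m * real ((2 ^ Suc j) ^ m) powr (1 - \<delta>)))
    \<le> exp (- 2 * real m) * (1 / 2) ^ j"
proof -
  define c :: real where "c = ln 2"
  have lam: "1 / 2 \<le> c" "c \<le> 1" using half_le_ln_2 ln_2_less_1 by (auto simp: c_def)
  have L0: "L > 0" using L by simp
  have "1 \<le> L\<^sup>2" using L by (intro one_le_power) auto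
  then have j1: "real j \<ge> 1" using j by linarith
  have m1: "real m \<ge> 1" using m by simp
  have two: "(2::real) ^ k = exp (real k * c)" for k
    by (simp add: c_def exp_of_nat_mult)
  have e4: "(4::real) \<le> exp 2"
  proof -
    have "(4::real) = 2 ^ 2" by simp
    also have "\<dots> = exp (2 * c)" by (simp only: two) simp
    also have "\<dots> \<le> exp 2" using lam by simp
    finally show ?thesis .
  qed
  have jp: "real j ^ (4 * m + 2) = exp (real (4 * m + 2) * ln (real j))"
    using j1 by (simp only: exp_of_nat_mult) simp
  have half: "1 / 2 ^ (j * m) = exp (- (real j * real m * c))"
    by (simp only: two) (simp add: exp_minus inverse_eq_divide)
  have Am: "A ^ m \<le> exp (real m * (72 * L))"
    using power_mono[OF A(2,1), of m] by (simp only: exp_of_nat_mult)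
  have pw: "real ((2 ^ Suc j) ^ m) powr (1 - \<delta>) = exp ((1 - \<delta>) * (real (Suc j * m) * c))"
  proof -
    have "real ((2 ^ Suc j) ^ m) = exp (real (Suc j * m) * c)"
      by (simp only: power_mult[symmetric] of_nat_power of_nat_numeral two)
    then show ?thesis by (simp add: powr_def)
  qed
  have "4 * 2 ^ j * real j ^ (4 * m + 2) * (1 / 2 ^ (j * m) * (A ^ m * real ((2 ^ Suc j) ^ m) powr (1 - \<delta>)))
     \<le> exp 2 * exp (real j * c) * exp (real (4 * m + 2) * ln (real j)) *
        (exp (- (real j * real m * c)) * (exp (real m * (72 * L)) * exp ((1 - \<delta>) * (real (Suc j * m) * c))))"
    unfolding pw half jp two[of j] by (intro mult_mono e4 Am) (auto intro!: mult_nonneg_nonneg zero_le_power A(1))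
  also have "\<dots> = exp (2 + real j * c + real (4 * m + 2) * ln (real j) +
      (- (real j * real m * c) + (real m * (72 * L) + (1 - \<delta>) * (real (Suc j * m) * c))))"
    by (simp only: exp_add)
  also have "\<dots> \<le> exp (- 2 * real m + - (real j * c))"
  proof -
    define s where "s = sqrt (real j)"
    have s: "s \<ge> 100 * L" unfolding s_def
    proof (rule real_le_rsqrt)
      show "(100 * L)\<^sup>2 \<le> real j" using j by (simp add: power_mult_distrib)
    qed
    have ss: "s * s = real j" by (simp add: s_def)
    have s0: "s > 0" using s L0 by linarith
    have lnj: "ln (real j) \<le> 2 * s"
    proof -
      have "ln (real j) = 2 * ln s" using s0 ss by (metis ln_mult mult_2 less_numeral_extra(3))
      also have "ln s \<le> s" using ln_le_minus_one[OF s0] by linarith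
      finally show ?thesis by simp
    qed
    define u where "u = real j / L"
    have uL: "real j = u * L" using L0 by (simp add: u_def)
    have u1: "s * 100 \<le> u"
    proof -
      have "100 * L * s \<le> s * s" using s s0 by (intro mult_right_mono) auto
      then show ?thesis using L0 ss by (simp add: u_def field_simps)
    qed
    have u2: "10000 * L \<le> u"
    proof -
      have "10000 * L * L \<le> real j" using j by (simp add: power2_eq_square)
      then show ?thesis using L0 by (simp add: u_def field_simps)
    qed
    have u0: "u > 0" using u2 L0 by linarith
    have dj: "\<delta> * (real (Suc j * m) * c) \<ge> (u * real m) / 2"
    proof -
      have "\<delta> * (real (Suc j * m) * c) \<ge> \<delta> * (real (j * m) * (1 / 2))"
        using lam \<delta> L0 by (intro mult_left_mono mult_mono) auto
      also have "\<delta> * (real (j * m) * (1 / 2)) = (u * real m) / 2" using \<delta> by (simp add: u_def)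
      finally show ?thesis .
    qed
    have a1: "real (4 * m + 2) * ln (real j) \<le> real m * (12 * s)"
    proof -
      have "real (4 * m + 2) * ln (real j) \<le> (6 * real m) * (2 * s)"
        using m1 lnj s0 j1 by (intro mult_mono) auto
      then show ?thesis by simp
    qed
    have a2: "real j * 2 \<le> real m * (u / 8)"
    proof -
      have "real j * 16 = u * (16 * L)" using uL by simp
      also have "\<dots> \<le> u * real m" using mL u0 by (intro mult_left_mono) auto
      finally show ?thesis by (simp add: mult.commute)
    qed
    have a3: "real j * c \<le> real j" using lam j1 by (intro mult_left_le) auto
    have a4: "real (Suc j * m) * c \<le> real j * real m * c + real m"
      using lam m1 by (simp add: algebra_simps mult_left_le)
    \<comment> \<open>\<open>s\<close> is at most \<open>u / 100\<close> and \<open>L\<close> at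
      most \<open>u / 10000\<close>. The \<open>5\<close> collects the constant \<open>2\<close> (at
      most \<open>2 * m\<close>), the extra \<open>m\<close> of \<open>a4\<close> and the target's
      \<open>2 * m\<close>.\<close>
    have a5: "12 * s + 72 * L + 5 + u / 8 \<le> u / 2" using u1 u2 L by linarith
    then have "real m * (12 * s + 72 * L + 5 + u / 8) \<le> real m * (u / 2)" using m1 by (intro mult_left_mono) auto
    then have a6: "real m * (12 * s) + real m * (72 * L) + 5 * real m + real m * (u / 8) \<le> (u * real m) / 2"
      by (simp add: algebra_simps)
    have "(1 - \<delta>) * (real (Suc j * m) * c) \<le> real j * real m * c + real m - (u * real m) / 2"
      using dj a4 by (simp only: left_diff_distrib mult_1)
    then have "2 + real j * c + real (4 * m + 2) * ln (real j) +
      (- (real j * real m * c) + (real m * (72 * L) + (1 - \<delta>) * (real (Suc j * m) * c)))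
      \<le> - 2 * real m + - (real j * c)"
      using a1 a2 a3 a6 m1 by linarith
    then show ?thesis by simp
  qed
  also have "\<dots> = exp (- 2 * real m) * (1 / 2) ^ j"
  proof -
    have "(1 / 2 :: real) ^ j = 1 / 2 ^ j" by (simp add: power_divide)
    also have "\<dots> = exp (- (real j * c))" by (simp only: two) (simp add: exp_minus inverse_eq_divide)
    finally show ?thesis by (simp only: exp_add)
  qed
  finally show ?thesis .
qed

lemma main_block_sum_le:
  fixes L \<delta> :: real
  assumes m: "m > 0" and L: "L = ln (real m)" "L \<ge> 2" and mL: "real m \<ge> 16 * L" and \<delta>: "\<delta> = 1 / L"
    and J1: "real J1 \<ge> 10000 * L\<^sup>2" and A: "0 \<le> A" "A \<le> exp (72 * L)"
  shows "(\<Sum>j\<in>{J1..<J}. 4 * 2 ^ j * real j ^ (4 * m + 2) *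
      (1 / 2 ^ (j * m) * (A ^ m * real ((2 ^ Suc j) ^ m) powr (1 - \<delta>)))) \<le> exp (- real m) / 16"
proof -
  have "(\<Sum>j\<in>{J1..<J}. 4 * 2 ^ j * real j ^ (4 * m + 2) *
      (1 / 2 ^ (j * m) * (A ^ m * real ((2 ^ Suc j) ^ m) powr (1 - \<delta>)))) \<le>
      (\<Sum>j\<in>{J1..<J}. exp (- 2 * real m) * (1 / 2) ^ j)"
    using J1 by (intro sum_mono main_block_term_le[OF m L mL \<delta> _ A]) auto
  also have "\<dots> \<le> (\<Sum>j<J. exp (- 2 * real m) * (1 / 2) ^ j)" by (intro sum_mono2) auto
  also have "\<dots> = exp (- 2 * real m) * (\<Sum>j<J. (1 / 2) ^ j)" by (simp add: sum_distrib_left)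
  also have "\<dots> \<le> exp (- 2 * real m) * 2"
  proof (rule mult_left_mono)
    have "(\<Sum>j<J. (1 / 2 :: real) ^ j) = 2 * (1 - (1 / 2) ^ J)" by (simp add: sum_gp_strict)
    also have "\<dots> \<le> 2" by simp
    finally show "(\<Sum>j<J. (1 / 2 :: real) ^ j) \<le> 2" .
  qed simp
  \<comment> \<open>One factor \<open>exp (- m)\<close> is kept; the other pays for the
    constants.\<close>
  also have "\<dots> = exp (- real m) * (exp (- real m) * 2)" by (simp flip: exp_add)
  also have "\<dots> \<le> exp (- real m) * (1 / 16)"
  proof (rule mult_left_mono)
    have "real m \<ge> 32" using mL L by linarith
    then have "exp (real m) \<ge> 32" using exp_ge_add_one_self[of "real m"] by linarith
    then show "exp (- real m) * 2 \<le> 1 / 16" by (simp add: exp_minus field_simps)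
  qed simp
  finally show ?thesis by simp
qed

text \<open>The blocks end near \<open>d powr (2/3)\<close>. An exponent above \<open>1/2\<close>
  makes the tail small; one below \<open>8/9\<close> makes the off-diagonal term small, which is of
  order \<open>(2 ^ J) powr (9/8) / d\<close> up to logarithms.\<close>

lemma dyadic_exponent:
  fixes d :: nat
  assumes "d \<ge> 1"
  obtains J where "real d powr (2/3) \<le> 2 ^ J" "2 ^ J \<le> 2 * real d powr (2/3)"
proof -
  let ?x = "real d powr (2/3)"
  have x: "?x \<ge> 1" using assms by (intro ge_one_powr_ge_zero) auto
  define J where "J = nat \<lceil>log 2 ?x\<rceil>"
  have l: "log 2 ?x \<ge> 0" by (subst zero_le_log_cancel_iff) (use x assms in auto)
  then have J: "log 2 ?x \<le> real J" "real J \<le> log 2 ?x + 1" unfolding J_def by linarith+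
  have "?x = 2 powr log 2 ?x" using assms by (subst powr_log_cancel) auto
  also have "\<dots> \<le> 2 powr real J" using J by (intro powr_mono) auto
  finally have 1: "?x \<le> 2 ^ J" by (simp add: powr_realpow)
  have "2 powr real J \<le> 2 powr (log 2 ?x + 1)" using J by (intro powr_mono) auto
  also have "\<dots> = 2 * ?x" using assms by (simp add: powr_add)
  finally have "2 ^ J \<le> 2 * ?x" by (simp add: powr_realpow)
  with 1 show thesis by (rule that)
qed

lemma tendsto_ln_powr_0:
  "((\<lambda>x. K * (1 + 2 * ln x) ^ n * x powr (-(1/4))) \<longlongrightarrow> 0) at_top" for K :: real
proof -
  have "((\<lambda>x::real. (1 + 2 * ln x) powr real n * x powr (-(1/4))) \<longlongrightarrow> 0) at_top"
    by real_asymp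
  moreover have "\<forall>\<^sub>F x::real in at_top. (1 + 2 * ln x) powr real n * x powr (-(1/4)) = (1 + 2 * ln x) ^ n * x powr (-(1/4))"
    using eventually_ge_at_top[of 1]
  proof eventually_elim
    case (elim x)
    then have "ln x \<ge> 0" by simp
    then have "1 + 2 * ln x > 0" by linarith
    then show ?case by (simp add: powr_realpow)
  qed
  ultimately have "((\<lambda>x::real. (1 + 2 * ln x) ^ n * x powr (-(1/4))) \<longlongrightarrow> 0) at_top"
    by (rule Lim_transform_eventually)
  from tendsto_mult_right_zero[OF this, of K] show ?thesis by (simp add: mult.assoc)
qed

text \<open>The exponent \<open>1 / (8 * m)\<close> reduces an \<open>m\<close>-fold product to
  \<open>(2 ^ J) powr (1/8)\<close>. With \<open>2 ^ J\<close> from the grid and the factor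
  \<open>1 / d\<close>, the exponent of \<open>d\<close> is
  \<open>(2/3) * (9/8) - 1 = - 1/4\<close>; for fixed \<open>m\<close> the rest is a power of a
  logarithm.\<close>

lemma secondary_block_sum_le:
  assumes m: "m > 0" and d: "d \<ge> 1" and J: "2 ^ J \<le> 2 * real d powr (2/3)" and A: "A \<ge> 0"
  shows "(\<Sum>j\<in>{J1..<J}. 4 * 2 ^ j * real j ^ (4 * m + 2) *
      (2 ^ m / real d * (A ^ m * real ((2 ^ Suc j) ^ m) powr (1 / (8 * real m)))))
    \<le> 16 * 2 ^ m * A ^ m * (1 + 2 * ln (real d)) ^ (4 * m + 3) * real d powr (-(1/4))"
proof -
  define K where "K = 1 + 2 * ln (real d)"
  have ln0: "ln (real d) \<ge> 0" using d by simp
  \<comment> \<open>From \<open>2 ^ J \<le> 2 * d powr (2/3)\<close> and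
    \<open>ln 2 \<ge> 1 / 2\<close>. \<open>K\<close> bounds both the number of blocks and the
    indices \<open>j\<close>.\<close>
  have JK: "real J \<le> K"
  proof -
    have "real J * ln 2 = ln (2 ^ J)" by (simp add: ln_realpow)
    also have "\<dots> \<le> ln (2 * real d powr (2/3))" using J d by (subst ln_le_cancel_iff) auto
    also have "\<dots> = ln 2 + 2 / 3 * ln (real d)" using d by (simp add: ln_mult ln_powr)
    finally have "(real J - 1) * ln 2 \<le> 2 / 3 * ln (real d)" by (simp add: algebra_simps)
    moreover have "(real J - 1) * (1 / 2) \<le> (real J - 1) * ln 2" if "real J > 1"
      using that half_le_ln_2 by (intro mult_left_mono) auto
    ultimately have "(real J - 1) * (1 / 2) \<le> 2 / 3 * ln (real d)" if "real J > 1"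
      using that by linarith
    then show ?thesis using ln0 unfolding K_def by (cases "real J > 1") auto
  qed
  have K0: "K \<ge> 0" using ln0 by (simp add: K_def)
  have pw: "real ((2 ^ Suc j) ^ m) powr (1 / (8 * real m)) \<le> (2 ^ J) powr (1/8)" if "j < J" for j
  proof -
    have "real ((2 ^ Suc j) ^ m) = (2 ^ Suc j) powr real m" by (subst powr_realpow) auto
    then have "real ((2 ^ Suc j) ^ m) powr (1 / (8 * real m)) = (2 ^ Suc j) powr (real m * (1 / (8 * real m)))"
      by (simp only: powr_powr)
    also have "real m * (1 / (8 * real m)) = 1 / 8" using m by simp
    also have "(2 ^ Suc j) powr (1/8) \<le> (2 ^ J :: real) powr (1/8)" using that by (intro powr_mono2 power_increasing) auto
    finally show ?thesis .
  qed
  have "(\<Sum>j\<in>{J1..<J}. 4 * 2 ^ j * real j ^ (4 * m + 2) *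
      (2 ^ m / real d * (A ^ m * real ((2 ^ Suc j) ^ m) powr (1 / (8 * real m))))) \<le>
    (\<Sum>j\<in>{J1..<J}. 4 * 2 ^ J * K ^ (4 * m + 2) * (2 ^ m / real d * (A ^ m * (2 ^ J) powr (1/8))))"
  proof (rule sum_mono)
    fix j assume j: "j \<in> {J1..<J}"
    have "real j \<le> K" using j JK by simp
    then show "4 * 2 ^ j * real j ^ (4 * m + 2) *
        (2 ^ m / real d * (A ^ m * real ((2 ^ Suc j) ^ m) powr (1 / (8 * real m)))) \<le>
        4 * 2 ^ J * K ^ (4 * m + 2) * (2 ^ m / real d * (A ^ m * (2 ^ J) powr (1/8)))"
      using j A K0 pw[of j] by (intro mult_mono power_mono power_increasing mult_nonneg_nonneg) auto
  qed
  also have "\<dots> = real (J - J1) * (4 * K ^ (4 * m + 2) * 2 ^ m * A ^ m * ((2 ^ J * (2 ^ J) powr (1/8)) / real d))"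
    by simp
  also have "\<dots> \<le> K * (4 * K ^ (4 * m + 2) * 2 ^ m * A ^ m * (4 * real d powr (-(1/4))))"
  proof (intro mult_mono mult_left_mono)
    show "real (J - J1) \<le> K" using JK by linarith
    have "2 ^ J * (2 ^ J) powr (1/8) = ((2::real) ^ J) powr (9/8)"
      using powr_add[of "2 ^ J :: real" 1 "1/8"] by simp
    also have "\<dots> \<le> (2 * real d powr (2/3)) powr (9/8)" using J by (intro powr_mono2) auto
    also have "\<dots> = 2 powr (9/8) * real d powr (3/4)" using d by (simp add: powr_mult powr_powr)
    also have "\<dots> \<le> 2 powr 2 * real d powr (3/4)" by (intro mult_right_mono powr_mono) auto
    finally have "2 ^ J * (2 ^ J) powr (1/8) / real d \<le> 4 * real d powr (3/4) / real d"
      by (intro divide_right_mono) auto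
    also have "\<dots> = 4 * real d powr (-(1/4))"
      using d powr_diff[of "real d" "3/4" 1] by simp
    finally show "2 ^ J * (2 ^ J) powr (1/8) / real d \<le> 4 * real d powr (-(1/4))" .
  qed (use K0 A in auto)
  also have "\<dots> = 16 * 2 ^ m * A ^ m * K ^ (4 * m + 3) * real d powr (-(1/4))"
    by (simp add: eval_nat_numeral power_add)
  finally show ?thesis by (simp add: K_def)
qed

section \<open>Primitive characters with large partial sums\<close>

definition large_primitive_chars :: "nat \<Rightarrow> real \<Rightarrow> (nat \<Rightarrow> complex) set" where
  "large_primitive_chars d x = {\<chi>. primitive_char d \<chi> \<and> (\<exists>t. cmod (\<Sum>n=1..t. \<chi> n) > sqrt (real d) * x)}"

lemma finite_large_primitive_chars: "d > 0 \<Longrightarrow> finite (large_primitive_chars d x)"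
  by (rule finite_subset[OF _ finite_dirichlet_chars]) (auto simp: large_primitive_chars_def primitive_char_def)

text \<open>\<open>D\<close> is chosen before \<open>T\<close>: the conditions on \<open>d\<close>
  involve only \<open>m\<close> and \<open>J1\<close>, while \<open>T\<close> enters through the
  factor \<open>T ^ (2 * m)\<close> alone. This uniformity is essential because the later
  \<open>T\<close> varies with the conductor.\<close>

lemma card_large_primitive_chars_le:
  assumes m: "m > 0" and L: "ln (real m) \<ge> 2" and mL: "real m \<ge> 16 * ln (real m)"
    and J1: "real J1 \<ge> 10000 * (ln (real m))\<^sup>2"
  shows "\<exists>D. \<forall>d\<ge>D. \<forall>T\<ge>1. real (card (large_primitive_chars d (T * (2 * real J1 + 11))))
    \<le> real (totient d) / T ^ (2 * m) * (exp (- real m) / 4)"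
proof -
  define \<delta> where "\<delta> = 1 / ln (real m)"
  define A1 where "A1 = (\<Prod>p=2..m\<^sup>2. 1 / (1 - real p powr (-(1 - \<delta>))))"
  define A2 where "A2 = (\<Prod>p=2..m ^ (8 * m). 1 / (1 - real p powr (-(1 / (8 * real m)))))"
  have \<delta>: "0 < \<delta>" "\<delta> \<le> 1 / 2" unfolding \<delta>_def using L by (auto simp: field_simps)
  have pos: "0 \<le> 1 / (1 - real p powr (-\<eta>))" if "p \<ge> 2" "\<eta> > 0" for p \<eta>
    using that by (simp add: powr_less_one less_imp_le)
  have A10: "A1 \<ge> 0" unfolding A1_def using \<delta> by (intro prod_nonneg ballI pos) auto
  have A20: "A2 \<ge> 0" unfolding A2_def using m by (intro prod_nonneg ballI pos) auto
  have A1e: "A1 \<le> exp (72 * ln (real m))" unfolding A1_def by (rule euler_product_le[OF m refl L \<delta>_def])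
  \<comment> \<open>The smoothness bounds \<open>m ^ 2\<close> and \<open>m ^ (8 * m)\<close> are
    chosen so that they reach \<open>m\<close> when raised to the respective exponents, the first of
    which is at least \<open>1 / 2\<close>.\<close>
  have y1: "real (Suc (m\<^sup>2)) powr (1 - \<delta>) \<ge> real m"
  proof -
    have "real m = (real m ^ 2) powr (1/2)" using m by (simp add: powr_half_sqrt)
    also have "\<dots> \<le> (real m ^ 2) powr (1 - \<delta>)" using m \<delta> by (intro powr_mono) auto
    also have "\<dots> \<le> real (Suc (m\<^sup>2)) powr (1 - \<delta>)" using \<delta> by (intro powr_mono2) auto
    finally show ?thesis .
  qed
  have y2: "real (Suc (m ^ (8 * m))) powr (1 / (8 * real m)) \<ge> real m"
  proof -
    have "real m = (real m ^ (8 * m)) powr (1 / (8 * real m))"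
      using m by (simp add: powr_powr flip: powr_realpow)
    also have "\<dots> \<le> real (Suc (m ^ (8 * m))) powr (1 / (8 * real m))" by (intro powr_mono2) auto
    finally show ?thesis .
  qed
  \<comment> \<open>\<open>R1\<close> saves a power of the block length against the diagonal term of the moment; \<open>R2\<close>, small only in
    terms of \<open>d\<close>, is needed for the off-diagonal term, which carries the factor \<open>1 / d\<close>.\<close>
  define R1 where "R1 j = A1 ^ m * real ((2 ^ Suc j) ^ m) powr (1 - \<delta>)" for j
  define R2 where "R2 j = A2 ^ m * real ((2 ^ Suc j) ^ m) powr (1 / (8 * real m))" for j
  have R: "real (card (ordered_factorizations m l)) \<le> min (R1 j) (R2 j)"
    if l: "1 \<le> l" "l \<le> (2 ^ Suc j) ^ m" for j l
  proof -
    have lr: "real l \<le> real ((2 ^ Suc j) ^ m)" using l(2) by (rule of_nat_mono)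
    have "real (card (ordered_factorizations m l)) \<le> A1 ^ m * real l powr (1 - \<delta>)"
      unfolding A1_def using \<delta> l by (intro card_ordered_factorizations_le y1) auto
    also have "\<dots> \<le> R1 j"
      unfolding R1_def using \<delta> A10 lr by (intro mult_left_mono powr_mono2) auto
    finally have 1: "real (card (ordered_factorizations m l)) \<le> R1 j" .
    have "real (card (ordered_factorizations m l)) \<le> A2 ^ m * real l powr (1 / (8 * real m))"
      unfolding A2_def using m l by (intro card_ordered_factorizations_le y2) auto
    also have "\<dots> \<le> R2 j"
      unfolding R2_def using m A20 lr by (intro mult_left_mono powr_mono2) auto
    finally show ?thesis using 1 by simp
  qed
  have R10: "R1 j \<ge> 0" and R20: "R2 j \<ge> 0" for j
    unfolding R1_def R2_def using A10 A20 by (auto intro!: mult_nonneg_nonneg)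
  have J1pos: "J1 \<ge> 1"
  proof -
    have "(ln (real m))\<^sup>2 > 0" using L by simp
    then show ?thesis using J1 by (cases J1) auto
  qed
  \<comment> \<open>In turn: the tail is small, the blocks end below \<open>d / 2\<close>,
    \<open>J1 \<le> J\<close>, and the off-diagonal term is negligible.\<close>
  have ev1: "\<forall>\<^sub>F x::real in at_top. 80 * sqrt x * (1 + ln x) \<le> x powr (2/3)" by real_asymp
  have ev2: "\<forall>\<^sub>F x::real in at_top. 2 * x powr (2/3) \<le> x / 2 - 2" by real_asymp
  have ev3: "\<forall>\<^sub>F x::real in at_top. 2 ^ J1 \<le> x powr (2/3)" by real_asymp
  have ev4: "\<forall>\<^sub>F x::real in at_top. 16 * 2 ^ m * A2 ^ m * (1 + 2 * ln x) ^ (4 * m + 3) * x powr (-(1/4)) < exp (- real m) / 16"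
    by (rule order_tendstoD(2)[OF tendsto_ln_powr_0]) simp
  have "\<forall>\<^sub>F x::real in at_top. 80 * sqrt x * (1 + ln x) \<le> x powr (2/3) \<and> 2 * x powr (2/3) \<le> x / 2 - 2 \<and>
      2 ^ J1 \<le> x powr (2/3) \<and>
      16 * 2 ^ m * A2 ^ m * (1 + 2 * ln x) ^ (4 * m + 3) * x powr (-(1/4)) < exp (- real m) / 16 \<and> x \<ge> 2"
    using ev1 ev2 ev3 ev4 eventually_ge_at_top[of 2] by eventually_elim auto
  then obtain D0 where D0: "\<And>x::real. x \<ge> D0 \<Longrightarrow> 80 * sqrt x * (1 + ln x) \<le> x powr (2/3) \<and> 2 * x powr (2/3) \<le> x / 2 - 2 \<and>
      2 ^ J1 \<le> x powr (2/3) \<and>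
      16 * 2 ^ m * A2 ^ m * (1 + 2 * ln x) ^ (4 * m + 3) * x powr (-(1/4)) < exp (- real m) / 16 \<and> x \<ge> 2"
    unfolding eventually_at_top_linorder by blast
  show ?thesis
  proof (intro exI[of _ "nat \<lceil>D0\<rceil>"] allI impI)
    fix d :: nat and T :: real assume d: "nat \<lceil>D0\<rceil> \<le> d" and T: "1 \<le> T"
    have "D0 \<le> real d" using d by linarith
    note D = D0[OF this]
    have d1: "d > 1" using D by auto
    obtain J where J: "real d powr (2/3) \<le> 2 ^ J" "2 ^ J \<le> 2 * real d powr (2/3)"
      using dyadic_exponent[of d] d1 by auto
    have "(2::real) ^ J1 \<le> 2 ^ J" using D J by linarith
    then have J1J: "J1 \<le> J" by simp
    have "(2::real) ^ J \<le> real d / 2 - 2" using D J by linarith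
    moreover have "real (d - 1 - d div 2) \<ge> real d / 2 - 1"
      using d1 by (simp add: of_nat_diff)
    ultimately have "(2::real) ^ J \<le> real (d - 1 - d div 2)" by linarith
    then have Jd: "2 ^ J \<le> d - 1 - d div 2" by (metis of_nat_le_iff of_nat_numeral of_nat_power)
    then have Jd2: "2 * 2 ^ J \<le> d" by linarith
    have tail: "40 * sqrt (real d) * (1 + ln (real d)) / 2 ^ J \<le> 1 / 2"
    proof -
      have "80 * sqrt (real d) * (1 + ln (real d)) \<le> 2 ^ J" using D J by linarith
      then show ?thesis by (simp add: field_simps)
    qed
    define Y where "Y = {\<psi>. dirichlet_char d \<psi> \<and> \<not> small_blocks d J1 J T \<psi>}"
    have fY: "finite Y" unfolding Y_def
      by (rule finite_subset[OF _ finite_dirichlet_chars[of d]]) (use d1 in auto)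
    \<comment> \<open>A large sum violates \<open>small_blocks\<close> for \<chi> or for its
      conjugate, which doubles the count.\<close>
    have "large_primitive_chars d (T * (2 * real J1 + 11)) \<subseteq> Y \<union> (\<lambda>\<psi> n. cnj (\<psi> n)) ` Y"
    proof
      fix \<chi> assume "\<chi> \<in> large_primitive_chars d (T * (2 * real J1 + 11))"
      then obtain t where \<chi>: "primitive_char d \<chi>"
        and t: "cmod (\<Sum>n=1..t. \<chi> n) > sqrt (real d) * (T * (2 * real J1 + 11))"
        unfolding large_primitive_chars_def by blast
      have \<chi>': "dirichlet_char d \<chi>" using \<chi> by (simp add: primitive_char_def)
      have "\<not> (small_blocks d J1 J T (\<lambda>n. cnj (\<chi> n)) \<and> small_blocks d J1 J T \<chi>)"
        using char_partial_sum_le[OF \<chi> d1 _ _ J1pos J1J T Jd tail, of t] t by auto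
      then show "\<chi> \<in> Y \<union> (\<lambda>\<psi> n. cnj (\<psi> n)) ` Y"
        using \<chi>' dirichlet_char_cnj[OF \<chi>']
        by (auto simp: Y_def intro!: image_eqI[of \<chi> "\<lambda>\<psi> n. cnj (\<psi> n)" "\<lambda>n. cnj (\<chi> n)"])
    qed
    then have "card (large_primitive_chars d (T * (2 * real J1 + 11))) \<le> card (Y \<union> (\<lambda>\<psi> n. cnj (\<psi> n)) ` Y)"
      using fY by (intro card_mono) auto
    also have "\<dots> \<le> card Y + card Y"
      by (rule order_trans[OF card_Un_le]) (use card_image_le[OF fY] in auto)
    finally have c: "real (card (large_primitive_chars d (T * (2 * real J1 + 11)))) \<le> 2 * real (card Y)" by linarith
    have "real (card Y) \<le> real (totient d) / T ^ (2 * m) *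
        (\<Sum>j\<in>{J1..<J}. 4 * 2 ^ j * real j ^ (4 * m + 2) * ((2 ^ m / real d + 1 / 2 ^ (j * m)) * min (R1 j) (R2 j)))"
      unfolding Y_def using d1 T R R10 R20
      by (intro card_not_small_blocks_le J1pos Jd2) auto
    also have "\<dots> \<le> real (totient d) / T ^ (2 * m) * (exp (- real m) / 16 + exp (- real m) / 16)"
    proof (rule mult_left_mono)
      \<comment> \<open>The minimum is replaced by \<open>R2\<close> in the off-diagonal and by
        \<open>R1\<close> in the diagonal term.\<close>
      have "(\<Sum>j\<in>{J1..<J}. 4 * 2 ^ j * real j ^ (4 * m + 2) * ((2 ^ m / real d + 1 / 2 ^ (j * m)) * min (R1 j) (R2 j)))
        \<le> (\<Sum>j\<in>{J1..<J}. 4 * 2 ^ j * real j ^ (4 * m + 2) * (2 ^ m / real d * R2 j + 1 / 2 ^ (j * m) * R1 j))"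
        unfolding distrib_right by (intro sum_mono mult_left_mono add_mono) auto
      also have "\<dots> = (\<Sum>j\<in>{J1..<J}. 4 * 2 ^ j * real j ^ (4 * m + 2) * (2 ^ m / real d * R2 j))
         + (\<Sum>j\<in>{J1..<J}. 4 * 2 ^ j * real j ^ (4 * m + 2) * (1 / 2 ^ (j * m) * R1 j))"
        by (simp only: distrib_left sum.distrib)
      also have "\<dots> \<le> exp (- real m) / 16 + exp (- real m) / 16"
      proof (rule add_mono)
        have "(\<Sum>j\<in>{J1..<J}. 4 * 2 ^ j * real j ^ (4 * m + 2) * (2 ^ m / real d * R2 j)) \<le>
            16 * 2 ^ m * A2 ^ m * (1 + 2 * ln (real d)) ^ (4 * m + 3) * real d powr (-(1/4))"
          unfolding R2_def using d1 by (intro secondary_block_sum_le m J(2) A20) auto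
        then show "(\<Sum>j\<in>{J1..<J}. 4 * 2 ^ j * real j ^ (4 * m + 2) * (2 ^ m / real d * R2 j)) \<le> exp (- real m) / 16"
          using D by linarith
        show "(\<Sum>j\<in>{J1..<J}. 4 * 2 ^ j * real j ^ (4 * m + 2) * (1 / 2 ^ (j * m) * R1 j)) \<le> exp (- real m) / 16"
          unfolding R1_def by (rule main_block_sum_le[OF m refl L mL \<delta>_def J1 A10 A1e])
      qed
      finally show "(\<Sum>j\<in>{J1..<J}. 4 * 2 ^ j * real j ^ (4 * m + 2) * ((2 ^ m / real d + 1 / 2 ^ (j * m)) * min (R1 j) (R2 j)))
        \<le> exp (- real m) / 16 + exp (- real m) / 16" .
    qed (use T in auto)
    finally show "real (card (large_primitive_chars d (T * (2 * real J1 + 11))))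
        \<le> real (totient d) / T ^ (2 * m) * (exp (- real m) / 4)" using c by simp
  qed
qed

section \<open>The distribution function\<close>

lemma sum_divisors_square_le:
  assumes q: "q > 0"
  shows "(\<Sum>d | d dvd q. (real d / real q)\<^sup>2) \<le> 2"
proof -
  have fin: "finite {d. d dvd q}" using q by simp
  have "(\<Sum>d | d dvd q. (real d / real q)\<^sup>2) = (\<Sum>r | r dvd q. 1 / (real r)\<^sup>2)"
  proof (rule sum.reindex_bij_witness[of _ "\<lambda>r. q div r" "\<lambda>d. q div d"])
    fix d assume d: "d \<in> {d. d dvd q}"
    then obtain k where k: "q = d * k" by auto
    then have "d > 0" "k > 0" using q by auto
    then show "1 / (real (q div d))\<^sup>2 = (real d / real q)\<^sup>2" using k by (simp add: power_divide)
  qed (use q in auto)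
  also have "\<dots> \<le> (\<Sum>r\<in>{1..<Suc q}. 1 / (real r)\<^sup>2)"
  proof (rule sum_mono2)
    show "{r. r dvd q} \<subseteq> {1..<Suc q}"
    proof
      fix r assume "r \<in> {r. r dvd q}"
      then show "r \<in> {1..<Suc q}" using q dvd_imp_le[of r q] dvd_pos_nat[of q r] by simp
    qed
  qed auto
  also have "\<dots> \<le> 2" by (rule sum_inverse_squares_le) simp
  finally show ?thesis .
qed

lemma norm_partial_sum_primitive_le:
  assumes \<psi>: "primitive_char d \<psi>" and d: "d > 1"
  shows "cmod (\<Sum>n=1..t. \<psi> n) \<le> real d"
proof -
  have \<psi>': "dirichlet_char d \<psi>" using \<psi> by (simp add: primitive_char_def)
  have "cmod (\<Sum>n=1..t. \<psi> n) = cmod (\<Sum>n=1..t mod d. \<psi> n)" by (subst char_partial_sum_periodic[OF \<psi> d]) simp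
  also have "\<dots> \<le> (\<Sum>n=1..t mod d. 1)"
    by (rule sum_norm_le) (use norm_dirichlet_char_le_1[OF \<psi>'] d in auto)
  also have "\<dots> \<le> real d" using d by (simp add: less_imp_le)
  finally show ?thesis .
qed

text \<open>Conductor \<open>d\<close> costs \<open>T = (q / d) powr (1/4)\<close> in the descent,
  but primitive sums are measured against \<open>sqrt d\<close>, and \<open>sqrt q\<close> is
  \<open>T ^ 2 * sqrt d\<close>. One factor \<open>T\<close> thus remains to raise the threshold for
  the primitive character.\<close>

lemma card_large_chars_le:
  assumes m: "m \<ge> 4" and L: "ln (real m) \<ge> 2" and mL: "real m \<ge> 16 * ln (real m)"
    and J1: "real J1 \<ge> 10000 * (ln (real m))\<^sup>2" and \<alpha>: "\<alpha> \<ge> 2 ^ 16 * (2 * real J1 + 11)"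
  shows "\<forall>\<^sub>F q in sequentially. real (card {\<chi>. dirichlet_char q \<chi> \<and> \<chi> \<noteq> principal_char q \<and>
      (\<exists>t. cmod (\<Sum>n=1..t. \<chi> n) > \<alpha> * sqrt (real q))}) \<le> real (totient q) * (exp (- real m) / 2)"
proof -
  obtain D where D: "\<And>d T. d \<ge> D \<Longrightarrow> T \<ge> 1 \<Longrightarrow> real (card (large_primitive_chars d (T * (2 * real J1 + 11))))
    \<le> real (totient d) / T ^ (2 * m) * (exp (- real m) / 4)"
    using card_large_primitive_chars_le[OF _ L mL J1] m by auto
  have "\<forall>\<^sub>F x::real in at_top. 2 ^ 16 * x powr (1/4) * real D \<le> sqrt x" by real_asymp
  then have "\<forall>\<^sub>F q in sequentially. 2 ^ 16 * real q powr (1/4) * real D \<le> sqrt (real q)"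
    by (rule eventually_compose_filterlim[OF _ filterlim_real_sequentially])
  then show ?thesis using eventually_gt_at_top[of 0]
  proof eventually_elim
    case (elim q)
    then have q: "q > 0" and qD: "2 ^ 16 * real q powr (1/4) * real D \<le> sqrt (real q)" by auto
    define T where "T d = (real q / real d) powr (1/4)" for d
    define P where "P d = large_primitive_chars d (T d * (2 * real J1 + 11))" for d
    define DD where "DD = {d. d dvd q \<and> d \<ge> D}"
    have fD: "finite DD" using q by (simp add: DD_def)
    have d0: "d > 0" "d \<le> q" if "d dvd q" for d using that q by (auto intro: dvd_pos_nat dvd_imp_le)
    have T1: "T d \<ge> 1" if "d dvd q" for d
      unfolding T_def using d0[OF that] by (intro ge_one_powr_ge_zero) auto
    have fP: "finite (P d)" if "d \<in> DD" for d
      unfolding P_def using that d0 by (intro finite_large_primitive_chars) (auto simp: DD_def)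
    let ?ind = "\<lambda>\<psi> n. if coprime n q then \<psi> n else (0::complex)"
    have "{\<chi>. dirichlet_char q \<chi> \<and> \<chi> \<noteq> principal_char q \<and> (\<exists>t. cmod (\<Sum>n=1..t. \<chi> n) > \<alpha> * sqrt (real q))}
      \<subseteq> (\<Union>d\<in>DD. ?ind ` P d)"
    proof clarify
      fix \<chi> t assume \<chi>: "dirichlet_char q \<chi>" "\<chi> \<noteq> principal_char q" and t: "cmod (\<Sum>n=1..t. \<chi> n) > \<alpha> * sqrt (real q)"
      obtain d \<psi> where d: "d dvd q" "d > 1" "primitive_char d \<psi>" and ind: "\<And>n. \<chi> n = (if coprime n q then \<psi> n else 0)"
        and bd: "\<And>X t. \<forall>t. cmod (\<Sum>n=1..t. \<psi> n) \<le> X \<Longrightarrow>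
          cmod (\<Sum>n=1..t. \<chi> n) \<le> 2 ^ 16 * (real q / real d) powr (1/4) * X"
        using inducing_primitive_char[OF \<chi>(1) q \<chi>(2)] by metis
      have dq: "d \<le> q" using d0 d by auto
      have "d \<ge> D"
      proof (rule ccontr)
        assume "\<not> D \<le> d"
        have "\<forall>t. cmod (\<Sum>n=1..t. \<psi> n) \<le> real D"
          using norm_partial_sum_primitive_le[OF d(3,2)] \<open>\<not> D \<le> d\<close> by (meson le_cases of_nat_mono order_trans)
        from bd[OF this, of t] have "cmod (\<Sum>n=1..t. \<chi> n) \<le> 2 ^ 16 * (real q / real d) powr (1/4) * real D" .
        also have "\<dots> \<le> 2 ^ 16 * real q powr (1/4) * real D"
          using d q by (intro mult_right_mono mult_left_mono powr_mono2) (auto simp: divide_le_eq mult_le_cancel_left1)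
        also have "\<dots> \<le> 1 * sqrt (real q)" using qD by simp
        also have "\<dots> \<le> \<alpha> * sqrt (real q)" using \<alpha> by (intro mult_right_mono) auto
        finally show False using t by simp
      qed
      moreover have "\<psi> \<in> P d"
      proof (rule ccontr)
        assume "\<psi> \<notin> P d"
        then have "\<forall>t. cmod (\<Sum>n=1..t. \<psi> n) \<le> sqrt (real d) * (T d * (2 * real J1 + 11))"
          using d(3) unfolding P_def large_primitive_chars_def by (auto simp: not_less)
        from bd[OF this, of t] have "cmod (\<Sum>n=1..t. \<chi> n) \<le> 2 ^ 16 * T d * (sqrt (real d) * (T d * (2 * real J1 + 11)))"
          by (simp only: T_def)
        also have "\<dots> = 2 ^ 16 * (2 * real J1 + 11) * (T d * T d * sqrt (real d))" by (simp only: mult_ac)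
        also have "T d * T d * sqrt (real d) = sqrt (real q)"
        proof -
          have "T d * T d = sqrt (real q / real d)"
            unfolding T_def by (simp add: powr_half_sqrt flip: powr_add)
          then show ?thesis using d by (simp add: real_sqrt_divide)
        qed
        also have "2 ^ 16 * (2 * real J1 + 11) * sqrt (real q) \<le> \<alpha> * sqrt (real q)"
          by (intro mult_right_mono \<alpha>) auto
        finally show False using t by simp
      qed
      moreover have "\<chi> = ?ind \<psi>" using ind by auto
      ultimately show "\<chi> \<in> (\<Union>d\<in>DD. ?ind ` P d)" using d(1) unfolding DD_def by blast
    qed
    then have "card {\<chi>. dirichlet_char q \<chi> \<and> \<chi> \<noteq> principal_char q \<and> (\<exists>t. cmod (\<Sum>n=1..t. \<chi> n) > \<alpha> * sqrt (real q))}
      \<le> card (\<Union>d\<in>DD. ?ind ` P d)"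
      using fD fP by (intro card_mono) auto
    also have "\<dots> \<le> (\<Sum>d\<in>DD. card (?ind ` P d))" by (rule card_UN_le[OF fD])
    also have "\<dots> \<le> (\<Sum>d\<in>DD. card (P d))" by (intro sum_mono card_image_le fP)
    finally have c: "card {\<chi>. dirichlet_char q \<chi> \<and> \<chi> \<noteq> principal_char q \<and> (\<exists>t. cmod (\<Sum>n=1..t. \<chi> n) > \<alpha> * sqrt (real q))}
      \<le> (\<Sum>d\<in>DD. card (P d))" .
    have "real (card {\<chi>. dirichlet_char q \<chi> \<and> \<chi> \<noteq> principal_char q \<and> (\<exists>t. cmod (\<Sum>n=1..t. \<chi> n) > \<alpha> * sqrt (real q))})
      \<le> (\<Sum>d\<in>DD. real (card (P d)))" using of_nat_mono[OF c, where 'a = real] by (simp only: of_nat_sum)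
    also have "\<dots> \<le> (\<Sum>d\<in>DD. real (totient q) * (exp (- real m) / 4) * (real d / real q)\<^sup>2)"
    proof (rule sum_mono)
      fix d assume d: "d \<in> DD"
      then have dq: "d dvd q" "d \<ge> D" by (auto simp: DD_def)
      have "real (card (P d)) \<le> real (totient d) / T d ^ (2 * m) * (exp (- real m) / 4)"
        unfolding P_def by (rule D[OF dq(2) T1[OF dq(1)]])
      \<comment> \<open>\<open>m \<ge> 4\<close> is used here: \<open>T d ^ 8\<close> is
        \<open>(q / d) ^ 2\<close>, and the inverse squares of the divisors \<open>q / d\<close>
        have sum at most \<open>2\<close>.\<close>
      also have "\<dots> \<le> real (totient q) / T d ^ 8 * (exp (- real m) / 4)"
      proof (intro mult_right_mono frac_le power_increasing T1 dq)
        have "totient d dvd totient q" by (rule totient_dvd[OF dq(1)])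
        then show "real (totient d) \<le> real (totient q)" using q by (intro of_nat_mono dvd_imp_le) auto
        show "0 < T d ^ 8" using T1[OF dq(1)] by (intro zero_less_power) linarith
      qed (use m in auto)
      also have "T d ^ 8 = (real q / real d)\<^sup>2"
      proof -
        have pos: "real q / real d > 0" using d0[OF dq(1)] q by simp
        then have "T d ^ 8 = (real q / real d) powr 2" unfolding T_def using d0[OF dq(1)] q by (subst powr_power) auto
        also have "\<dots> = (real q / real d)\<^sup>2" by (rule powr_numeral[OF less_imp_le[OF pos]])
        finally show ?thesis .
      qed
      also have "real (totient q) / (real q / real d)\<^sup>2 * (exp (- real m) / 4) =
          real (totient q) * (exp (- real m) / 4) * (real d / real q)\<^sup>2"
        by (simp add: power_divide mult_ac)
      finally show "real (card (P d)) \<le> real (totient q) * (exp (- real m) / 4) * (real d / real q)\<^sup>2" .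
    qed
    also have "\<dots> = real (totient q) * (exp (- real m) / 4) * (\<Sum>d\<in>DD. (real d / real q)\<^sup>2)"
      by (simp add: sum_distrib_left)
    also have "\<dots> \<le> real (totient q) * (exp (- real m) / 4) * 2"
    proof (rule mult_left_mono)
      have "(\<Sum>d\<in>DD. (real d / real q)\<^sup>2) \<le> (\<Sum>d | d dvd q. (real d / real q)\<^sup>2)"
        using q by (intro sum_mono2) (auto simp: DD_def)
      also have "\<dots> \<le> 2" by (rule sum_divisors_square_le[OF q])
      finally show "(\<Sum>d\<in>DD. (real d / real q)\<^sup>2) \<le> 2" .
    qed simp
    finally show ?case by simp
  qed
qed

section \<open>From exceptional characters to \<open>F_mod\<close>\<close>

lemma char_sum_eq: "char_sum \<chi> t = (\<Sum>n=1..nat \<lfloor>t\<rfloor>. \<chi> n)"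
proof -
  have "real n \<le> t \<longleftrightarrow> n \<le> nat \<lfloor>t\<rfloor>" if "1 \<le> n" for n
  proof -
    have "real n \<le> t \<longleftrightarrow> int n \<le> \<lfloor>t\<rfloor>" by (simp add: le_floor_iff)
    also have "\<dots> \<longleftrightarrow> n \<le> nat \<lfloor>t\<rfloor>" using that by linarith
    finally show ?thesis .
  qed
  then have "{n::nat. 1 \<le> n \<and> real n \<le> t} = {1..nat \<lfloor>t\<rfloor>}" by auto
  then show ?thesis by (simp add: char_sum_def)
qed

text \<open>Every character is principal, good or exceptional, so
  \<open>totient q \<le> 1 + card G + card W\<close>. The \<open>1\<close> for the principal
  character matches the denominator of \<open>F_mod\<close>.\<close>

lemma F_mod_ge:
  assumes m: "m \<ge> 4" and L: "ln (real m) \<ge> 2" and mL: "real m \<ge> 16 * ln (real m)"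
    and J1: "real J1 \<ge> 10000 * (ln (real m))\<^sup>2" and \<alpha>: "\<alpha> \<ge> 2 ^ 16 * (2 * real J1 + 11)"
  shows "\<forall>\<^sub>F q in sequentially. totient q > 1 \<longrightarrow> F_mod q \<alpha> \<ge> 1 - exp (- real m)"
  using card_large_chars_le[OF m L mL J1 \<alpha>] eventually_gt_at_top[of 0]
proof eventually_elim
  case (elim q)
  show ?case
  proof
    assume tq: "1 < totient q"
    have q: "q > 0" using elim by simp
    define All where "All = {\<chi>. dirichlet_char q \<chi>}"
    define G where "G = {\<chi>. dirichlet_char q \<chi> \<and> \<chi> \<noteq> principal_char q \<and> max_char_sum \<chi> \<le> \<alpha> * sqrt (real q)}"
    define W where "W = {\<chi>. dirichlet_char q \<chi> \<and> \<chi> \<noteq> principal_char q \<and> (\<exists>t. cmod (\<Sum>n=1..t. \<chi> n) > \<alpha> * sqrt (real q))}"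
    have fA: "finite All" unfolding All_def by (rule finite_dirichlet_chars[OF q])
    have fin: "finite G" "finite W" using fA by (auto simp: G_def W_def All_def elim!: rev_finite_subset)
    have "All \<subseteq> insert (principal_char q) (G \<union> W)"
    proof
      fix \<chi> assume "\<chi> \<in> All"
      moreover have "max_char_sum \<chi> \<le> \<alpha> * sqrt (real q)"
        if "\<And>t. cmod (\<Sum>n=1..t. \<chi> n) \<le> \<alpha> * sqrt (real q)"
        unfolding max_char_sum_def char_sum_eq using that by (intro cSUP_least) auto
      ultimately show "\<chi> \<in> insert (principal_char q) (G \<union> W)"
        unfolding All_def G_def W_def by (auto simp: not_less[symmetric])
    qed
    then have "card All \<le> card (insert (principal_char q) (G \<union> W))"
      using fin by (intro card_mono) auto
    also have "\<dots> \<le> Suc (card (G \<union> W))" by (rule card_insert_le_m1) auto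
    also have "\<dots> \<le> Suc (card G + card W)" using card_Un_le by simp
    finally have "totient q \<le> Suc (card G + card W)"
      using totient_le_card_dirichlet_chars[OF q] unfolding All_def by linarith
    then have "real (totient q) - 1 \<le> real (card G) + real (card W)" by linarith
    moreover have "real (card W) \<le> real (totient q) * (exp (- real m) / 2)" using elim unfolding W_def by simp
    \<comment> \<open>The factor \<open>1 / 2\<close> pays for passing from \<open>totient q\<close>
      to \<open>totient q - 1\<close>, at least half as large when
      \<open>totient q \<ge> 2\<close>.\<close>
    moreover have "real (totient q) * (exp (- real m) / 2) \<le> (real (totient q) - 1) * exp (- real m)"
    proof -
      have "(real (totient q) / 2) * exp (- real m) \<le> (real (totient q) - 1) * exp (- real m)"
        using tq by (intro mult_right_mono) auto
      then show ?thesis by simp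
    qed
    ultimately have "(1 - exp (- real m)) * (real (totient q) - 1) \<le> real (card G)"
      by (simp add: algebra_simps)
    then show "F_mod q \<alpha> \<ge> 1 - exp (- real m)"
      using tq unfolding F_mod_def G_def by (simp add: le_divide_eq)
  qed
qed

text \<open>\<open>B = 1\<close> and \<open>E = 0\<close> suffice:
  \<open>2 * ln (ln \<alpha>) / ln \<alpha>\<close> is eventually at most \<open>1\<close>, so a
  proportion of exceptions at most \<open>exp (- m)\<close> with
  \<open>m \<ge> exp (x \<alpha>)\<close> is already stronger than required.\<close>

theorem mainTheorem4:
  "\<exists>B::real. B > 0 \<and>
     (\<exists>E :: real \<Rightarrow> real. E \<in> O[at_top](\<lambda>\<alpha>. 1 / ln \<alpha>) \<and>
       (\<forall>\<^sub>F \<alpha> in at_top.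
          F_lim \<alpha> \<ge>
            ereal (1 - exp (- exp (B * \<alpha> powr (1/2) / (ln \<alpha>) powr (1/4))
                             * (2 * ln (ln \<alpha>) / ln \<alpha> + E \<alpha>)))))"
proof (intro exI[of _ "1::real"] conjI exI[of _ "\<lambda>_. 0::real"])
  define x where "x \<alpha> = \<alpha> powr (1/2) / ln \<alpha> powr (1/4)" for \<alpha> :: real
  have X: "filterlim (\<lambda>\<alpha>. exp (x \<alpha>)) at_top at_top" unfolding x_def by real_asymp
  \<comment> \<open>The square of \<open>x \<alpha>\<close> is \<alpha> divided by
    \<open>sqrt (ln \<alpha>)\<close>, of smaller order than \<alpha>. This is where the power of
    \<open>ln \<alpha>\<close> absorbs the constants.\<close>
  have "\<forall>\<^sub>F \<alpha> in at_top. 10000 * (x \<alpha> + 1)\<^sup>2 \<le> \<alpha> / 2 ^ 18 - 1" unfolding x_def by real_asymp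
  moreover have "\<forall>\<^sub>F \<alpha>::real in at_top. 2 * ln (ln \<alpha>) / ln \<alpha> \<le> 1" by real_asymp
  moreover have "\<forall>\<^sub>F \<alpha> in at_top. 16 * ln (2 * exp (x \<alpha>)) \<le> exp (x \<alpha>)"
  proof -
    have "\<forall>\<^sub>F y::real in at_top. 16 * ln (2 * y) \<le> y" by real_asymp
    from eventually_compose_filterlim[OF this X] show ?thesis .
  qed
  moreover have "\<forall>\<^sub>F \<alpha> in at_top. exp (x \<alpha>) \<ge> exp 2"
    by (rule eventually_compose_filterlim[OF eventually_ge_at_top X])
  moreover have "\<forall>\<^sub>F \<alpha>::real in at_top. \<alpha> \<ge> 11 * 2 ^ 20" by (rule eventually_ge_at_top)
  ultimately show "\<forall>\<^sub>F \<alpha> in at_top. F_lim \<alpha> \<ge>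
      ereal (1 - exp (- exp (1 * \<alpha> powr (1/2) / (ln \<alpha>) powr (1/4)) * (2 * ln (ln \<alpha>) / ln \<alpha> + 0)))"
  proof eventually_elim
    case (elim \<alpha>)
    define m where "m = nat \<lceil>exp (x \<alpha>)\<rceil>"
    \<comment> \<open>With \<open>2 ^ 18\<close> the term \<open>2 ^ 17 * J1\<close> uses at most
      half of \<alpha>, leaving the other half for \<open>11 * 2 ^ 16\<close>.\<close>
    define J1 where "J1 = nat \<lfloor>\<alpha> / 2 ^ 18\<rfloor>"
    have e4: "exp (x \<alpha>) \<ge> 4"
    proof -
      have "(4::real) = exp (2 * ln 2)" by (simp add: exp_double)
      also have "\<dots> \<le> exp 2" using ln_2_less_1 by simp
      finally show ?thesis using elim by linarith
    qed
    have m1: "exp (x \<alpha>) \<le> real m" "real m \<le> exp (x \<alpha>) + 1" unfolding m_def using e4 by linarith+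
    have m2: "real m \<le> 2 * exp (x \<alpha>)" using m1 e4 by linarith
    have mpos: "real m > 0" using m1 e4 by linarith
    have x2: "2 \<le> x \<alpha>" using elim by simp
    have "x \<alpha> \<le> ln (real m)" using m1 mpos by (simp add: ln_ge_iff)
    then have L2: "2 \<le> ln (real m)" using x2 by linarith
    have "ln (real m) \<le> ln (2 * exp (x \<alpha>))" using m2 mpos by (subst ln_le_cancel_iff) auto
    then have mL: "16 * ln (real m) \<le> real m" using elim m1 by linarith
    have "ln (2 * exp (x \<alpha>)) = ln 2 + x \<alpha>" by (simp add: ln_mult)
    then have "ln (real m) \<le> x \<alpha> + 1" using \<open>ln (real m) \<le> ln (2 * exp (x \<alpha>))\<close> ln_2_less_1 by linarith
    then have "(ln (real m))\<^sup>2 \<le> (x \<alpha> + 1)\<^sup>2" using L2 by (intro power_mono) auto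
    moreover have "real J1 \<ge> \<alpha> / 2 ^ 18 - 1" unfolding J1_def by linarith
    ultimately have J1: "10000 * (ln (real m))\<^sup>2 \<le> real J1" using elim by linarith
    have "real J1 \<le> \<alpha> / 2 ^ 18" unfolding J1_def using elim by (intro of_nat_floor) simp
    then have \<alpha>: "\<alpha> \<ge> 2 ^ 16 * (2 * real J1 + 11)" using elim by simp
    have m4: "m \<ge> 4" using m1 e4 by linarith
    have "\<forall>\<^sub>F q in inf sequentially (principal {q. totient q > 1}). ereal (1 - exp (- real m)) \<le> ereal (F_mod q \<alpha>)"
      unfolding eventually_inf_principal
      using F_mod_ge[OF m4 L2 mL J1 \<alpha>] by eventually_elim auto
    then have "ereal (1 - exp (- real m)) \<le> F_lim \<alpha>"
      unfolding F_lim_def by (rule Liminf_bounded)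
    moreover have "1 - exp (- exp (x \<alpha>) * (2 * ln (ln \<alpha>) / ln \<alpha>)) \<le> 1 - exp (- real m)"
    proof -
      have "exp (x \<alpha>) * (2 * ln (ln \<alpha>) / ln \<alpha>) \<le> exp (x \<alpha>) * 1" using elim by (intro mult_left_mono) auto
      then show ?thesis using m1 by simp
    qed
    ultimately have "ereal (1 - exp (- exp (x \<alpha>) * (2 * ln (ln \<alpha>) / ln \<alpha>))) \<le> F_lim \<alpha>"
      using order_trans ereal_less_eq(3) by blast
    then show ?case by (simp add: x_def)
  qed
qed auto

end
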